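(* Let $\mathcal{H}$ be a Hilbert space, let $(P_\lambda)_{\lambda\in\Lambda}\subset\mathcal{B}(\mathcal{H})$ be an orthogonal family of projections with sum $I$, let $\mathfrak{A}=\{P_\lambda:\lambda\in\Lambda\}'\cap\mathcal{K}(\mathcal{H})$, and let $\mathfrak{B}$ be a compact $C^*$-algebra. Suppose that $T\colon\mathfrak{A}\to\mathfrak{B}$ is a (not necessarily linear) strong BJ isomorphism. Then there exists a linear $*$-isomorphism $\Psi\colon\mathfrak{B}\to\mathfrak{A}$ such that $(\Psi\circ T)\bigl(\sum_{\lambda\in\Lambda_0}\mathfrak{A}P_\lambda\bigr)=\sum_{\lambda\in\Lambda_0}\mathfrak{A}P_\lambda$ for each $\Lambda_0\subset\Lambda$.
   Context: $\mathcal{H}$ is a complex Hilbert space; $\mathcal{B}(\mathcal{H})$ and $\mathcal{K}(\mathcal{H})$ are the bounded and compact operators; $X'$ is the commutant of $X$ in $\mathcal{B}(\mathcal{H})$. An orthogonal family of projections with sum $I$ consists of pairwise orthogonal projections with $\sum_{\lambda}P_\lambda=I$ in the strong-operator topology. For $\Lambda_0\subset\Lambda$, $\sum_{\lambda\in\Lambda_0}\mathfrak{A}P_\lambda$ denotes $\{A\in\mathfrak{A}: AP_\lambda=0\text{ for all }\lambda\in\Lambda\setminus\Lambda_0\}$. A $C^*$-algebra is compact if it is $*$-isomorphic to a $C^*$-subalgebra of the algebra of compact operators on some Hilbert space. For elements $x,y$ of a $C^*$-algebra $\mathfrak{C}$, $x\perp_{BJ}^s y$ means $\|x+yz\|\ge\|x\|$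 for each $z\in\mathfrak{C}$. A map between $C^*$-algebras is a strong BJ isomorphism if it is bijective and preserves $\perp_{BJ}^s$ in both directions ($x\perp_{BJ}^s y$ iff the images satisfy the same relation). *)

theory Defs
  imports "HOL-Analysis.Analysis"
begin

section \<open>Complex Hilbert spaces\<close>

class complex_vector = real_vector +
  fixes scaleC :: "complex \<Rightarrow> 'a \<Rightarrow> 'a"  (infixr \<open>*\<^sub>C\<close> 75)
  assumes scaleC_add_right: "c *\<^sub>C (x + y) = c *\<^sub>C x + c *\<^sub>C y"
    and scaleC_add_left: "(c + d) *\<^sub>C x = c *\<^sub>C x + d *\<^sub>C x"
    and scaleC_scaleC: "c *\<^sub>C d *\<^sub>C x = (c * d) *\<^sub>C x"
    and scaleC_of_real: "of_real r *\<^sub>C x = r *\<^sub>R x"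

text \<open>
  The inner product is linear in the first argument. Positive definiteness and
  \<open>norm x = sqrt (Re (cinner x x))\<close> are inherited from \<^class>\<open>real_inner\<close> through
  the last axiom.
\<close>

class complex_inner = real_inner + complex_vector +
  fixes cinner :: "'a \<Rightarrow> 'a \<Rightarrow> complex"
  assumes cinner_commute: "cinner x y = cnj (cinner y x)"
    and cinner_add_left: "cinner (x + y) z = cinner x z + cinner y z"
    and cinner_scaleC_left: "cinner (c *\<^sub>C x) y = c * cinner x y"
    and Re_cinner: "Re (cinner x y) = x \<bullet> y"

class complex_hilbert_space = complex_inner + complete_space
begin

subclass banach ..

end

instantiation complex :: complex_hilbert_space
begin

definition scaleC_complex :: "complex \<Rightarrow> complex \<Rightarrow> complex"
  where "scaleC_complex c x = c * x"

definition cinner_complex :: "complex \<Rightarrow> complex \<Rightarrow> complex"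
  where "cinner_complex x y = x * cnj y"

instance
  by standard
    (auto simp: scaleC_complex_def cinner_complex_def inner_complex_def algebra_simps scaleR_conv_of_real)

end


section \<open>\<open>C\<^sup>*\<close>-algebras\<close>

text \<open>\<^class>\<open>real_normed_algebra\<close> does not require a unit, and neither does this class.\<close>

class cstar_algebra = real_normed_algebra + banach + complex_vector +
  fixes star :: "'a \<Rightarrow> 'a"
  assumes norm_scaleC: "norm (c *\<^sub>C x) = cmod c * norm x"
    and mult_scaleC_left: "(c *\<^sub>C x) * y = c *\<^sub>C (x * y)"
    and mult_scaleC_right: "x * (c *\<^sub>C y) = c *\<^sub>C (x * y)"
    and star_star: "star (star x) = x"
    and star_add: "star (x + y) = star x + star y"
    and star_scaleC: "star (c *\<^sub>C x) = cnj c *\<^sub>C star x"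
    and star_mult: "star (x * y) = star y * star x"
    and cstar_identity: "norm (star x * x) = (norm x)\<^sup>2"

definition cstar_subalgebra :: "'a::cstar_algebra set \<Rightarrow> bool"
  where "cstar_subalgebra A \<longleftrightarrow>
    0 \<in> A \<and> closed A \<and>
    (\<forall>x\<in>A. \<forall>y\<in>A. x + y \<in> A \<and> x * y \<in> A) \<and>
    (\<forall>x\<in>A. star x \<in> A \<and> (\<forall>c. c *\<^sub>C x \<in> A))"

definition star_isomorphism ::
    "'a::cstar_algebra set \<Rightarrow> 'b::cstar_algebra set \<Rightarrow> ('a \<Rightarrow> 'b) \<Rightarrow> bool"
  where "star_isomorphism A B \<phi> \<longleftrightarrow>
    bij_betw \<phi> A B \<and>
    (\<forall>x\<in>A. \<forall>y\<in>A. \<phi> (x + y) = \<phi> x + \<phi> y \<and> \<phi> (x * y) = \<phi> x * \<phi> y) \<and>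
    (\<forall>x\<in>A. \<phi> (star x) = star (\<phi> x) \<and> (\<forall>c. \<phi> (c *\<^sub>C x) = c *\<^sub>C \<phi> x))"

text \<open>The relation depends on the algebra \<open>C\<close> over which \<open>z\<close> ranges.\<close>

definition strong_BJ_orthogonal :: "'a::cstar_algebra set \<Rightarrow> 'a \<Rightarrow> 'a \<Rightarrow> bool"
  where "strong_BJ_orthogonal C x y \<longleftrightarrow> (\<forall>z\<in>C. norm (x + y * z) \<ge> norm x)"

definition strong_BJ_isomorphism ::
    "'a::cstar_algebra set \<Rightarrow> 'b::cstar_algebra set \<Rightarrow> ('a \<Rightarrow> 'b) \<Rightarrow> bool"
  where "strong_BJ_isomorphism A B T \<longleftrightarrow>
    bij_betw T A B \<and>
    (\<forall>x\<in>A. \<forall>y\<in>A. strong_BJ_orthogonal A x y \<longleftrightarrow> strong_BJ_orthogonal B (T x) (T y))"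


section \<open>Riesz representation and adjoints\<close>

lemma Cauchy_if_minimizing:
  fixes X :: "nat \<Rightarrow> 'a::real_inner"
  assumes f: "bounded_linear f"
    and lower: "\<And>x. m \<le> (norm x)\<^sup>2 / 2 - f x"
    and X: "\<And>n. (norm (X n))\<^sup>2 / 2 - f (X n) < m + inverse (real (Suc n))"
  shows "Cauchy X"
proof (rule metric_CauchyI)
  interpret bounded_linear f by (rule f)
  fix e :: real
  assume e: "0 < e"
  then obtain N where N: "inverse (real (Suc N)) < e\<^sup>2 / 8"
    using reals_Archimedean[of "e\<^sup>2 / 8"] by auto
  show "\<exists>M. \<forall>i\<ge>M. \<forall>j\<ge>M. dist (X i) (X j) < e"
  proof (intro exI[of _ N] allI impI)
    fix i j
    assume ij: "N \<le> i" "N \<le> j"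
    have arith: "D < c" if "D / 4 = gi + gj - 2 * gk" "gi < m + p" "gj < m + q" "m \<le> gk"
      "r < c / 8" "p \<le> r" "q \<le> r" for D gi gj gk p q r c :: real
      using that by linarith
    have par: "(norm (X i - X j))\<^sup>2 / 4 = ((norm (X i))\<^sup>2 / 2 - f (X i)) + ((norm (X j))\<^sup>2 / 2 - f (X j))
        - 2 * ((norm ((X i + X j) /\<^sub>R 2))\<^sup>2 / 2 - f ((X i + X j) /\<^sub>R 2))"
      by (simp add: power2_norm_eq_inner inner_add_left inner_add_right inner_diff_left
          inner_diff_right scaleR add inner_commute field_simps)
    have "inverse (real (Suc i)) \<le> inverse (real (Suc N))" "inverse (real (Suc j)) \<le> inverse (real (Suc N))"
      using ij by (auto intro!: le_imp_inverse_le)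
    then have "(norm (X i - X j))\<^sup>2 < e\<^sup>2"
      by (rule arith[OF par X[of i] X[of j] lower[of "(X i + X j) /\<^sub>R 2"] N])
    with e show "dist (X i) (X j) < e"
      by (simp add: dist_norm power2_less_imp_less)
  qed
qed

lemma linear_coeff_zero_if_quadratic_nonneg:
  fixes a b :: real
  assumes "\<And>t. 0 \<le> t * a + t\<^sup>2 * b"
  shows "a = 0"
proof (rule ccontr)
  assume a: "a \<noteq> 0"
  define c where "c = \<bar>b\<bar> + 1"
  define t where "t = - a / (2 * c)"
  have pos: "0 < c" and "b \<le> c" by (auto simp: c_def)
  then have "t * a + t\<^sup>2 * b \<le> t * a + t\<^sup>2 * c"
    by (intro add_left_mono mult_left_mono) auto
  also have "\<dots> = - (a\<^sup>2 / (4 * c))"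
    using pos unfolding t_def by (simp add: power2_eq_square field_simps)
  also have "\<dots> < 0"
    using a pos by simp
  finally show False
    using assms[of t] by simp
qed

lemma riesz_representation:
  fixes f :: "'a::{real_inner, complete_space} \<Rightarrow> real"
  assumes f: "bounded_linear f"
  obtains z where "\<And>x. f x = x \<bullet> z"
proof -
  interpret bounded_linear f by (rule f)
  define g where "g x = (norm x)\<^sup>2 / 2 - f x" for x
  have bound: "- (onorm f)\<^sup>2 / 2 \<le> g x" for x
  proof -
    have "f x \<le> onorm f * norm x"
      using onorm[OF f, of x] by simp
    moreover have "0 \<le> (norm x - onorm f)\<^sup>2" by simp
    ultimately show ?thesis
      unfolding g_def power2_diff by (simp add: field_simps)
  qed
  define m where "m = Inf (range g)"
  have bdd: "bdd_below (range g)"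
    using bound by (auto intro!: bdd_belowI)
  have lower: "m \<le> g x" for x
    unfolding m_def using bdd by (rule cInf_lower[rotated]) simp
  have "\<exists>x. g x < m + inverse (real (Suc n))" for n
    using cInf_lessD[of "range g" "m + inverse (real (Suc n))"] by (auto simp: m_def)
  then obtain X where X: "\<And>n. g (X n) < m + inverse (real (Suc n))"
    by metis
  have "Cauchy X"
    using f lower[unfolded g_def] X[unfolded g_def] by (rule Cauchy_if_minimizing)
  then obtain z where z: "X \<longlonglongrightarrow> z"
    using Cauchy_convergent convergent_def by blast
  have "(\<lambda>n. g (X n)) \<longlonglongrightarrow> g z"
    unfolding g_def by (intro tendsto_intros tendsto z) simp
  moreover have "(\<lambda>n. m + inverse (real (Suc n))) \<longlonglongrightarrow> m + 0"
    by (intro tendsto_add tendsto_const LIMSEQ_inverse_real_of_nat)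
  ultimately have "g z \<le> m + 0"
    by (rule LIMSEQ_le) (use X in \<open>auto intro!: less_imp_le\<close>)
  then have min: "g z \<le> g x" for x
    using lower[of x] by simp
  have "f x = x \<bullet> z" for x
  proof -
    have "g (z + t *\<^sub>R x) = g z + (t * (x \<bullet> z - f x) + t\<^sup>2 * ((norm x)\<^sup>2 / 2))" for t
      unfolding g_def power2_norm_eq_inner
      by (simp add: inner_add_left inner_add_right add scaleR inner_commute[of z x]
          power2_eq_square field_simps)
    then have "0 \<le> t * (x \<bullet> z - f x) + t\<^sup>2 * ((norm x)\<^sup>2 / 2)" for t
      using min[of "z + t *\<^sub>R x"] by simp
    then have "x \<bullet> z - f x = 0"
      by (rule linear_coeff_zero_if_quadratic_nonneg)
    then show ?thesis by simp
  qed
  then show thesis by (rule that)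
qed

lemma scaleC_one [simp]: "1 *\<^sub>C (x::'a::complex_vector) = x"
  using scaleC_of_real[of 1 x] by simp

lemma scaleC_scaleR: "c *\<^sub>C r *\<^sub>R (x::'a::complex_vector) = r *\<^sub>R c *\<^sub>C x"
  by (metis mult.commute scaleC_of_real scaleC_scaleC)

lemma scaleC_diff_right: "c *\<^sub>C (x - y) = c *\<^sub>C x - c *\<^sub>C (y::'a::complex_vector)"
  by (metis add_diff_cancel diff_add_cancel scaleC_add_right)

lemma scaleC_zero_right [simp]: "c *\<^sub>C 0 = (0::'a::complex_vector)"
  using scaleC_diff_right[of c 0 0] by simp

lemma scaleC_minus_right: "c *\<^sub>C (- x) = - (c *\<^sub>C (x::'a::complex_vector))"
  using scaleC_diff_right[of c 0 x] by simp

lemma cinner_scaleC_right: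
  fixes x y :: "'a::complex_inner"
  shows "cinner x (c *\<^sub>C y) = cnj c * cinner x y"
  by (metis cinner_commute cinner_scaleC_left complex_cnj_mult)

lemma cinner_add_right:
  fixes x y :: "'a::complex_inner"
  shows "cinner x (y + z) = cinner x y + cinner x z"
  by (metis cinner_add_left cinner_commute complex_cnj_add)

lemma cinner_self: "cinner x x = of_real ((norm (x::'a::complex_inner))\<^sup>2)"
proof (rule complex_eqI)
  have "Im (cinner x x) = - Im (cinner x x)"
    using arg_cong[OF cinner_commute[of x x], of Im] by simp
  then show "Im (cinner x x) = Im (of_real ((norm x)\<^sup>2))" by simp
qed (simp add: Re_cinner power2_norm_eq_inner)

lemma Im_cinner: "Im (cinner x y) = - ((\<i> *\<^sub>C x) \<bullet> (y::'a::complex_inner))"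
  using Re_cinner[of "\<i> *\<^sub>C x" y] by (simp add: cinner_scaleC_left)

lemma cinner_right_cancel:
  fixes y z :: "'a::complex_inner"
  assumes "\<And>x. cinner x y = cinner x z"
  shows "y = z"
proof -
  have "(y - z) \<bullet> y = (y - z) \<bullet> z"
    by (metis assms Re_cinner)
  then have "(y - z) \<bullet> (y - z) = 0"
    by (simp add: inner_diff_right)
  then show ?thesis by simp
qed

lemma norm_scaleC_complex_inner: "norm (c *\<^sub>C (x::'a::complex_inner)) = cmod c * norm x"
proof -
  have "complex_of_real ((norm (c *\<^sub>C x))\<^sup>2) = of_real ((cmod c * norm x)\<^sup>2)"
    unfolding power_mult_distrib of_real_mult cinner_self[symmetric, where 'a = 'a]
    using complex_norm_square[of c] by (simp add: cinner_scaleC_left cinner_scaleC_right mult.commute)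
  then have "(norm (c *\<^sub>C x))\<^sup>2 = (cmod c * norm x)\<^sup>2"
    using of_real_eq_iff by blast
  then show ?thesis
    by (simp add: power2_eq_iff_nonneg)
qed

lemma bounded_linear_scaleC: "bounded_linear ((*\<^sub>C) c :: 'a::complex_inner \<Rightarrow> 'a)"
  by (rule bounded_linear_intro[where K = "cmod c"])
    (simp_all add: scaleC_add_right scaleC_scaleR norm_scaleC_complex_inner)


section \<open>Bounded operators on a complex Hilbert space\<close>

text \<open>
  The library's type of bounded real-linear maps, with its operator norm, restricted to the
  complex-linear ones.
\<close>

typedef (overloaded) 'h bounded_operator =
  "{A :: 'h::complex_hilbert_space \<Rightarrow>\<^sub>L 'h. \<forall>c x. blinfun_apply A (c *\<^sub>C x) = c *\<^sub>C blinfun_apply A x}"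
  morphisms blinfun_of_op op_of_blinfun
  by (rule exI[of _ 0]) simp

setup_lifting type_definition_bounded_operator

lift_definition op_apply :: "'h::complex_hilbert_space bounded_operator \<Rightarrow> 'h \<Rightarrow> 'h"
  is blinfun_apply .

lemma op_eqI: "(\<And>x. op_apply A x = op_apply B x) \<Longrightarrow> A = B"
  by transfer (rule blinfun_eqI)

lemma op_eqI_cinner:
  assumes "\<And>x y. cinner x (op_apply A y) = cinner x (op_apply B y)"
  shows "A = B"
  by (rule op_eqI, rule cinner_right_cancel, rule assms)

lemma op_apply_scaleC: "op_apply A (c *\<^sub>C x) = c *\<^sub>C op_apply A x"
  by transfer simp

lemma bounded_linear_op_apply: "bounded_linear (op_apply A)"
  by transfer (rule blinfun.bounded_linear_right)

instantiation bounded_operator :: (complex_hilbert_space) real_normed_vector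
begin

lift_definition zero_bounded_operator :: "'a bounded_operator" is 0
  by simp

lift_definition plus_bounded_operator ::
    "'a bounded_operator \<Rightarrow> 'a bounded_operator \<Rightarrow> 'a bounded_operator" is "(+)"
  by (simp add: blinfun.bilinear_simps scaleC_add_right)

lift_definition minus_bounded_operator ::
    "'a bounded_operator \<Rightarrow> 'a bounded_operator \<Rightarrow> 'a bounded_operator" is "(-)"
  by (simp add: blinfun.bilinear_simps scaleC_diff_right)

lift_definition uminus_bounded_operator :: "'a bounded_operator \<Rightarrow> 'a bounded_operator" is uminus
  by (simp add: blinfun.bilinear_simps scaleC_minus_right)

lift_definition scaleR_bounded_operator ::
    "real \<Rightarrow> 'a bounded_operator \<Rightarrow> 'a bounded_operator" is "(*\<^sub>R)"
  by (simp add: blinfun.bilinear_simps scaleC_scaleR)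

lift_definition norm_bounded_operator :: "'a bounded_operator \<Rightarrow> real" is norm .

definition dist_bounded_operator :: "'a bounded_operator \<Rightarrow> 'a bounded_operator \<Rightarrow> real"
  where "dist_bounded_operator A B = norm (A - B)"

definition sgn_bounded_operator :: "'a bounded_operator \<Rightarrow> 'a bounded_operator"
  where "sgn_bounded_operator A = scaleR (inverse (norm A)) A"

definition uniformity_bounded_operator :: "('a bounded_operator \<times> 'a bounded_operator) filter"
  where "uniformity_bounded_operator = (INF e\<in>{0 <..}. principal {(x, y). dist x y < e})"

definition open_bounded_operator :: "'a bounded_operator set \<Rightarrow> bool"
  where "open_bounded_operator S \<longleftrightarrow> (\<forall>x\<in>S. \<forall>\<^sub>F (x', y) in uniformity. x' = x \<longrightarrow> y \<in> S)"

instance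
  apply standard
  unfolding dist_bounded_operator_def sgn_bounded_operator_def uniformity_bounded_operator_def
    open_bounded_operator_def
  apply (rule refl | (transfer, simp add: algebra_simps norm_triangle_ineq))+
  done

end

instance bounded_operator :: (complex_hilbert_space) banach
proof
  fix X :: "nat \<Rightarrow> 'a bounded_operator"
  assume "Cauchy X"
  have dist: "dist (blinfun_of_op A) (blinfun_of_op B) = dist A B" for A B :: "'a bounded_operator"
    unfolding dist_norm by transfer simp
  have "Cauchy (\<lambda>n. blinfun_of_op (X n))"
    using \<open>Cauchy X\<close> unfolding Cauchy_def dist .
  then obtain L where L: "(\<lambda>n. blinfun_of_op (X n)) \<longlonglongrightarrow> L"
    using Cauchy_convergent convergent_def by blast
  have lim: "(\<lambda>n. blinfun_apply (blinfun_of_op (X n)) x) \<longlonglongrightarrow> blinfun_apply L x" for x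
    by (intro tendsto_intros L)
  have "blinfun_apply L (c *\<^sub>C x) = c *\<^sub>C blinfun_apply L x" for c x
  proof (rule LIMSEQ_unique)
    show "(\<lambda>n. blinfun_apply (blinfun_of_op (X n)) (c *\<^sub>C x)) \<longlonglongrightarrow> blinfun_apply L (c *\<^sub>C x)"
      by (rule lim)
    have "blinfun_apply (blinfun_of_op (X n)) (c *\<^sub>C x) = c *\<^sub>C blinfun_apply (blinfun_of_op (X n)) x" for n
      using blinfun_of_op[of "X n"] by simp
    then show "(\<lambda>n. blinfun_apply (blinfun_of_op (X n)) (c *\<^sub>C x)) \<longlonglongrightarrow> c *\<^sub>C blinfun_apply L x"
      using bounded_linear.tendsto[OF bounded_linear_scaleC lim] by simp
  qed
  then have "blinfun_of_op (op_of_blinfun L) = L"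
    by (simp add: op_of_blinfun_inverse)
  then have "(\<lambda>n. dist (X n) (op_of_blinfun L)) = (\<lambda>n. dist (blinfun_of_op (X n)) L)"
    by (metis dist)
  then have "X \<longlonglongrightarrow> op_of_blinfun L"
    using L tendsto_dist_iff by metis
  then show "convergent X"
    unfolding convergent_def by blast
qed

lemma ex_adjoint:
  fixes A :: "'h::complex_hilbert_space bounded_operator"
  shows "\<exists>B. \<forall>x y. cinner (op_apply A x) y = cinner x (op_apply B y)"
proof -
  interpret A: bounded_linear "op_apply A" by (rule bounded_linear_op_apply)
  have "\<exists>z. \<forall>x. op_apply A x \<bullet> y = x \<bullet> z" for y
    using riesz_representation[OF bounded_linear_inner_left_comp[OF bounded_linear_op_apply]] by metis
  then obtain b where b: "\<And>x y. op_apply A x \<bullet> y = x \<bullet> b y"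
    by metis
  have adj: "cinner (op_apply A x) y = cinner x (b y)" for x y
    by (rule complex_eqI) (simp_all add: Re_cinner Im_cinner b flip: op_apply_scaleC)
  have add: "b (x + y) = b x + b y" for x y
    by (rule cinner_right_cancel) (simp add: cinner_add_right flip: adj)
  have scale: "b (c *\<^sub>C x) = c *\<^sub>C b x" for c x
    by (rule cinner_right_cancel) (simp add: cinner_scaleC_right flip: adj)
  have bound: "norm (b y) \<le> norm y * onorm (op_apply A)" for y
  proof (cases "b y = 0")
    case False
    have "norm (b y) * norm (b y) = op_apply A (b y) \<bullet> y"
      by (simp add: b power2_norm_eq_inner flip: power2_eq_square)
    also have "\<dots> \<le> norm (op_apply A (b y)) * norm y"
      by (rule norm_cauchy_schwarz)
    also have "\<dots> \<le> (onorm (op_apply A) * norm (b y)) * norm y"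
      by (intro mult_right_mono onorm bounded_linear_op_apply norm_ge_zero)
    finally show ?thesis
      using False by (simp add: mult.commute mult.left_commute)
  qed (simp add: onorm_pos_le[OF bounded_linear_op_apply])
  have "bounded_linear b"
    by (rule bounded_linear_intro[OF add _ bound]) (metis scale scaleC_of_real)
  then have "op_apply (op_of_blinfun (Blinfun b)) = b"
    by (simp add: op_apply.rep_eq op_of_blinfun_inverse bounded_linear_Blinfun_apply scale)
  with adj show ?thesis by metis
qed

instantiation bounded_operator :: (complex_hilbert_space) cstar_algebra
begin

lift_definition times_bounded_operator ::
    "'a bounded_operator \<Rightarrow> 'a bounded_operator \<Rightarrow> 'a bounded_operator" is "(o\<^sub>L)"
  by simp

lift_definition scaleC_bounded_operator :: "complex \<Rightarrow> 'a bounded_operator \<Rightarrow> 'a bounded_operator"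
  is "\<lambda>c A. Blinfun ((*\<^sub>C) c) o\<^sub>L A"
  by (simp add: bounded_linear_Blinfun_apply bounded_linear_scaleC scaleC_scaleC mult.commute)

definition star_bounded_operator :: "'a bounded_operator \<Rightarrow> 'a bounded_operator"
  where "star_bounded_operator A =
    (THE B. \<forall>x y. cinner (op_apply A x) y = cinner x (op_apply B y))"

lemma op_apply_plus [simp]: "op_apply (A + B) x = op_apply A x + op_apply B x"
  by transfer (simp add: blinfun.bilinear_simps)

lemma op_apply_times [simp]: "op_apply (A * B) x = op_apply A (op_apply B x)"
  by transfer simp

lemma op_apply_scaleC_left [simp]: "op_apply (c *\<^sub>C A) x = c *\<^sub>C op_apply A x"
  by transfer (simp add: bounded_linear_Blinfun_apply bounded_linear_scaleC)

lemma op_apply_scaleR_left [simp]: "op_apply (r *\<^sub>R A) x = r *\<^sub>R op_apply A x"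
  by transfer (simp add: blinfun.bilinear_simps)

lemma op_apply_add: "op_apply A (x + y) = op_apply A x + op_apply A y"
  by (rule linear_add[OF bounded_linear.linear[OF bounded_linear_op_apply]])

lemma op_apply_scaleR: "op_apply A (r *\<^sub>R x) = r *\<^sub>R op_apply A x"
  by (rule linear_scale[OF bounded_linear.linear[OF bounded_linear_op_apply]])

lemma norm_op_apply: "norm (op_apply A x) \<le> norm A * norm x"
  by transfer (rule norm_blinfun)

lemma norm_op_bound: "0 \<le> b \<Longrightarrow> (\<And>x. norm (op_apply A x) \<le> b * norm x) \<Longrightarrow> norm A \<le> b"
  by transfer (rule norm_blinfun_bound)

lemma cinner_star_right:
  fixes A :: "'a bounded_operator"
  shows "cinner x (op_apply (star A) y) = cinner (op_apply A x) y"
proof -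
  obtain B where B: "\<forall>x y. cinner (op_apply A x) y = cinner x (op_apply B y)"
    using ex_adjoint[of A] by (rule exE)
  have "star A = B"
    unfolding star_bounded_operator_def
  proof (rule the_equality)
    fix C
    assume C: "\<forall>x y. cinner (op_apply A x) y = cinner x (op_apply C y)"
    show "C = B"
    proof (rule op_eqI_cinner)
      show "cinner x (op_apply C y) = cinner x (op_apply B y)" for x y
        using B[rule_format, of x y] C[rule_format, of x y] by simp
    qed
  qed (rule B)
  with B show ?thesis by simp
qed

lemma cinner_star_left:
  fixes A :: "'a bounded_operator"
  shows "cinner (op_apply (star A) x) y = cinner x (op_apply A y)"
  using cinner_commute[of "op_apply (star A) x" y] cinner_commute[of x "op_apply A y"]
  by (simp add: cinner_star_right)

lemma norm_mult_op: "norm (A * B) \<le> norm A * norm (B :: 'a bounded_operator)"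
  by transfer (rule norm_blinfun_compose)

lemma star_star_op: "star (star A) = (A :: 'a bounded_operator)"
  by (rule op_eqI_cinner) (simp add: cinner_star_right cinner_star_left)

lemma norm_le_norm_star_mult: "(norm A)\<^sup>2 \<le> norm (star A * (A :: 'a bounded_operator))"
proof -
  have "norm A \<le> sqrt (norm (star A * A))"
  proof (rule norm_op_bound)
    fix x
    have "(norm (op_apply A x))\<^sup>2 = x \<bullet> op_apply (star A * A) x"
      by (simp add: power2_norm_eq_inner cinner_star_right flip: Re_cinner)
    also have "\<dots> \<le> norm x * norm (op_apply (star A * A) x)"
      by (rule norm_cauchy_schwarz)
    also have "\<dots> \<le> norm x * (norm (star A * A) * norm x)"
      by (intro mult_left_mono norm_op_apply norm_ge_zero)
    also have "\<dots> = (sqrt (norm (star A * A)) * norm x)\<^sup>2"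
      by (simp add: power_mult_distrib power2_eq_square)
    finally show "norm (op_apply A x) \<le> sqrt (norm (star A * A)) * norm x"
      by (rule power2_le_imp_le) simp
  qed simp
  then show ?thesis
    by (simp add: real_le_rsqrt sqrt_ge_absD)
qed

lemma norm_star_op: "norm (star A) = norm (A :: 'a bounded_operator)"
proof -
  have le: "norm B \<le> norm (star B)" for B :: "'a bounded_operator"
  proof (cases "norm B = 0")
    case False
    have "norm B * norm B \<le> norm (star B) * norm B"
      using norm_le_norm_star_mult[of B] norm_mult_op[of "star B" B] by (simp add: power2_eq_square)
    with False show ?thesis by simp
  qed simp
  show ?thesis
    using le[of A] le[of "star A"] by (simp add: star_star_op)
qed

instance
proof
  fix A B C :: "'a bounded_operator" and c d :: complex and r :: real
  show "A * B * C = A * (B * C)" "(A + B) * C = A * C + B * C" "A * (B + C) = A * B + A * C"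
    "r *\<^sub>R A * B = r *\<^sub>R (A * B)" "A * r *\<^sub>R B = r *\<^sub>R (A * B)"
    by (auto intro!: op_eqI simp: op_apply_add op_apply_scaleR)
  show "norm (A * B) \<le> norm A * norm B"
    by (rule norm_mult_op)
  show "c *\<^sub>C (A + B) = c *\<^sub>C A + c *\<^sub>C B" "(c + d) *\<^sub>C A = c *\<^sub>C A + d *\<^sub>C A"
    "c *\<^sub>C d *\<^sub>C A = (c * d) *\<^sub>C A" "of_real r *\<^sub>C A = r *\<^sub>R A"
    "c *\<^sub>C A * B = c *\<^sub>C (A * B)" "A * c *\<^sub>C B = c *\<^sub>C (A * B)"
    by (auto intro!: op_eqI simp: op_apply_scaleC scaleC_add_left scaleC_add_right scaleC_scaleC scaleC_of_real)
  show "norm (c *\<^sub>C A) = cmod c * norm A"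
  proof -
    have le: "norm (a *\<^sub>C F) \<le> cmod a * norm F" for a and F :: "'a bounded_operator"
      by (rule norm_op_bound) (auto simp: norm_scaleC_complex_inner mult.assoc
          intro!: mult_left_mono norm_op_apply)
    show ?thesis
    proof (cases "c = 0")
      case False
      have "inverse c *\<^sub>C c *\<^sub>C A = A"
        using False by (auto intro!: op_eqI simp: scaleC_scaleC)
      then have "norm A \<le> cmod (inverse c) * norm (c *\<^sub>C A)"
        using le[of "inverse c" "c *\<^sub>C A"] by simp
      then have "cmod c * norm A \<le> norm (c *\<^sub>C A)"
        using False by (simp add: norm_divide field_simps)
      with le[of c A] show ?thesis by simp
    qed (use le[of 0 A] in simp)
  qed
  show "star (star A) = A"
    by (rule star_star_op)
  show "star (A + B) = star A + star B" "star (c *\<^sub>C A) = cnj c *\<^sub>C star A" "star (A * B) = star B * star A"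
    by (rule op_eqI_cinner, simp add: cinner_star_right cinner_add_left cinner_add_right
        cinner_scaleC_left cinner_scaleC_right)+
  show "norm (star A * A) = (norm A)\<^sup>2"
    using norm_le_norm_star_mult[of A] norm_mult_op[of "star A" A]
    by (simp add: norm_star_op power2_eq_square)
qed

end

definition compact_operators :: "'h::complex_hilbert_space bounded_operator set"
  where "compact_operators = {A. compact (closure (op_apply A ` cball 0 1))}"

definition commutant ::
    "'h::complex_hilbert_space bounded_operator set \<Rightarrow> 'h bounded_operator set"
  where "commutant S = {A. \<forall>X\<in>S. A * X = X * A}"

text \<open>
  \<^const>\<open>has_sum\<close> is unconditional convergence of the net of finite partial sums, applied here
  pointwise: the projections sum to the identity in the strong-operator topology. Zero
  projections are allowed.
\<close>

definition orthogonal_projections_sum_id ::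
    "'i set \<Rightarrow> ('i \<Rightarrow> 'h::complex_hilbert_space bounded_operator) \<Rightarrow> bool"
  where "orthogonal_projections_sum_id \<Lambda> P \<longleftrightarrow>
    (\<forall>l\<in>\<Lambda>. star (P l) = P l \<and> P l * P l = P l) \<and>
    (\<forall>l\<in>\<Lambda>. \<forall>m\<in>\<Lambda>. l \<noteq> m \<longrightarrow> P l * P m = 0) \<and>
    (\<forall>x. ((\<lambda>l. op_apply (P l) x) has_sum x) \<Lambda>)"

text \<open>
  \<open>block_sum A P \<Lambda> \<Lambda>\<^sub>0\<close> is what is usually written as the sum of the sets \<open>A P\<^sub>l\<close>
  over \<open>l \<in> \<Lambda>\<^sub>0\<close>.
\<close>

definition block_sum ::
    "'h::complex_hilbert_space bounded_operator set \<Rightarrow> ('i \<Rightarrow> 'h bounded_operator) \<Rightarrow>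
      'i set \<Rightarrow> 'i set \<Rightarrow> 'h bounded_operator set"
  where "block_sum A P \<Lambda> \<Lambda>\<^sub>0 = {a \<in> A. \<forall>l\<in>\<Lambda> - \<Lambda>\<^sub>0. a * P l = 0}"

text \<open>
  HOL cannot quantify existentially over the type of the Hilbert space inside a formula, so the
  space is a type parameter. As a hypothesis with that type free, the predicate means that some
  such Hilbert space exists. The algebra \<open>B\<close> is a \<open>C\<^sup>*\<close>-subalgebra of its type and may
  be the whole type.
\<close>

definition compact_cstar_algebra ::
    "'k::complex_hilbert_space itself \<Rightarrow> 'b::cstar_algebra set \<Rightarrow> bool"
  where "compact_cstar_algebra _ B \<longleftrightarrow>
    cstar_subalgebra B \<and>
    (\<exists>(D :: 'k bounded_operator set) \<phi>.
      cstar_subalgebra D \<and> D \<subseteq> compact_operators \<and> star_isomorphism B D \<phi>)"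

end

theory Submission
  imports Defs
begin

text \<open>
  The map \<open>T\<close> is not linear, so all it can transport is the relation of strong Birkhoff--James (BJ)
  orthogonality. The point is that this relation determines the blocks of an algebra of compact
  operators together with their Hilbert space dimensions, finite or infinite.

  Let \<open>C\<close> be a closed \<open>*\<close>-algebra of compact operators. Attach to \<open>x \<noteq> 0\<close> in \<open>C\<close> its norming projection
  \<open>e\<close>, the projection onto the eigenspace of \<open>x * star x\<close> for the eigenvalue \<open>(norm x)\<^sup>2\<close>. It lies in
  \<open>C\<close>, and \<open>x\<close> is orthogonal to \<open>y\<close> if and only if \<open>star y\<close> kills a nonzero vector in the range of \<open>e\<close>
  (\<open>strong_BJ_orthogonal_iff\<close>). Consequently the elements whose norming projection is a minimal
  projection of \<open>C\<close> are those for which the set of all \<open>y\<close> they are orthogonal to is smallest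
  (\<open>BJ_minimal_iff\<close>), and for them orthogonality to \<open>y\<close> simply means \<open>e * y = 0\<close>.

  A strong BJ isomorphism \<open>T\<close> between two such algebras therefore induces a bijection of their
  minimal projections: \<open>p\<close> corresponds to \<open>q\<close> if \<open>q * T a = 0\<close> is equivalent to \<open>p * a = 0\<close> for all \<open>a\<close>.
  The bijection preserves orthogonality in both directions (\<open>corresponding_orthogonal_iff\<close>), and
  orthogonality tells whether two minimal projections belong to the same block, namely if some
  minimal projection is orthogonal to neither of them.

  Now choose an orthonormal basis \<open>E\<close> of the Hilbert space, adapted to the family \<open>P\<close>. The projections
  \<open>rank_one e e\<close> correspond to a maximal orthogonal family of minimal projections \<open>q e\<close> in the other
  algebra \<open>D\<close>, with the same distribution over blocks (\<open>ex_corresponding_family\<close>). So there is no need to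
  compare dimensions: the family yields matrix units and with them an isomorphism \<open>\<pi>\<close> from \<open>D\<close> to the
  block algebra with \<open>\<pi> (q e) = rank_one e e\<close> (\<open>ex_block_isomorphism\<close>). An element \<open>a\<close> belongs to a block sum
  if and only if \<open>rank_one e e * a = 0\<close> for all \<open>e\<close> in the remaining blocks. This is equivalent to
  \<open>q e * T a = 0\<close>, hence to \<open>rank_one e e * \<pi> (T a) = 0\<close>, so \<open>\<pi> \<circ> T\<close> maps every block sum onto itself.

  An abstract compact \<open>C\<^sup>*\<close>-algebra is first replaced by its image under an isomorphism onto an algebra of
  compact operators. The relation is defined by the norm of the abstract algebra, so the isomorphism
  has to be isometric (\<open>star_isomorphism_isometric\<close>). This is derived from the spectral
  decomposition of positive compact operators, on the image side only.
\<close>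

section \<open>Complex inner products\<close>

lemma scaleC_zero_left [simp]: "0 *\<^sub>C x = (0 :: 'a::complex_vector)"
  using scaleC_of_real[of 0 x] by simp

lemma scaleC_minus_left: "(- c) *\<^sub>C x = - (c *\<^sub>C (x :: 'a::complex_vector))"
  using scaleC_add_left[of c "- c" x] by (simp add: add_eq_0_iff)

lemma scaleC_eq_0_iff: "c *\<^sub>C x = (0 :: 'a::complex_vector) \<longleftrightarrow> c = 0 \<or> x = 0"
proof
  assume eq: "c *\<^sub>C x = 0"
  show "c = 0 \<or> x = 0"
  proof (cases "c = 0")
    case False
    then have "x = inverse c *\<^sub>C c *\<^sub>C x"
      by (simp add: scaleC_scaleC)
    with eq show ?thesis
      by simp
  qed simp
qed auto

lemma cinner_zero [simp]: "cinner 0 (y :: 'a::complex_inner) = 0" "cinner (x :: 'a::complex_inner) 0 = 0"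
proof -
  show "cinner 0 y = 0" for y :: 'a
    using cinner_add_left[of 0 0 y] by simp
  then show "cinner x 0 = 0"
    using cinner_commute[of x 0] by simp
qed

lemma cinner_minus_left: "cinner (- x) y = - cinner x (y :: 'a::complex_inner)"
  using cinner_add_left[of x "- x" y] by (simp add: add_eq_0_iff)

lemma cinner_diff_left: "cinner (x - y) z = cinner x z - cinner y (z :: 'a::complex_inner)"
  using cinner_add_left[of x "- y" z] by (simp add: cinner_minus_left)

lemma cinner_scaleR_left: "cinner (r *\<^sub>R x) y = of_real r * cinner x (y :: 'a::complex_inner)"
  by (metis cinner_scaleC_left scaleC_of_real)

lemma cinner_scaleR_right: "cinner x (r *\<^sub>R y) = of_real r * cinner x (y :: 'a::complex_inner)"
  by (metis cinner_scaleC_right complex_cnj_complex_of_real scaleC_of_real)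

lemma Re_cinner_scaleR_left: "Re (cinner (r *\<^sub>R x) y) = r * Re (cinner x (y :: 'a::complex_inner))"
  by (simp add: Re_cinner)

lemma Re_cinner_scaleR_right: "Re (cinner x (r *\<^sub>R y)) = r * Re (cinner x (y :: 'a::complex_inner))"
  by (simp add: Re_cinner)

lemma cinner_sum_left: "cinner (sum f F) (y :: 'a::complex_inner) = (\<Sum>i\<in>F. cinner (f i) y)"
  by (induction F rule: infinite_finite_induct) (auto simp: cinner_add_left)

lemma cinner_sum_right: "cinner (x :: 'a::complex_inner) (sum f F) = (\<Sum>i\<in>F. cinner x (f i))"
  by (induction F rule: infinite_finite_induct) (auto simp: cinner_add_right)

lemma cinner_self_eq_0_iff: "cinner x x = 0 \<longleftrightarrow> x = (0 :: 'a::complex_inner)"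
  by (simp add: cinner_self)

lemma norm_sq_eq_Re_cinner: "(norm (x :: 'a::complex_inner))\<^sup>2 = Re (cinner x x)"
  by (simp add: Re_cinner power2_norm_eq_inner)

lemma norm_add_sq:
  "(norm (x + y))\<^sup>2 = (norm x)\<^sup>2 + (norm y)\<^sup>2 + 2 * Re (cinner x (y :: 'a::complex_inner))"
  by (simp add: Re_cinner power2_norm_eq_inner inner_add_left inner_add_right inner_commute)

lemma norm_diff_sq:
  "(norm (x - y))\<^sup>2 = (norm x)\<^sup>2 + (norm y)\<^sup>2 - 2 * Re (cinner x (y :: 'a::complex_inner))"
  by (simp add: Re_cinner power2_norm_eq_inner inner_diff_left inner_diff_right inner_commute)

text \<open>The real Cauchy--Schwarz inequality, applied after rotating \<open>cinner x y\<close> onto the real axis.\<close>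

lemma cmod_cinner_le: "cmod (cinner x y) \<le> norm x * norm (y :: 'a::complex_inner)"
proof (cases "cinner x y = 0")
  case False
  define c where "c = cnj (cinner x y) / of_real (cmod (cinner x y))"
  have c: "cmod c = 1"
    using False by (simp add: c_def norm_divide)
  have "cinner (c *\<^sub>C x) y = of_real (cmod (cinner x y))"
    using False by (simp add: c_def cinner_scaleC_left field_simps complex_norm_square
        flip: power2_eq_square of_real_power)
  then have "cmod (cinner x y) = (c *\<^sub>C x) \<bullet> y"
    by (metis Re_cinner Re_complex_of_real)
  also have "\<dots> \<le> norm (c *\<^sub>C x) * norm y"
    by (rule norm_cauchy_schwarz)
  finally show ?thesis
    by (simp add: norm_scaleC_complex_inner c)
qed simp

lemma bounded_linear_cinner_left: "bounded_linear (\<lambda>x. cinner x (y :: 'a::complex_inner))"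
  by (rule bounded_linear_intro[where K = "norm y"])
    (auto simp: cinner_add_left cinner_scaleR_left cmod_cinner_le scaleR_conv_of_real)

lemma bounded_linear_cinner_right: "bounded_linear (\<lambda>y. cinner (x :: 'a::complex_inner) y)"
  by (rule bounded_linear_intro[where K = "norm x"])
    (auto simp: cinner_add_right cinner_scaleR_right scaleR_conv_of_real mult.commute[of _ "norm x"] cmod_cinner_le)

lemma cinner_left_cancel:
  fixes y z :: "'a::complex_inner"
  assumes "\<And>x. cinner y x = cinner z x"
  shows "y = z"
  by (rule cinner_right_cancel) (metis assms cinner_commute)

section \<open>Orthonormal families\<close>

definition orthonormal_family :: "'i set \<Rightarrow> ('i \<Rightarrow> 'a::complex_inner) \<Rightarrow> bool"
  where "orthonormal_family I f \<longleftrightarrow>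
    (\<forall>i\<in>I. \<forall>j\<in>I. cinner (f i) (f j) = (if i = j then 1 else 0))"

lemma orthonormal_familyD:
  assumes "orthonormal_family I f" "i \<in> I" "j \<in> I"
  shows "cinner (f i) (f j) = (if i = j then 1 else 0)"
  using assms unfolding orthonormal_family_def by blast

lemma norm_sum_orthonormal:
  assumes f: "orthonormal_family I f" and F: "finite F" "F \<subseteq> I"
  shows "(norm (\<Sum>i\<in>F. c i *\<^sub>C f i))\<^sup>2 = (\<Sum>i\<in>F. (cmod (c i))\<^sup>2)"
proof -
  have "cinner (\<Sum>i\<in>F. c i *\<^sub>C f i) (\<Sum>j\<in>F. c j *\<^sub>C f j)
      = (\<Sum>i\<in>F. \<Sum>j\<in>F. c i * cnj (c j) * cinner (f i) (f j))"
    by (subst cinner_sum_left)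
      (simp add: cinner_sum_right cinner_scaleC_left cinner_scaleC_right sum_distrib_left ac_simps)
  also have "\<dots> = (\<Sum>i\<in>F. \<Sum>j\<in>F. if i = j then c i * cnj (c j) else 0)"
    using F by (intro sum.cong refl) (auto simp: orthonormal_familyD[OF f] subset_iff)
  also have "\<dots> = (\<Sum>i\<in>F. c i * cnj (c i))"
    using F(1) by (simp add: sum.delta)
  also have "\<dots> = of_real (\<Sum>i\<in>F. (cmod (c i))\<^sup>2)"
    unfolding of_real_sum complex_norm_square ..
  finally show ?thesis
    by (metis Re_complex_of_real norm_sq_eq_Re_cinner)
qed

lemma Bessel_inequality:
  assumes f: "orthonormal_family I f" and F: "finite F" "F \<subseteq> I"
  shows "(\<Sum>i\<in>F. (cmod (cinner x (f i)))\<^sup>2) \<le> (norm x)\<^sup>2"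
proof -
  define s where "s = (\<Sum>i\<in>F. cinner x (f i) *\<^sub>C f i)"
  have "cinner x s = of_real (\<Sum>i\<in>F. (cmod (cinner x (f i)))\<^sup>2)"
    unfolding s_def cinner_sum_right cinner_scaleC_right of_real_sum complex_norm_square
    by (simp add: mult.commute)
  moreover have "(norm s)\<^sup>2 = (\<Sum>i\<in>F. (cmod (cinner x (f i)))\<^sup>2)"
    unfolding s_def by (rule norm_sum_orthonormal[OF f F])
  ultimately have "(norm (x - s))\<^sup>2 = (norm x)\<^sup>2 - (\<Sum>i\<in>F. (cmod (cinner x (f i)))\<^sup>2)"
    by (simp add: norm_diff_sq)
  then show ?thesis
    by (metis diff_ge_0_iff_ge zero_le_power2)
qed

text \<open>
  \<open>basis_transfer I f g\<close> is the partial isometry that carries \<open>f i\<close> to \<open>g i\<close>. With \<open>g = f\<close> it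
  is the orthogonal projection onto the closed span of the family.
\<close>

definition basis_transfer ::
    "'i set \<Rightarrow> ('i \<Rightarrow> 'a::complex_inner) \<Rightarrow> ('i \<Rightarrow> 'b::complex_hilbert_space) \<Rightarrow> 'a \<Rightarrow> 'b"
  where "basis_transfer I f g x = (\<Sum>\<^sub>\<infinity>i\<in>I. cinner x (f i) *\<^sub>C g i)"

text \<open>
  The partial sums form a Cauchy net because, by Pythagoras, they differ by at most a tail of the
  convergent Bessel series. The series of vectors itself is in general not absolutely convergent.
\<close>

lemma orthonormal_series_summable:
  fixes g :: "'i \<Rightarrow> 'b::complex_hilbert_space"
  assumes f: "orthonormal_family I f" and g: "orthonormal_family I g"
  shows "(\<lambda>i. cinner x (f i) *\<^sub>C g i) summable_on I"
proof -
  define h where "h i = cinner x (f i) *\<^sub>C g i" for i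
  define a where "a i = (cmod (cinner x (f i)))\<^sup>2" for i
  define S where "S = {sum a F |F. finite F \<and> F \<subseteq> I}"
  have norm_h: "(norm (sum h F))\<^sup>2 = sum a F" if "finite F" "F \<subseteq> I" for F
    unfolding h_def a_def by (rule norm_sum_orthonormal[OF g that])
  have "sum a {} \<in> S"
    unfolding S_def by blast
  moreover have bdd: "bdd_above S"
    by (rule bdd_aboveI[of _ "(norm x)\<^sup>2"])
      (use Bessel_inequality[OF f] in \<open>auto simp: S_def a_def\<close>)
  ultimately have S: "S \<noteq> {}" "bdd_above S"
    by auto
  have "\<exists>P. eventually P (finite_subsets_at_top I) \<and>
      (\<forall>F F'. P F \<and> P F' \<longrightarrow> dist (sum h F) (sum h F') < e)" if e: "0 < e" for e
  proof -
    have "Sup S - (e / 2)\<^sup>2 < Sup S"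
      using e by simp
    then obtain F0 where F0: "finite F0" "F0 \<subseteq> I" "Sup S - (e / 2)\<^sup>2 < sum a F0"
      using less_cSup_iff[OF S] unfolding S_def by blast
    define P where "P F \<longleftrightarrow> finite F \<and> F0 \<subseteq> F \<and> F \<subseteq> I" for F
    have near: "dist (sum h F) (sum h F0) < e / 2" if "P F" for F
    proof -
      have F: "finite F" "F0 \<subseteq> F" "F \<subseteq> I"
        using that by (auto simp: P_def)
      have "sum a F \<le> Sup S"
        using F S by (intro cSup_upper) (auto simp: S_def)
      then have "sum a (F - F0) < (e / 2)\<^sup>2"
        using F F0 by (simp add: sum_diff)
      moreover have "(norm (sum h (F - F0)))\<^sup>2 = sum a (F - F0)"
        by (rule norm_h) (use F in blast)+
      ultimately have "(norm (sum h (F - F0)))\<^sup>2 < (e / 2)\<^sup>2"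
        by (simp only:)
      then have "norm (sum h (F - F0)) < e / 2"
        by (rule power2_less_imp_less) (use e in simp)
      then show ?thesis
        using F F0 by (simp add: dist_norm sum_diff)
    qed
    have "eventually P (finite_subsets_at_top I)"
      using F0 by (auto simp: eventually_finite_subsets_at_top P_def)
    moreover have "dist (sum h F) (sum h F') < e" if "P F" "P F'" for F F'
      using near[OF that(1)] near[OF that(2)] dist_triangle_half_r by (metis dist_commute)
    ultimately show ?thesis
      by blast
  qed
  then have "cauchy_filter (filtermap (sum h) (finite_subsets_at_top I))"
    by (simp add: cauchy_filter_metric_filtermap)
  moreover have "complete (UNIV :: 'b set)"
    by (meson Cauchy_convergent UNIV_I complete_def convergent_def)
  ultimately obtain L where "(sum h \<longlongrightarrow> L) (finite_subsets_at_top I)"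
    using complete_uniform[where S = UNIV] by (force simp: filterlim_def)
  then show ?thesis
    unfolding h_def summable_on_def has_sum_def by blast
qed

lemma basis_transfer_has_sum:
  fixes g :: "'i \<Rightarrow> 'b::complex_hilbert_space"
  assumes "orthonormal_family I f" "orthonormal_family I g"
  shows "((\<lambda>i. cinner x (f i) *\<^sub>C g i) has_sum basis_transfer I f g x) I"
  unfolding basis_transfer_def using orthonormal_series_summable[OF assms] by (rule has_sum_infsum)

lemma has_sum_cinner_left:
  "(f has_sum s) I \<Longrightarrow> ((\<lambda>i. cinner (f i) y) has_sum cinner s (y :: 'a::complex_inner)) I"
  using has_sum_bounded_linear[OF bounded_linear_cinner_left] .

lemma has_sum_cinner_right:
  "(f has_sum s) I \<Longrightarrow> ((\<lambda>i. cinner y (f i)) has_sum cinner y (s :: 'a::complex_inner)) I"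
  using has_sum_bounded_linear[OF bounded_linear_cinner_right] .

lemma has_sum_in_closed_subspace:
  fixes s :: "'a::real_normed_vector"
  assumes "(f has_sum s) I" "closed S" "subspace S" "\<And>i. i \<in> I \<Longrightarrow> f i \<in> S"
  shows "s \<in> S"
proof (rule Lim_in_closed_set[OF assms(2)])
  show "(sum f \<longlongrightarrow> s) (finite_subsets_at_top I)"
    using assms(1) by (simp add: has_sum_def)
  show "\<forall>\<^sub>F F in finite_subsets_at_top I. sum f F \<in> S"
    by (rule eventually_finite_subsets_at_top_weakI) (use assms(3,4) in \<open>auto intro: subspace_sum\<close>)
qed simp

context
  fixes I :: "'i set" and f :: "'i \<Rightarrow> 'a::complex_hilbert_space" and g :: "'i \<Rightarrow> 'b::complex_hilbert_space"
  assumes f: "orthonormal_family I f" and g: "orthonormal_family I g"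
begin

lemma basis_transfer_adjoint: "cinner (basis_transfer I f g x) y = cinner x (basis_transfer I g f y)"
proof (rule has_sum_unique)
  show "((\<lambda>i. cinner (cinner x (f i) *\<^sub>C g i) y) has_sum cinner (basis_transfer I f g x) y) I"
    by (intro has_sum_cinner_left basis_transfer_has_sum f g)
  have "((\<lambda>i. cinner x (cinner y (g i) *\<^sub>C f i)) has_sum cinner x (basis_transfer I g f y)) I"
    by (intro has_sum_cinner_right basis_transfer_has_sum f g)
  moreover have "cinner (cinner x (f i) *\<^sub>C g i) y = cinner x (cinner y (g i) *\<^sub>C f i)" for i
    unfolding cinner_scaleC_left cinner_scaleC_right cinner_commute[of y "g i"] by (simp add: mult.commute)
  ultimately show "((\<lambda>i. cinner (cinner x (f i) *\<^sub>C g i) y) has_sum cinner x (basis_transfer I g f y)) I"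
    by (simp only:)
qed

lemma basis_transfer_basis:
  assumes "i \<in> I" shows "basis_transfer I f g (f i) = g i"
proof (rule has_sum_unique)
  show "((\<lambda>j. cinner (f i) (f j) *\<^sub>C g j) has_sum basis_transfer I f g (f i)) I"
    by (intro basis_transfer_has_sum f g)
  have "((\<lambda>j. cinner (f i) (f j) *\<^sub>C g j) has_sum g i) {i}"
    using assms by (simp add: has_sum_finite_iff orthonormal_familyD[OF f])
  moreover have "((\<lambda>j. cinner (f i) (f j) *\<^sub>C g j) has_sum g i) I
      \<longleftrightarrow> ((\<lambda>j. cinner (f i) (f j) *\<^sub>C g j) has_sum g i) {i}"
    by (rule has_sum_cong_neutral) (use assms in \<open>auto simp: orthonormal_familyD[OF f]\<close>)
  ultimately show "((\<lambda>j. cinner (f i) (f j) *\<^sub>C g j) has_sum g i) I"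
    by simp
qed

lemma basis_transfer_add: "basis_transfer I f g (x + y) = basis_transfer I f g x + basis_transfer I f g y"
  by (rule cinner_left_cancel) (simp add: basis_transfer_adjoint cinner_add_left)

lemma basis_transfer_scaleC: "basis_transfer I f g (c *\<^sub>C x) = c *\<^sub>C basis_transfer I f g x"
  by (rule cinner_left_cancel) (simp add: basis_transfer_adjoint cinner_scaleC_left)

lemma norm_basis_transfer_le: "norm (basis_transfer I f g x) \<le> norm x"
proof -
  have "(norm (basis_transfer I f g x))\<^sup>2 \<le> (norm x)\<^sup>2"
  proof (rule tendsto_upperbound)
    have "(sum (\<lambda>i. cinner x (f i) *\<^sub>C g i) \<longlongrightarrow> basis_transfer I f g x) (finite_subsets_at_top I)"
      using basis_transfer_has_sum[OF f g] by (simp add: has_sum_def)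
    then show "((\<lambda>F. (norm (\<Sum>i\<in>F. cinner x (f i) *\<^sub>C g i))\<^sup>2) \<longlongrightarrow> (norm (basis_transfer I f g x))\<^sup>2)
        (finite_subsets_at_top I)"
      by (intro tendsto_intros)
    show "\<forall>\<^sub>F F in finite_subsets_at_top I. (norm (\<Sum>i\<in>F. cinner x (f i) *\<^sub>C g i))\<^sup>2 \<le> (norm x)\<^sup>2"
      by (rule eventually_finite_subsets_at_top_weakI)
        (simp add: norm_sum_orthonormal[OF g] Bessel_inequality[OF f])
  qed simp
  then show ?thesis
    by (rule power2_le_imp_le) simp
qed

lemma bounded_linear_basis_transfer: "bounded_linear (basis_transfer I f g)"
  by (rule bounded_linear_intro[where K = 1])
    (simp_all add: basis_transfer_add norm_basis_transfer_le flip: scaleC_of_real basis_transfer_scaleC)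

end


lemma basis_transfer_eq_zero:
  assumes "\<And>i. i \<in> I \<Longrightarrow> cinner x (f i) = 0"
  shows "basis_transfer I f g x = 0"
  unfolding basis_transfer_def using assms by (intro infsum_0) simp

lemma basis_transfer_eq_self:
  assumes f: "orthonormal_family I f"
    and x: "\<And>y. (\<And>i. i \<in> I \<Longrightarrow> cinner y (f i) = 0) \<Longrightarrow> cinner x y = 0"
  shows "basis_transfer I f f x = x"
proof -
  let ?U = "basis_transfer I f f"
  have orth: "cinner (x - ?U x) (f i) = 0" if "i \<in> I" for i
    using that by (simp add: cinner_diff_left basis_transfer_adjoint[OF f f] basis_transfer_basis[OF f f])
  then have "?U (x - ?U x) = 0"
    by (rule basis_transfer_eq_zero)
  then have "cinner (?U x) (x - ?U x) = 0"
    by (simp add: basis_transfer_adjoint[OF f f])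
  moreover have "cinner x (x - ?U x) = 0"
    using orth by (rule x)
  ultimately have "cinner (x - ?U x) (x - ?U x) = 0"
    by (simp add: cinner_diff_left)
  then show "?U x = x"
    by (simp add: cinner_self_eq_0_iff)
qed

lemma basis_transfer_basis_transfer:
  assumes f: "orthonormal_family I f" and g: "orthonormal_family I g" and h: "orthonormal_family I h"
  shows "basis_transfer I g h (basis_transfer I f g x) = basis_transfer I f h x"
proof (rule has_sum_unique)
  show "((\<lambda>i. basis_transfer I g h (cinner x (f i) *\<^sub>C g i)) has_sum
      basis_transfer I g h (basis_transfer I f g x)) I"
    by (intro has_sum_bounded_linear[OF bounded_linear_basis_transfer[OF g h]] basis_transfer_has_sum[OF f g])
  have "((\<lambda>i. basis_transfer I g h (cinner x (f i) *\<^sub>C g i)) has_sum basis_transfer I f h x) I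
      \<longleftrightarrow> ((\<lambda>i. cinner x (f i) *\<^sub>C h i) has_sum basis_transfer I f h x) I"
    by (rule has_sum_cong) (simp add: basis_transfer_scaleC[OF g h] basis_transfer_basis[OF g h])
  then show "((\<lambda>i. basis_transfer I g h (cinner x (f i) *\<^sub>C g i)) has_sum basis_transfer I f h x) I"
    using basis_transfer_has_sum[OF f h] by simp
qed

lemma ex_maximal_orthonormal:
  fixes S :: "'a::complex_inner set"
  assumes unit: "\<And>x. x \<in> S \<Longrightarrow> norm x = 1"
  obtains E where "E \<subseteq> S" "orthonormal_family E (\<lambda>x. x)"
    "\<And>x. x \<in> S \<Longrightarrow> (\<And>e. e \<in> E \<Longrightarrow> cinner x e = 0) \<Longrightarrow> False"
proof -
  define \<O> where "\<O> = {E. E \<subseteq> S \<and> orthonormal_family E (\<lambda>x. x)}"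
  have "\<exists>M\<in>\<O>. \<forall>X\<in>\<O>. M \<subseteq> X \<longrightarrow> X = M"
  proof (rule subset_Zorn)
    fix C assume C: "subset.chain \<O> C"
    have "orthonormal_family (\<Union>C) (\<lambda>x. x)"
      unfolding orthonormal_family_def
    proof (intro ballI)
      fix x y assume "x \<in> \<Union>C" "y \<in> \<Union>C"
      then obtain X Y where XY: "X \<in> C" "Y \<in> C" "x \<in> X" "y \<in> Y"
        by blast
      then have "X \<subseteq> Y \<or> Y \<subseteq> X"
        using C unfolding subset.chain_def by blast
      then obtain Z where "Z \<in> C" "x \<in> Z" "y \<in> Z"
        using XY by blast
      moreover from this have "orthonormal_family Z (\<lambda>x. x)"
        using C unfolding subset.chain_def \<O>_def by blast
      ultimately show "cinner x y = (if x = y then 1 else 0)"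
        using orthonormal_familyD by fast
    qed
    moreover have "\<Union>C \<subseteq> S"
      using C unfolding subset.chain_def \<O>_def by blast
    ultimately show "\<exists>U\<in>\<O>. \<forall>X\<in>C. X \<subseteq> U"
      unfolding \<O>_def by blast
  qed
  then obtain M where M: "M \<in> \<O>" "\<And>X. X \<in> \<O> \<Longrightarrow> M \<subseteq> X \<Longrightarrow> X = M"
    by blast
  have on: "orthonormal_family M (\<lambda>x. x)" and "M \<subseteq> S"
    using M(1) by (auto simp: \<O>_def)
  have False if x: "x \<in> S" and orth: "\<And>e. e \<in> M \<Longrightarrow> cinner x e = 0" for x
  proof -
    have "cinner x x = 1"
      using unit[OF x] by (simp add: cinner_self)
    then have "x \<notin> M"
      using orth[of x] by auto
    moreover have "cinner e x = 0" if "e \<in> M" for e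
      using orth[OF that] cinner_commute[of e x] by simp
    ultimately have "orthonormal_family (insert x M) (\<lambda>x. x)"
      using on orth \<open>cinner x x = 1\<close> unfolding orthonormal_family_def by auto
    then have "insert x M = M"
      using x \<open>M \<subseteq> S\<close> by (intro M(2)) (auto simp: \<O>_def)
    with \<open>x \<notin> M\<close> show False
      by auto
  qed
  from that[OF \<open>M \<subseteq> S\<close> on this] show thesis .
qed

section \<open>\<open>C\<^sup>*\<close>-algebra preliminaries\<close>

lemma star_zero [simp]: "star 0 = (0 :: 'a::cstar_algebra)"
  using star_add[of 0 "0 :: 'a"] by simp

lemma star_minus: "star (- x) = - star (x :: 'a::cstar_algebra)"
  using star_add[of x "- x"] by (simp add: add_eq_0_iff)

lemma star_diff: "star (x - y) = star x - star (y :: 'a::cstar_algebra)"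
  using star_add[of x "- y"] by (simp add: star_minus)

lemma star_scaleR: "star (r *\<^sub>R x) = r *\<^sub>R star (x :: 'a::cstar_algebra)"
  by (metis complex_cnj_complex_of_real scaleC_of_real star_scaleC)

lemma star_sum: "star (sum f F) = (\<Sum>i\<in>F. star (f i :: 'a::cstar_algebra))"
  by (induction F rule: infinite_finite_induct) (auto simp: star_add)

lemma norm_star: "norm (star x) = norm (x :: 'a::cstar_algebra)"
proof -
  have le: "norm y \<le> norm (star y)" for y :: 'a
  proof (cases "norm y = 0")
    case False
    have "norm y * norm y \<le> norm (star y) * norm y"
      using norm_mult_ineq[of "star y" y] cstar_identity[of y] by (simp add: power2_eq_square)
    with False show ?thesis by simp
  qed simp
  show ?thesis
    using le[of x] le[of "star x"] by (simp add: star_star)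
qed

lemma cstar_identity_right: "norm (x * star x) = (norm (x :: 'a::cstar_algebra))\<^sup>2"
  using cstar_identity[of "star x"] by (simp add: star_star norm_star)

definition projection :: "'a::cstar_algebra \<Rightarrow> bool"
  where "projection p \<longleftrightarrow> star p = p \<and> p * p = p"

lemma projectionD:
  assumes "projection p" shows "star p = p" "p * p = p" "p * (p * x) = p * x"
  using assms by (auto simp: projection_def simp flip: mult.assoc)

lemma projection_zero [simp]: "projection 0"
  by (simp add: projection_def)

lemma norm_projection:
  assumes "projection p" "p \<noteq> 0" shows "norm p = 1"
proof -
  have "norm p = (norm p)\<^sup>2"
    using cstar_identity[of p] assms(1) by (simp add: projection_def)
  with assms(2) show ?thesis
    by (simp add: power2_eq_square)
qed

text \<open>This is used to interchange the factors in equations between products of self-adjoint elements.\<close>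

lemma mult_eq_star:
  fixes x y z :: "'a::cstar_algebra"
  assumes "x * y = z" shows "star y * star x = star z"
  using assms star_mult by metis

lemma cstar_subalgebra_0: "cstar_subalgebra C \<Longrightarrow> 0 \<in> C"
  and cstar_subalgebra_closed: "cstar_subalgebra C \<Longrightarrow> closed C"
  and cstar_subalgebra_add: "cstar_subalgebra C \<Longrightarrow> x \<in> C \<Longrightarrow> y \<in> C \<Longrightarrow> x + y \<in> C"
  and cstar_subalgebra_mult: "cstar_subalgebra C \<Longrightarrow> x \<in> C \<Longrightarrow> y \<in> C \<Longrightarrow> x * y \<in> C"
  and cstar_subalgebra_star: "cstar_subalgebra C \<Longrightarrow> x \<in> C \<Longrightarrow> star x \<in> C"
  and cstar_subalgebra_scaleC: "cstar_subalgebra C \<Longrightarrow> x \<in> C \<Longrightarrow> c *\<^sub>C x \<in> C"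
  by (auto simp: cstar_subalgebra_def)

lemma cstar_subalgebra_scaleR: "cstar_subalgebra C \<Longrightarrow> x \<in> C \<Longrightarrow> r *\<^sub>R x \<in> C"
  by (metis cstar_subalgebra_scaleC scaleC_of_real)

lemma cstar_subalgebra_diff: "cstar_subalgebra C \<Longrightarrow> x \<in> C \<Longrightarrow> y \<in> C \<Longrightarrow> x - y \<in> C"
  using cstar_subalgebra_add[of C x "(- 1) *\<^sub>R y"] cstar_subalgebra_scaleR[of C y "- 1"] by simp

lemmas cstar_subalgebra_intros = cstar_subalgebra_0 cstar_subalgebra_add cstar_subalgebra_mult
  cstar_subalgebra_star cstar_subalgebra_scaleC cstar_subalgebra_scaleR cstar_subalgebra_diff

lemma cstar_subalgebra_sum:
  assumes "cstar_subalgebra C" "\<And>i. i \<in> F \<Longrightarrow> f i \<in> C" shows "sum f F \<in> C"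
  using assms(2) by (induction F rule: infinite_finite_induct) (auto intro: cstar_subalgebra_intros[OF assms(1)])

lemma cstar_subalgebra_LIMSEQ:
  assumes "cstar_subalgebra C" "\<And>n. f n \<in> C" "f \<longlonglongrightarrow> l" shows "l \<in> C"
  by (rule closed_sequentially[OF cstar_subalgebra_closed[OF assms(1)] assms(2,3)])

section \<open>Operators\<close>

lemma op_apply_zero [simp]: "op_apply A 0 = 0" "op_apply 0 x = 0"
  using op_apply_add[of A 0 0] op_apply_plus[of 0 0 x] by simp_all

lemma op_apply_minus: "op_apply A (- x) = - op_apply A x"
  using op_apply_scaleR[of A "- 1" x] by simp

lemma op_apply_diff: "op_apply A (x - y) = op_apply A x - op_apply A y"
  using op_apply_add[of A x "- y"] by (simp add: op_apply_minus)

lemma op_apply_minus_left [simp]: "op_apply (- A) x = - op_apply A x"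
  using op_apply_scaleR_left[of "- 1" A x] by simp

lemma op_apply_diff_left [simp]: "op_apply (A - B) x = op_apply A x - op_apply B x"
  using op_apply_plus[of A "- B" x] by simp

lemma op_apply_sum_left: "op_apply (sum f F) x = (\<Sum>i\<in>F. op_apply (f i) x)"
  by (induction F rule: infinite_finite_induct) auto

lemma bounded_linear_op_apply_left: "bounded_linear (\<lambda>A. op_apply A x)"
  by (rule bounded_linear_intro[where K = "norm x"]) (auto simp: norm_op_apply)

lemma ex_op_apply:
  fixes f :: "'h::complex_hilbert_space \<Rightarrow> 'h"
  assumes "bounded_linear f" "\<And>c x. f (c *\<^sub>C x) = c *\<^sub>C f x"
  obtains A where "\<And>x. op_apply A x = f x"
proof
  show "op_apply (op_of_blinfun (Blinfun f)) x = f x" for x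
    using assms by (simp add: op_apply.rep_eq op_of_blinfun_inverse bounded_linear_Blinfun_apply)
qed

lemma star_eqI:
  fixes A B :: "'h::complex_hilbert_space bounded_operator"
  assumes "\<And>x y. cinner (op_apply A x) y = cinner x (op_apply B y)"
  shows "star A = B"
  by (rule op_eqI_cinner) (simp add: cinner_star_right assms)

lemma norm_op_le:
  fixes A :: "'h::complex_hilbert_space bounded_operator"
  assumes "0 \<le> c" "\<And>x. norm x \<le> 1 \<Longrightarrow> norm (op_apply A x) \<le> c"
  shows "norm A \<le> c"
proof (rule norm_op_bound[OF assms(1)])
  fix x show "norm (op_apply A x) \<le> c * norm x"
  proof (cases "x = 0")
    case False
    then show ?thesis
      using assms(2)[of "x /\<^sub>R norm x"] by (simp add: op_apply_scaleR field_simps)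
  qed simp
qed

lemma norm_op_apply_sq: "(norm (op_apply A x))\<^sup>2 = Re (cinner (op_apply (star A * A) x) x)"
  by (simp add: norm_sq_eq_Re_cinner cinner_star_left)

text \<open>
  Expanding the square on the left shows that a vector at which \<open>A\<close> nearly attains its norm is nearly
  an eigenvector of \<open>star A * A\<close>.
\<close>

lemma norming_defect:
  assumes "norm x \<le> 1"
  shows "(norm (op_apply (star A * A) x - (norm A)\<^sup>2 *\<^sub>R x))\<^sup>2
    \<le> 2 * (norm A)\<^sup>2 * ((norm A)\<^sup>2 - (norm (op_apply A x))\<^sup>2)"
proof -
  let ?N = "(norm A)\<^sup>2" and ?a = "(norm (op_apply A x))\<^sup>2"
  have "(norm (op_apply (star A * A) x))\<^sup>2 \<le> (norm A * norm (op_apply A x))\<^sup>2"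
    using norm_op_apply[of "star A" "op_apply A x"] by (simp add: norm_star power_mono)
  then have 1: "(norm (op_apply (star A * A) x))\<^sup>2 \<le> ?N * ?a"
    by (simp add: power_mult_distrib)
  have "?a \<le> (norm A * norm x)\<^sup>2"
    by (intro power_mono norm_op_apply) simp
  also have "\<dots> \<le> (norm A)\<^sup>2"
    using assms by (simp add: power_mono mult_left_le)
  finally have "?N * ?a \<le> ?N * ?N"
    by (intro mult_left_mono) auto
  moreover have "(norm (?N *\<^sub>R x))\<^sup>2 \<le> ?N * ?N"
    using power_mono[of "norm (?N *\<^sub>R x)" ?N 2] mult_left_le[OF assms, of ?N] by (simp add: power2_eq_square)
  moreover have "Re (cinner (op_apply (star A * A) x) (?N *\<^sub>R x)) = ?N * ?a"
    by (simp only: cinner_scaleR_right norm_op_apply_sq[of A x] Re_complex_of_real times_complex.sel Im_complex_of_real mult_zero_left diff_zero)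
  ultimately show ?thesis
    unfolding norm_diff_sq using 1 by (simp add: algebra_simps)
qed

lemma norming_vector_eigen:
  assumes "norm x \<le> 1" "norm (op_apply A x) = norm A"
  shows "op_apply (star A * A) x = (norm A)\<^sup>2 *\<^sub>R x"
  using norming_defect[OF assms(1), of A] assms(2) by simp

section \<open>Compact operators\<close>

lemma compact_operator_subseq:
  assumes A: "A \<in> compact_operators" and x: "\<And>n. norm (x n) \<le> (K :: real)"
  obtains r l where "strict_mono (r :: nat \<Rightarrow> nat)" "(\<lambda>n. op_apply A (x (r n))) \<longlonglongrightarrow> l"
proof -
  define k where "k = max K 1"
  have k: "0 < k" "\<And>n. norm (x n) \<le> k"
    using x by (auto simp: k_def le_max_iff_disj)
  define y where "y n = x n /\<^sub>R k" for n
  have "op_apply A (y n) \<in> closure (op_apply A ` cball 0 1)" for n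
    by (rule set_mp[OF closure_subset]) (use k in \<open>auto simp: y_def field_simps\<close>)
  moreover have "compact (closure (op_apply A ` cball 0 1))"
    using A by (simp add: compact_operators_def)
  ultimately obtain l r where "strict_mono (r :: nat \<Rightarrow> nat)" and l: "((\<lambda>n. op_apply A (y n)) \<circ> r) \<longlonglongrightarrow> l"
    unfolding compact_def by (meson allI)
  moreover have "(\<lambda>n. op_apply A (x (r n))) \<longlonglongrightarrow> k *\<^sub>R l"
    using tendsto_scaleR[OF tendsto_const l, of k] k(1) by (simp add: y_def op_apply_scaleR)
  ultimately show thesis
    using that by blast
qed

lemma compact_operatorI_subseq:
  assumes "\<And>x. (\<And>n. norm (x n) \<le> 1) \<Longrightarrow>
    \<exists>(r :: nat \<Rightarrow> nat) l. strict_mono r \<and> (\<lambda>n. op_apply A (x (r n))) \<longlonglongrightarrow> l"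
  shows "A \<in> compact_operators"
proof -
  let ?S = "op_apply A ` cball 0 1"
  have "\<exists>l\<in>closure ?S. \<exists>r. strict_mono r \<and> (y \<circ> r) \<longlonglongrightarrow> l" if y: "\<forall>n. y n \<in> closure ?S" for y :: "nat \<Rightarrow> 'a"
  proof -
    have "\<exists>x. norm x \<le> 1 \<and> dist (op_apply A x) (y n) < inverse (real (Suc n))" for n
      using y[rule_format, of n] unfolding closure_approachable
      by (force simp: dest: spec[of _ "inverse (real (Suc n))"])
    then obtain x where x: "\<And>n. norm (x n) \<le> 1" "\<And>n. dist (op_apply A (x n)) (y n) < inverse (real (Suc n))"
      by metis
    obtain r l where r: "strict_mono (r :: nat \<Rightarrow> nat)" and l: "(\<lambda>n. op_apply A (x (r n))) \<longlonglongrightarrow> l"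
      using assms[of x] x(1) by blast
    have "(\<lambda>n. dist (op_apply A (x n)) (y n)) \<longlonglongrightarrow> 0"
      by (rule real_tendsto_sandwich[OF _ _ tendsto_const LIMSEQ_inverse_real_of_nat])
        (use x(2) in \<open>auto intro!: always_eventually less_imp_le\<close>)
    then have "(\<lambda>n. op_apply A (x n) - y n) \<longlonglongrightarrow> 0"
      by (simp add: dist_norm tendsto_norm_zero_iff)
    then have "(\<lambda>n. op_apply A (x (r n)) - y (r n)) \<longlonglongrightarrow> 0"
      using LIMSEQ_subseq_LIMSEQ[OF _ r] by (simp add: o_def)
    from tendsto_diff[OF l this] have "(y \<circ> r) \<longlonglongrightarrow> l"
      by (simp add: o_def)
    moreover from this have "l \<in> closure ?S"
      by (rule closed_sequentially[OF closed_closure, rotated]) (use y in simp)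
    ultimately show ?thesis
      using r by blast
  qed
  then show ?thesis
    unfolding compact_operators_def compact_def by blast
qed

lemma compact_operators_mult_left:
  assumes "A \<in> compact_operators" shows "B * A \<in> compact_operators"
proof (rule compact_operatorI_subseq)
  fix x :: "nat \<Rightarrow> 'a" assume "\<And>n. norm (x n) \<le> 1"
  then obtain r l where "strict_mono (r :: nat \<Rightarrow> nat)" and l: "(\<lambda>n. op_apply A (x (r n))) \<longlonglongrightarrow> l"
    using compact_operator_subseq[OF assms] by metis
  moreover have "(\<lambda>n. op_apply (B * A) (x (r n))) \<longlonglongrightarrow> op_apply B l"
    using bounded_linear.tendsto[OF bounded_linear_op_apply l] by simp
  ultimately show "\<exists>r l. strict_mono (r :: nat \<Rightarrow> nat) \<and> (\<lambda>n. op_apply (B * A) (x (r n))) \<longlonglongrightarrow> l"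
    by blast
qed

lemma compact_operators_mult_right:
  assumes "A \<in> compact_operators" shows "A * B \<in> compact_operators"
proof (rule compact_operatorI_subseq)
  fix x :: "nat \<Rightarrow> 'a" assume "\<And>n. norm (x n) \<le> 1"
  then have "norm (op_apply B (x n)) \<le> norm B" for n
    using norm_op_apply[of B "x n"] mult_left_le[of "norm (x n)" "norm B"] by (metis norm_ge_zero order_trans)
  then obtain r l where "strict_mono (r :: nat \<Rightarrow> nat)" "(\<lambda>n. op_apply A (op_apply B (x (r n)))) \<longlonglongrightarrow> l"
    by (rule compact_operator_subseq[OF assms])
  then show "\<exists>r l. strict_mono (r :: nat \<Rightarrow> nat) \<and> (\<lambda>n. op_apply (A * B) (x (r n))) \<longlonglongrightarrow> l"
    by (intro exI[of _ r] exI[of _ l]) simp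
qed

text \<open>
  Schauder's theorem in Hilbert space: from \<open>norm (star A z) ^ 2 = cinner (A * star A z) z\<close> it
  follows that \<open>star A\<close> maps a bounded sequence to a Cauchy sequence when \<open>A * star A\<close> does.
\<close>

lemma compact_operators_star:
  assumes "A \<in> compact_operators" shows "star A \<in> compact_operators"
proof (rule compact_operatorI_subseq)
  fix x :: "nat \<Rightarrow> 'a" assume x: "\<And>n. norm (x n) \<le> 1"
  obtain r l where r: "strict_mono (r :: nat \<Rightarrow> nat)" and l: "(\<lambda>n. op_apply (A * star A) (x (r n))) \<longlonglongrightarrow> l"
    using compact_operator_subseq[OF compact_operators_mult_right[OF assms]] x by metis
  have bound: "(norm (op_apply (star A) z))\<^sup>2 \<le> norm (op_apply (A * star A) z) * norm z" for z
    using norm_op_apply_sq[of "star A" z] cmod_cinner_le[of "op_apply (A * star A) z" z]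
      complex_Re_le_cmod[of "cinner (op_apply (A * star A) z) z"] by (simp add: star_star)
  have "Cauchy (\<lambda>n. op_apply (star A) (x (r n)))"
  proof (rule metric_CauchyI)
    fix e :: real assume e: "0 < e"
    obtain N where N: "\<And>m n. N \<le> m \<Longrightarrow> N \<le> n \<Longrightarrow>
        dist (op_apply (A * star A) (x (r m))) (op_apply (A * star A) (x (r n))) < e\<^sup>2 / 2"
      using metric_CauchyD[OF LIMSEQ_imp_Cauchy[OF l], of "e\<^sup>2 / 2"] e by auto
    have "dist (op_apply (star A) (x (r m))) (op_apply (star A) (x (r n))) < e" if mn: "N \<le> m" "N \<le> n" for m n
    proof -
      let ?z = "x (r m) - x (r n)"
      have "norm ?z \<le> 2"
        using norm_triangle_ineq4[of "x (r m)" "x (r n)"] x[of "r m"] x[of "r n"] by linarith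
      then have "norm (op_apply (A * star A) ?z) * norm ?z \<le> norm (op_apply (A * star A) ?z) * 2"
        by (intro mult_left_mono) auto
      also have "norm (op_apply (A * star A) ?z) < e\<^sup>2 / 2"
        using N[OF mn] by (simp only: op_apply_diff dist_norm)
      finally have "(norm (op_apply (star A) ?z))\<^sup>2 < e\<^sup>2"
        using bound[of ?z] by linarith
      then have "norm (op_apply (star A) ?z) < e"
        by (rule power2_less_imp_less) (use e in simp)
      then show ?thesis
        by (simp add: dist_norm op_apply_diff)
    qed
    then show "\<exists>M. \<forall>m\<ge>M. \<forall>n\<ge>M. dist (op_apply (star A) (x (r m))) (op_apply (star A) (x (r n))) < e"
      by blast
  qed
  then show "\<exists>r l. strict_mono (r :: nat \<Rightarrow> nat) \<and> (\<lambda>n. op_apply (star A) (x (r n))) \<longlonglongrightarrow> l"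
    using r Cauchy_convergent convergent_def by blast
qed

lemma compact_operators_add:
  assumes "A \<in> compact_operators" "B \<in> compact_operators" shows "A + B \<in> compact_operators"
proof (rule compact_operatorI_subseq)
  fix x :: "nat \<Rightarrow> 'a" assume x: "\<And>n. norm (x n) \<le> 1"
  obtain r l where r: "strict_mono (r :: nat \<Rightarrow> nat)" and l: "(\<lambda>n. op_apply A (x (r n))) \<longlonglongrightarrow> l"
    using compact_operator_subseq[OF assms(1)] x by metis
  obtain s m where s: "strict_mono (s :: nat \<Rightarrow> nat)" and m: "(\<lambda>n. op_apply B (x (r (s n)))) \<longlonglongrightarrow> m"
    using compact_operator_subseq[OF assms(2), of "\<lambda>n. x (r n)"] x by metis
  have "(\<lambda>n. op_apply (A + B) (x ((r \<circ> s) n))) \<longlonglongrightarrow> l + m"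
    using tendsto_add[OF LIMSEQ_subseq_LIMSEQ[OF l s] m] by (simp add: o_def)
  then show "\<exists>r l. strict_mono (r :: nat \<Rightarrow> nat) \<and> (\<lambda>n. op_apply (A + B) (x (r n))) \<longlonglongrightarrow> l"
    using strict_mono_o[OF r s] by blast
qed

lemma compact_operator_finite_net:
  assumes "A \<in> compact_operators" "0 < e"
  obtains K where "finite K" "\<And>x. norm x \<le> 1 \<Longrightarrow> \<exists>y\<in>K. dist y (op_apply A x) < e"
proof -
  have "compact (closure (op_apply A ` cball 0 1))"
    using assms(1) by (simp add: compact_operators_def)
  then obtain K where "finite K" "closure (op_apply A ` cball 0 1) \<subseteq> (\<Union>y\<in>K. ball y e)"
    unfolding compact_eq_totally_bounded using assms(2) by blast
  moreover have "op_apply A x \<in> closure (op_apply A ` cball 0 1)" if "norm x \<le> 1" for x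
    using that by (intro set_mp[OF closure_subset]) auto
  ultimately show thesis
    by (intro that) (auto simp: subset_iff)
qed

lemma closed_compact_operators: "closed (compact_operators :: 'h::complex_hilbert_space bounded_operator set)"
  unfolding closed_sequential_limits
proof (intro allI impI)
  fix F :: "nat \<Rightarrow> 'h bounded_operator" and A
  assume F: "(\<forall>n. F n \<in> compact_operators) \<and> F \<longlonglongrightarrow> A"
  let ?S = "op_apply A ` cball 0 1"
  have "\<exists>K. finite K \<and> closure ?S \<subseteq> (\<Union>y\<in>K. ball y e)" if e: "0 < e" for e
  proof -
    obtain n where n: "norm (A - F n) < e / 3"
      using metric_LIMSEQ_D[of F A "e / 3"] F e by (auto simp: dist_norm norm_minus_commute)
    obtain K where K: "finite K" "\<And>x. norm x \<le> 1 \<Longrightarrow> \<exists>y\<in>K. dist y (op_apply (F n) x) < e / 3"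
      using compact_operator_finite_net[of "F n" "e / 3"] F e by auto
    have "closure ?S \<subseteq> (\<Union>y\<in>K. ball y e)"
    proof
      fix z assume "z \<in> closure ?S"
      then obtain x where x: "norm x \<le> 1" "dist (op_apply A x) z < e / 3"
        using e unfolding closure_approachable by (force dest: spec[of _ "e / 3"])
      obtain y where y: "y \<in> K" "dist y (op_apply (F n) x) < e / 3"
        using K(2)[OF x(1)] by blast
      have "norm (op_apply (A - F n) x) \<le> norm (A - F n)"
        using norm_op_apply[of "A - F n" x] mult_left_le[OF x(1) norm_ge_zero[of "A - F n"]] by linarith
      then have "dist (op_apply A x) (op_apply (F n) x) < e / 3"
        using n by (simp add: dist_norm)
      then have "dist y z < e"
        using x(2) y(2) by metric
      with y(1) show "z \<in> (\<Union>y\<in>K. ball y e)"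
        by auto
    qed
    with K(1) show ?thesis
      by blast
  qed
  then show "A \<in> compact_operators"
    unfolding compact_operators_def compact_eq_totally_bounded by (simp add: complete_eq_closed)
qed

lemma cstar_subalgebra_compact_operators:
  "cstar_subalgebra (compact_operators :: 'h::complex_hilbert_space bounded_operator set)"
proof -
  have scale: "c *\<^sub>C A \<in> compact_operators" if "A \<in> compact_operators" for c and A :: "'h bounded_operator"
  proof -
    obtain B :: "'h bounded_operator" where "\<And>x. op_apply B x = c *\<^sub>C x"
      using ex_op_apply[OF bounded_linear_scaleC[of c]] by (metis mult.commute scaleC_scaleC)
    then have "c *\<^sub>C A = B * A"
      by (intro op_eqI) simp
    then show ?thesis
      using compact_operators_mult_left[OF that] by simp
  qed
  have zero: "0 \<in> (compact_operators :: 'h bounded_operator set)"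
    by (rule compact_operatorI_subseq) (auto intro!: exI[of _ id] simp: strict_mono_id)
  show ?thesis
    unfolding cstar_subalgebra_def
    by (auto intro: scale zero closed_compact_operators compact_operators_add
        compact_operators_mult_left compact_operators_star)
qed

text \<open>
  Take \<open>x n\<close> in the unit ball with \<open>norm (A (x n))\<close> tending to \<open>norm A\<close>. By compactness \<open>A (x n)\<close> converges
  along a subsequence, and since the \<open>x n\<close> are asymptotically eigenvectors of \<open>star A * A\<close>, they
  converge along it as well.
\<close>

lemma compact_operator_norming_vector:
  assumes A: "A \<in> compact_operators" and "A \<noteq> 0"
  obtains x where "norm x = 1" "op_apply (star A * A) x = (norm A)\<^sup>2 *\<^sub>R x" "norm (op_apply A x) = norm A"
proof -
  let ?N = "norm A"
  have N: "0 < ?N"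
    using \<open>A \<noteq> 0\<close> by simp
  have "\<exists>x. norm x \<le> 1 \<and> ?N - inverse (real (Suc n)) < norm (op_apply A x)" for n
  proof (rule ccontr)
    assume *: "\<not> ?thesis"
    then have le: "norm (op_apply A x) \<le> ?N - inverse (real (Suc n))" if "norm x \<le> 1" for x
      using that by force
    have "norm A \<le> ?N - inverse (real (Suc n))"
      by (rule norm_op_le) (use le le[of 0] in auto)
    then show False
      by simp
  qed
  then obtain x where x: "\<And>n. norm (x n) \<le> 1" "\<And>n. ?N - inverse (real (Suc n)) < norm (op_apply A (x n))"
    by metis
  have upper: "norm (op_apply A (x n)) \<le> ?N" for n
    using norm_op_apply[of A "x n"] mult_left_le[OF x(1)[of n] norm_ge_zero[of A]] by linarith
  have "(\<lambda>n. ?N - inverse (real (Suc n))) \<longlonglongrightarrow> ?N - 0"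
    by (rule tendsto_diff[OF tendsto_const LIMSEQ_inverse_real_of_nat])
  then have lower: "(\<lambda>n. ?N - inverse (real (Suc n))) \<longlonglongrightarrow> ?N"
    by simp
  have attained: "(\<lambda>n. norm (op_apply A (x n))) \<longlonglongrightarrow> ?N"
    by (rule real_tendsto_sandwich[OF always_eventually always_eventually lower tendsto_const])
      (intro allI less_imp_le x(2) upper)+
  then have "(\<lambda>n. 2 * ?N\<^sup>2 * (?N\<^sup>2 - (norm (op_apply A (x n)))\<^sup>2)) \<longlonglongrightarrow> 2 * ?N\<^sup>2 * (?N\<^sup>2 - ?N\<^sup>2)"
    by (intro tendsto_intros)
  then have small: "(\<lambda>n. 2 * ?N\<^sup>2 * (?N\<^sup>2 - (norm (op_apply A (x n)))\<^sup>2)) \<longlonglongrightarrow> 0"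
    by simp
  have sq: "(\<lambda>n. (norm (op_apply (star A * A) (x n) - ?N\<^sup>2 *\<^sub>R x n))\<^sup>2) \<longlonglongrightarrow> 0"
  proof (rule real_tendsto_sandwich[OF _ _ tendsto_const small])
    show "\<forall>\<^sub>F n in sequentially. 0 \<le> (norm (op_apply (star A * A) (x n) - ?N\<^sup>2 *\<^sub>R x n))\<^sup>2"
      by (rule always_eventually) (rule allI, rule zero_le_power2)
    show "\<forall>\<^sub>F n in sequentially. (norm (op_apply (star A * A) (x n) - ?N\<^sup>2 *\<^sub>R x n))\<^sup>2
        \<le> 2 * ?N\<^sup>2 * (?N\<^sup>2 - (norm (op_apply A (x n)))\<^sup>2)"
      by (rule always_eventually) (rule allI, rule norming_defect, rule x(1))
  qed
  have defect: "(\<lambda>n. op_apply (star A * A) (x n) - ?N\<^sup>2 *\<^sub>R x n) \<longlonglongrightarrow> 0"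
    using tendsto_real_sqrt[OF sq] by (simp add: tendsto_norm_zero_iff)
  obtain r y where r: "strict_mono (r :: nat \<Rightarrow> nat)" and y: "(\<lambda>n. op_apply A (x (r n))) \<longlonglongrightarrow> y"
    by (rule compact_operator_subseq[OF A x(1)])
  have "(\<lambda>n. op_apply (star A * A) (x (r n)) - (op_apply (star A * A) (x (r n)) - ?N\<^sup>2 *\<^sub>R x (r n)))
      \<longlonglongrightarrow> op_apply (star A) y - 0"
    using bounded_linear.tendsto[OF bounded_linear_op_apply y, of "star A"] LIMSEQ_subseq_LIMSEQ[OF defect r]
    by (intro tendsto_diff) (simp_all add: o_def)
  then have "(\<lambda>n. ?N\<^sup>2 *\<^sub>R x (r n)) \<longlonglongrightarrow> op_apply (star A) y"
    by simp
  from tendsto_scaleR[OF tendsto_const this, of "inverse (?N\<^sup>2)"] obtain z where z: "(\<lambda>n. x (r n)) \<longlonglongrightarrow> z"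
    using N by auto
  have "norm z \<le> 1"
    by (rule tendsto_upperbound[OF tendsto_norm[OF z]]) (use x(1) in auto)
  have "(\<lambda>n. norm (op_apply A (x (r n)))) \<longlonglongrightarrow> norm (op_apply A z)"
    by (intro tendsto_norm bounded_linear.tendsto[OF bounded_linear_op_apply z])
  moreover have "(\<lambda>n. norm (op_apply A (x (r n)))) \<longlonglongrightarrow> ?N"
    using LIMSEQ_subseq_LIMSEQ[OF attained r] by (simp add: o_def)
  ultimately have Az: "norm (op_apply A z) = ?N"
    by (rule LIMSEQ_unique)
  then have "?N * 1 \<le> ?N * norm z"
    using norm_op_apply[of A z] by simp
  then have "norm z = 1"
    using N \<open>norm z \<le> 1\<close> by simp
  with that norming_vector_eigen[OF \<open>norm z \<le> 1\<close> Az] Az show thesis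
    by blast
qed

section \<open>Norming projections\<close>

lemma op_projection_le_iff:
  fixes p f :: "'h::complex_hilbert_space bounded_operator"
  assumes "projection f"
  shows "p * f = f \<longleftrightarrow> (\<forall>u. op_apply f u = u \<longrightarrow> op_apply p u = u)"
proof
  show "\<forall>u. op_apply f u = u \<longrightarrow> op_apply p u = u" if "p * f = f"
    using that by (metis op_apply_times)
  show "p * f = f" if "\<forall>u. op_apply f u = u \<longrightarrow> op_apply p u = u"
    using that projectionD(2)[OF assms] by (intro op_eqI) (metis op_apply_times)
qed

lemma op_projection_nonzero:
  fixes p :: "'h::complex_hilbert_space bounded_operator"
  assumes "projection p" "p \<noteq> 0"
  obtains u where "norm u = 1" "op_apply p u = u"
proof -
  obtain v where v: "op_apply p v \<noteq> 0"
    using assms(2) op_eqI[of p 0] by auto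
  have "op_apply p (op_apply p v /\<^sub>R norm (op_apply p v)) = op_apply p v /\<^sub>R norm (op_apply p v)"
    using projectionD(2)[OF assms(1)] by (metis op_apply_scaleR op_apply_times)
  with v show thesis
    by (intro that[of "op_apply p v /\<^sub>R norm (op_apply p v)"]) auto
qed

text \<open>
  For nonzero \<open>x\<close>, the range of \<open>e\<close> is the image under \<open>x\<close> of the space on which \<open>x\<close> attains its norm.
  The eigenspace is taken for \<open>x * star x\<close> and not for \<open>star x * x\<close> because the perturbations
  \<open>x + y * z\<close> of the strong relation multiply \<open>y\<close> from the right, so that only the range of \<open>y\<close> matters.
\<close>

definition norming_projection ::
    "'h::complex_hilbert_space bounded_operator \<Rightarrow> 'h bounded_operator \<Rightarrow> bool"
  where "norming_projection x e \<longleftrightarrow> projection e \<and>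
    (\<forall>u. op_apply e u = u \<longleftrightarrow> op_apply (x * star x) u = (norm x)\<^sup>2 *\<^sub>R u)"

lemma norming_projection_unique:
  assumes "norming_projection x e" "norming_projection x f" shows "e = f"
proof -
  have "projection e" "projection f" and fixed: "op_apply e u = u \<longleftrightarrow> op_apply f u = u" for u
    using assms by (auto simp: norming_projection_def)
  then have "e * f = f" "f * e = e"
    by (simp_all add: op_projection_le_iff)
  then show ?thesis
    using mult_eq_star[of e f f] \<open>projection e\<close> \<open>projection f\<close> by (simp add: projectionD)
qed

lemma norming_projection_mult:
  assumes "norming_projection x e"
  shows "x * star x * e = (norm x)\<^sup>2 *\<^sub>R e" "e * (x * star x) = (norm x)\<^sup>2 *\<^sub>R e"
proof -
  have e: "projection e" and fixed: "op_apply e u = u \<longleftrightarrow> op_apply (x * star x) u = (norm x)\<^sup>2 *\<^sub>R u" for u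
    using assms by (auto simp: norming_projection_def)
  show 1: "x * star x * e = (norm x)\<^sup>2 *\<^sub>R e"
  proof (rule op_eqI)
    fix u
    have "op_apply e (op_apply e u) = op_apply e u"
      by (metis op_apply_times projectionD(2)[OF e])
    then show "op_apply (x * star x * e) u = op_apply ((norm x)\<^sup>2 *\<^sub>R e) u"
      using fixed[of "op_apply e u"] by simp
  qed
  show "e * (x * star x) = (norm x)\<^sup>2 *\<^sub>R e"
    using mult_eq_star[OF 1] projectionD(1)[OF e] by (simp add: star_mult star_star star_scaleR)
qed

lemma norming_projection_self:
  assumes "projection p" "p \<noteq> 0" shows "norming_projection p p"
  using assms norm_projection[OF assms] projectionD[OF assms(1)] by (simp add: norming_projection_def)

text \<open>
  The projection onto the fixed space of \<open>h = x * star x / (norm x)\<^sup>2\<close> is the norm limit of the powers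
  of \<open>h\<close>, and this puts it into every closed algebra that contains \<open>h\<close>: compactness of \<open>h\<close> gives
  \<open>norm (h - e) < 1\<close>, and \<open>h ^ n - e = (h - e) ^ n\<close> for positive \<open>n\<close>.
\<close>

lemma ex_norming_projection_compact:
  fixes x :: "'h::complex_hilbert_space bounded_operator"
  assumes x: "x \<in> compact_operators" and "x \<noteq> 0"
    and C: "cstar_subalgebra C" "x \<in> C"
  obtains e where "e \<in> C" "norming_projection x e" "e \<noteq> 0" "norm (x * star x - (norm x)\<^sup>2 *\<^sub>R e) < (norm x)\<^sup>2"
proof -
  define h where "h = (x * star x) /\<^sub>R (norm x)\<^sup>2"
  have nx: "0 < norm x"
    using \<open>x \<noteq> 0\<close> by simp
  have h_star: "star h = h"
    by (simp add: h_def star_scaleR star_mult star_star)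
  have h_cinner: "cinner (op_apply h u) v = cinner u (op_apply h v)" for u v
    by (metis h_star cinner_star_left)
  have h_pos: "0 \<le> Re (cinner (op_apply h u) u)" for u
  proof -
    have "Re (cinner (op_apply h u) u) = inverse ((norm x)\<^sup>2) * (norm (op_apply (star x) u))\<^sup>2"
      unfolding h_def op_apply_scaleR_left Re_cinner_scaleR_left norm_op_apply_sq star_star ..
    then show ?thesis
      by simp
  qed
  have norm_h: "norm h = 1"
    using nx by (simp add: h_def cstar_identity_right)
  have h_fixed: "op_apply h u = u \<longleftrightarrow> op_apply (x * star x) u = (norm x)\<^sup>2 *\<^sub>R u" for u
  proof -
    have "op_apply (x * star x) u = (norm x)\<^sup>2 *\<^sub>R op_apply h u"
      using nx by (simp add: h_def)
    then show ?thesis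
      using nx by (simp only: scaleR_cancel_left) simp
  qed
  have h_compact: "h \<in> compact_operators"
    unfolding h_def by (intro cstar_subalgebra_scaleR[OF cstar_subalgebra_compact_operators]
        compact_operators_mult_right x)
  have h_C: "h \<in> C"
    unfolding h_def by (intro cstar_subalgebra_intros[OF C(1)] C(2))
  obtain E where E: "E \<subseteq> {u. norm u = 1 \<and> op_apply h u = u}" and on: "orthonormal_family E (\<lambda>u. u)"
    and max: "\<And>u. u \<in> {u. norm u = 1 \<and> op_apply h u = u} \<Longrightarrow> (\<And>v. v \<in> E \<Longrightarrow> cinner u v = 0) \<Longrightarrow> False"
    using ex_maximal_orthonormal[of "{u. norm u = 1 \<and> op_apply h u = u}"] by blast
  obtain e where e: "\<And>u. op_apply e u = basis_transfer E (\<lambda>u. u) (\<lambda>u. u) u"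
    using ex_op_apply[OF bounded_linear_basis_transfer[OF on on] basis_transfer_scaleC[OF on on]] by metis
  have he: "op_apply h (op_apply e u) = op_apply e u" for u
  proof -
    have "closed {u. op_apply h u = u}"
      by (intro closed_Collect_eq bounded_linear.continuous_on[OF bounded_linear_op_apply] continuous_on_id)
    moreover have "subspace {u. op_apply h u = u}"
      by (auto simp: subspace_def op_apply_add op_apply_scaleR)
    ultimately have "op_apply e u \<in> {u. op_apply h u = u}"
      unfolding e by (rule has_sum_in_closed_subspace[OF basis_transfer_has_sum[OF on on]])
        (use E in \<open>auto simp: op_apply_scaleC\<close>)
    then show ?thesis by simp
  qed
  have e_fixed: "op_apply e u = u" if u: "op_apply h u = u" for u
    unfolding e
  proof (rule basis_transfer_eq_self[OF on])
    fix y assume y: "\<And>v. v \<in> E \<Longrightarrow> cinner y v = 0"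
    have e_y: "op_apply e y = 0"
      unfolding e by (rule basis_transfer_eq_zero) (rule y)
    define w where "w = u - op_apply e u"
    have "cinner w v = 0" if "v \<in> E" for v
      using that by (simp add: w_def e cinner_diff_left basis_transfer_adjoint[OF on on] basis_transfer_basis[OF on on])
    moreover have "op_apply h w = w"
      by (simp add: w_def op_apply_diff u he)
    ultimately have "w = 0"
      using max[of "w /\<^sub>R norm w"] by (cases "w = 0") (auto simp: op_apply_scaleR cinner_scaleR_left)
    then have "cinner u y = cinner (op_apply e u) y"
      by (simp add: w_def)
    also have "\<dots> = cinner u (op_apply e y)"
      by (simp add: e basis_transfer_adjoint[OF on on])
    finally show "cinner u y = 0"
      by (simp add: e_y)
  qed
  have e_star: "star e = e"
    by (rule star_eqI) (simp add: e basis_transfer_adjoint[OF on on])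
  have e_mult: "e * e = e" "h * e = e"
    by (rule op_eqI, simp add: e_fixed he)+
  then have "e * h = e"
    using mult_eq_star[of h e e] by (simp add: h_star e_star)
  have norming: "norming_projection x e"
    unfolding norming_projection_def projection_def
    using e_star e_mult e_fixed he h_fixed by metis
  define g where "g = h - e"
  have g_star: "star g = g"
    by (simp add: g_def star_diff h_star e_star)
  have "e \<in> compact_operators"
    using compact_operators_mult_right[OF h_compact, of e] by (simp add: e_mult)
  then have g_compact: "g \<in> compact_operators"
    unfolding g_def by (intro cstar_subalgebra_diff[OF cstar_subalgebra_compact_operators] h_compact)
  have g_g: "g * g = h * h - e" and g_e: "e * g = 0"
    by (simp_all add: g_def algebra_simps e_mult \<open>e * h = e\<close>)
  have norm_g: "norm g < 1"
  proof (rule ccontr)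
    assume ge: "\<not> norm g < 1"
    then obtain u where u: "norm u = 1" "op_apply (g * g) u = (norm g)\<^sup>2 *\<^sub>R u"
      using compact_operator_norming_vector[OF g_compact] by (metis g_star norm_zero zero_less_one)
    have "(norm g)\<^sup>2 *\<^sub>R op_apply e u = op_apply (e * (g * g)) u"
      by (simp add: u(2)[unfolded op_apply_times] op_apply_scaleR)
    also have "\<dots> = 0"
      using g_e by (simp flip: mult.assoc)
    finally have eu: "op_apply e u = 0"
      using ge by auto
    then have hh: "op_apply h (op_apply h u) = (norm g)\<^sup>2 *\<^sub>R u"
      using u(2) by (simp only: g_g) simp
    have "norm (op_apply h (op_apply h u)) \<le> 1"
      using norm_op_apply[of h "op_apply h u"] norm_op_apply[of h u] by (simp add: norm_h u(1))
    then have "(norm g)\<^sup>2 \<le> 1"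
      by (simp add: hh u(1))
    then have "norm g = 1"
      using ge by (simp add: power2_eq_square) (smt (verit) mult_less_cancel_left2 mult_le_cancel_left2 mult_nonneg_nonneg)
    \<comment> \<open>\<open>h\<close> is positive, so its square can fix a vector only if \<open>h\<close> does.\<close>
    define v where "v = op_apply h u - u"
    have "op_apply h v = - v"
      using hh \<open>norm g = 1\<close> by (simp add: v_def op_apply_diff)
    then have "Re (cinner (op_apply h v) v) = - (norm v)\<^sup>2"
      by (simp add: cinner_minus_left norm_sq_eq_Re_cinner)
    with h_pos[of v] have "v = 0"
      by simp
    then have "op_apply e u = u"
      by (intro e_fixed) (simp add: v_def)
    with eu u(1) show False
      by simp
  qed
  define p where "p n = rec_nat h (\<lambda>_. (*) h) n" for n :: nat
  have p_0: "p 0 = h" and p_Suc: "p (Suc n) = h * p n" for n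
    by (simp_all add: p_def)
  have p_C: "p n \<in> C" for n
    by (induction n) (auto simp: p_0 p_Suc h_C cstar_subalgebra_mult[OF C(1)])
  have e_p: "e * p n = e" for n
    by (induction n) (auto simp: p_0 p_Suc \<open>e * h = e\<close> simp flip: mult.assoc)
  have p_e: "norm (p n - e) \<le> norm g ^ n" for n
  proof (induction n)
    case 0
    show ?case
      using norm_g by (simp add: p_0 flip: g_def)
  next
    case (Suc n)
    have "p (Suc n) - e = g * (p n - e)"
      by (simp add: p_Suc g_def algebra_simps e_mult e_p)
    then have "norm (p (Suc n) - e) \<le> norm g * norm (p n - e)"
      by (simp add: norm_mult_ineq)
    also have "\<dots> \<le> norm g * norm g ^ n"
      by (intro mult_left_mono Suc.IH norm_ge_zero)
    finally show ?case by simp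
  qed
  have "(\<lambda>n. p n - e) \<longlonglongrightarrow> 0"
    by (rule tendsto_norm_zero_cancel, rule real_tendsto_sandwich[OF _ _ tendsto_const LIMSEQ_power_zero[of "norm g"]])
      (use norm_g p_e in auto)
  then have "p \<longlonglongrightarrow> e"
    by (simp add: LIM_zero_iff)
  then have "e \<in> C"
    by (rule cstar_subalgebra_LIMSEQ[OF C(1) p_C])
  moreover have "e \<noteq> 0"
    using norm_g norm_h by (auto simp: g_def)
  moreover have "x * star x - (norm x)\<^sup>2 *\<^sub>R e = (norm x)\<^sup>2 *\<^sub>R g"
    using nx by (simp add: g_def h_def scaleR_diff_right)
  then have "norm (x * star x - (norm x)\<^sup>2 *\<^sub>R e) < (norm x)\<^sup>2"
    using norm_g nx by simp
  ultimately show thesis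
    using norming that by blast
qed

section \<open>Algebras of compact operators\<close>

locale compact_operator_algebra =
  fixes C :: "'h::complex_hilbert_space bounded_operator set"
  assumes subalgebra: "cstar_subalgebra C" and compact: "C \<subseteq> compact_operators"
begin

lemmas intros = cstar_subalgebra_intros[OF subalgebra]

lemma ex_norming_projection:
  assumes "x \<in> C" "x \<noteq> 0"
  obtains e where "e \<in> C" "norming_projection x e" "e \<noteq> 0"
    "norm (x * star x - (norm x)\<^sup>2 *\<^sub>R e) < (norm x)\<^sup>2"
  using ex_norming_projection_compact[OF _ assms(2) subalgebra assms(1)] compact assms(1) by blast

lemma norming_projection_in:
  assumes "x \<in> C" "x \<noteq> 0" "norming_projection x e" shows "e \<in> C" "e \<noteq> 0" "projection e"
proof -
  show "e \<in> C" "e \<noteq> 0"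
    using ex_norming_projection[OF assms(1,2)] norming_projection_unique[OF assms(3)] by metis+
  show "projection e"
    using assms(3) by (simp add: norming_projection_def)
qed

subsection \<open>Strong Birkhoff--James orthogonality\<close>

text \<open>
  If \<open>x\<close> is orthogonal to \<open>y\<close>, the perturbation \<open>x - t y star y x\<close> with small \<open>t > 0\<close> does not lower the
  norm. It contracts \<open>x v\<close> strictly unless \<open>star y\<close> kills \<open>x v\<close>, so at a vector \<open>v\<close> where the perturbed
  operator attains its norm, \<open>x\<close> attains its norm as well and \<open>star y x v = 0\<close>.
\<close>

theorem strong_BJ_orthogonal_iff:
  assumes x: "x \<in> C" "x \<noteq> 0" and y: "y \<in> C" and e: "norming_projection x e"
  shows "strong_BJ_orthogonal C x y \<longleftrightarrow> (\<exists>u. u \<noteq> 0 \<and> op_apply e u = u \<and> op_apply (star y) u = 0)"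
proof
  assume "\<exists>u. u \<noteq> 0 \<and> op_apply e u = u \<and> op_apply (star y) u = 0"
  then obtain u where u: "u \<noteq> 0" "op_apply (x * star x) u = (norm x)\<^sup>2 *\<^sub>R u" "op_apply (star y) u = 0"
    using e by (auto simp: norming_projection_def)
  define w where "w = op_apply (star x) u"
  have "(norm w)\<^sup>2 = (norm x * norm u)\<^sup>2"
    using norm_op_apply_sq[of "star x" u] u(2)
    by (simp add: w_def star_star cinner_scaleR_left power_mult_distrib flip: norm_sq_eq_Re_cinner)
  then have norm_w: "norm w = norm x * norm u"
    by (rule power2_eq_imp_eq) auto
  show "strong_BJ_orthogonal C x y"
    unfolding strong_BJ_orthogonal_def
  proof
    fix z assume "z \<in> C"
    have "cinner (op_apply (x + y * z) w) u = of_real ((norm x)\<^sup>2 * (norm u)\<^sup>2)"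
      using u(2) by (simp add: cinner_add_left w_def cinner_scaleR_left cinner_self u(3) flip: cinner_star_right)
    then have "(norm x)\<^sup>2 * (norm u)\<^sup>2 = cmod (cinner (op_apply (x + y * z) w) u)"
      by (simp only: norm_of_real) simp
    also have "\<dots> \<le> norm (op_apply (x + y * z) w) * norm u"
      by (rule cmod_cinner_le)
    also have "\<dots> \<le> norm (x + y * z) * norm w * norm u"
      by (intro mult_right_mono norm_op_apply norm_ge_zero)
    also have "\<dots> = norm (x + y * z) * (norm x * (norm u)\<^sup>2)"
      by (simp add: norm_w power2_eq_square)
    finally have "norm x * (norm x * (norm u)\<^sup>2) \<le> norm (x + y * z) * (norm x * (norm u)\<^sup>2)"
      by (simp add: power2_eq_square mult.assoc)
    then show "norm x \<le> norm (x + y * z)"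
      by (rule mult_right_le_imp_le) (use x u in simp)
  qed
next
  assume orth: "strong_BJ_orthogonal C x y"
  define t where "t = 1 / (1 + (norm y)\<^sup>2)"
  have t: "0 < t" "t * (norm y)\<^sup>2 \<le> 1"
    by (auto simp: t_def add_pos_nonneg field_simps)
  define a where "a = x + y * ((- t) *\<^sub>R (star y * x))"
  have z: "(- t) *\<^sub>R (star y * x) \<in> C"
    by (intro intros x y)
  have norm_a: "norm x \<le> norm a"
    using orth z unfolding strong_BJ_orthogonal_def a_def by blast
  have "a \<in> compact_operators"
    using compact intros(2)[OF x(1) intros(3)[OF y z]] by (auto simp: a_def)
  moreover have "a \<noteq> 0"
    using norm_a x(2) by auto
  ultimately obtain v where v: "norm v = 1" "norm (op_apply a v) = norm a"
    by (rule compact_operator_norming_vector)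
  define w where "w = op_apply x v"
  define s where "s = (norm (op_apply (star y) w))\<^sup>2"
  have "(norm (op_apply y (op_apply (star y) w)))\<^sup>2 \<le> (norm y * norm (op_apply (star y) w))\<^sup>2"
    by (intro power_mono norm_op_apply norm_ge_zero)
  then have "t\<^sup>2 * (norm (op_apply y (op_apply (star y) w)))\<^sup>2 \<le> t\<^sup>2 * ((norm y)\<^sup>2 * s)"
    by (intro mult_left_mono) (simp_all add: s_def power_mult_distrib)
  also have "\<dots> = (t * (norm y)\<^sup>2) * (t * s)"
    by (simp add: power2_eq_square)
  also have "\<dots> \<le> 1 * (t * s)"
    using t by (intro mult_right_mono) (auto simp: s_def)
  finally have tail: "t\<^sup>2 * (norm (op_apply y (op_apply (star y) w)))\<^sup>2 \<le> t * s"
    by simp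
  have "op_apply a v = w - t *\<^sub>R op_apply y (op_apply (star y) w)"
    by (simp add: a_def w_def op_apply_scaleR)
  moreover have "Re (cinner w (op_apply y (op_apply (star y) w))) = s"
    by (simp add: s_def norm_sq_eq_Re_cinner flip: cinner_star_left)
  ultimately have "(norm a)\<^sup>2 = (norm w)\<^sup>2 + t\<^sup>2 * (norm (op_apply y (op_apply (star y) w)))\<^sup>2 - 2 * (t * s)"
    by (simp add: norm_diff_sq Re_cinner_scaleR_right power_mult_distrib flip: v(2))
  moreover have "(norm x)\<^sup>2 \<le> (norm a)\<^sup>2"
    using norm_a by (intro power_mono) auto
  moreover have norm_w: "norm w \<le> norm x"
    using norm_op_apply[of x v] by (simp add: w_def v(1))
  then have "(norm w)\<^sup>2 \<le> (norm x)\<^sup>2"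
    by (intro power_mono) auto
  moreover have "0 \<le> s"
    by (simp add: s_def)
  ultimately have "t * s \<le> 0" and sq: "(norm x)\<^sup>2 \<le> (norm w)\<^sup>2 - t * s"
    using tail by linarith+
  then have "s = 0"
    using t(1) \<open>0 \<le> s\<close> by (simp add: mult_le_0_iff)
  with sq have "norm w = norm x"
    using norm_w power2_le_imp_le[of "norm x" "norm w"] by simp
  then have "op_apply (star x * x) v = (norm x)\<^sup>2 *\<^sub>R v"
    by (intro norming_vector_eigen) (simp_all add: v(1) w_def)
  then have "op_apply (x * star x) w = (norm x)\<^sup>2 *\<^sub>R w"
    by (simp add: w_def op_apply_scaleR)
  then have "op_apply e w = w"
    using e by (simp add: norming_projection_def)
  moreover have "w \<noteq> 0"
    using \<open>norm w = norm x\<close> x(2) by auto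
  moreover have "op_apply (star y) w = 0"
    using \<open>s = 0\<close> by (simp add: s_def)
  ultimately show "\<exists>u. u \<noteq> 0 \<and> op_apply e u = u \<and> op_apply (star y) u = 0"
    by blast
qed

lemma strong_BJ_orthogonal_self_iff:
  assumes x: "x \<in> C" shows "strong_BJ_orthogonal C x x \<longleftrightarrow> x = 0"
proof (cases "x = 0")
  case False
  obtain e where e: "norming_projection x e"
    using ex_norming_projection[OF x False] by blast
  have "u = 0" if "op_apply e u = u" "op_apply (star x) u = 0" for u
    using that e False by (simp add: norming_projection_def)
  then show ?thesis
    using False strong_BJ_orthogonal_iff[OF x False x e] by blast
qed (simp add: strong_BJ_orthogonal_def)

subsection \<open>Minimal projections\<close>

definition minimal_projection :: "'h bounded_operator \<Rightarrow> bool"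
  where "minimal_projection p \<longleftrightarrow> p \<in> C \<and> projection p \<and> p \<noteq> 0 \<and>
    (\<forall>f\<in>C. projection f \<and> p * f = f \<longrightarrow> f = 0 \<or> f = p)"

lemma minimal_projectionD:
  assumes "minimal_projection p"
  shows "p \<in> C" "projection p" "p \<noteq> 0" "star p = p" "p * p = p" "p * (p * x) = p * x"
  using assms projectionD[of p] by (auto simp: minimal_projection_def)

text \<open>
  A self-adjoint \<open>h\<close> in the corner satisfies \<open>h * h = N\<^sup>2 p\<close> with \<open>N = norm h\<close>, because the norming
  projection of \<open>h\<close> lies below \<open>p\<close>. Then \<open>(h + N p) / 2 N\<close> is a projection below \<open>p\<close>.
\<close>

lemma minimal_corner_selfadjoint:
  assumes p: "minimal_projection p" and h: "h \<in> C" "star h = h" "p * h = h"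
  obtains r :: real where "h = r *\<^sub>R p"
proof (cases "h = 0")
  case True
  then show thesis
    using that[of 0] by simp
next
  case False
  define N where "N = norm h"
  have N: "0 < N"
    using False by (simp add: N_def)
  obtain e where e: "e \<in> C" "norming_projection h e" "e \<noteq> 0"
    by (rule ex_norming_projection[OF h(1) False])
  then have "h * h * e = N\<^sup>2 *\<^sub>R e"
    using norming_projection_mult(1)[OF e(2)] by (simp add: h(2) N_def)
  moreover have "p * (h * h * e) = h * h * e"
    using h(3) by (simp flip: mult.assoc)
  ultimately have "p * e = e"
    using N by simp
  then have "e = p"
    using p e by (auto simp: minimal_projection_def norming_projection_def)
  then have hhp: "h * h * p = N\<^sup>2 *\<^sub>R p"
    using \<open>h * h * e = N\<^sup>2 *\<^sub>R e\<close> by simp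
  have hp: "h * p = h"
    using mult_eq_star[OF h(3)] h(2) minimal_projectionD(4)[OF p] by simp
  then have hh: "h * h = N\<^sup>2 *\<^sub>R p"
    using hhp by (simp add: mult.assoc)
  define f where "f = (h + N *\<^sub>R p) /\<^sub>R (2 * N)"
  have "(h + N *\<^sub>R p) * (h + N *\<^sub>R p) = (2 * N) *\<^sub>R (h + N *\<^sub>R p)"
    by (simp add: algebra_simps hh hp h(3) minimal_projectionD(5)[OF p] power2_eq_square flip: scaleR_add_left)
  then have "f * f = f"
    using N by (simp add: f_def)
  moreover have "star f = f"
    by (simp add: f_def star_scaleR star_add h(2) minimal_projectionD(4)[OF p])
  moreover have "p * f = f"
    by (simp add: f_def distrib_left h(3) minimal_projectionD(5)[OF p])
  moreover have "f \<in> C"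
    unfolding f_def by (intro intros h(1) minimal_projectionD(1)[OF p])
  ultimately have "f = 0 \<or> f = p"
    using p by (auto simp: minimal_projection_def projection_def)
  moreover have "h = (2 * N) *\<^sub>R f - N *\<^sub>R p"
    using N by (simp add: f_def)
  ultimately have "h = (- N) *\<^sub>R p \<or> h = N *\<^sub>R p"
    by (auto simp flip: scaleR_diff_left)
  then show thesis
    using that by blast
qed

text \<open>The scalar is obtained from the self-adjoint and skew-adjoint parts of \<open>p * d * p\<close>.\<close>

lemma minimal_corner:
  assumes p: "minimal_projection p" and d: "d \<in> C"
  obtains c where "p * d * p = c *\<^sub>C p"
proof -
  define k where "k = p * d * p"
  note pD = minimal_projectionD[OF p]
  have k: "k \<in> C" "p * k = k" "k * p = k"
    using pD d by (auto simp: k_def mult.assoc intro: intros)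
  have star_k: "p * star k = star k"
    using mult_eq_star[OF k(3)] pD(4) by simp
  obtain r where r: "k + star k = r *\<^sub>R p"
    by (rule minimal_corner_selfadjoint[OF p, of "k + star k"])
      (use k star_k in \<open>auto simp: star_add star_star add.commute distrib_left intro: intros\<close>)
  obtain s where s: "\<i> *\<^sub>C (k - star k) = s *\<^sub>R p"
    by (rule minimal_corner_selfadjoint[OF p, of "\<i> *\<^sub>C (k - star k)"])
      (use k star_k in \<open>auto simp: star_scaleC star_diff star_star mult_scaleC_right right_diff_distrib
        scaleC_minus_left scaleC_diff_right intro: intros\<close>)
  have "k - star k = (- \<i>) *\<^sub>C \<i> *\<^sub>C (k - star k)"
    unfolding scaleC_scaleC by simp
  also have "\<dots> = (- \<i> * of_real s) *\<^sub>C p"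
    by (simp only: s scaleC_scaleC flip: scaleC_of_real)
  finally have "k - star k = (- \<i> * of_real s) *\<^sub>C p" .
  moreover have "2 *\<^sub>R k = (k + star k) + (k - star k)"
    by (simp add: scaleR_2)
  ultimately have "2 *\<^sub>R k = (of_real r + - \<i> * of_real s) *\<^sub>C p"
    by (simp only: r scaleC_add_left scaleC_of_real)
  then have "k = (1 / 2) *\<^sub>R ((of_real r + - \<i> * of_real s) *\<^sub>C p)"
    by (metis scaleR_half_double scaleR_2)
  then have "k = (of_real (1 / 2) * (of_real r + - \<i> * of_real s)) *\<^sub>C p"
    by (simp only: scaleC_scaleC flip: scaleC_of_real)
  then show thesis
    using that unfolding k_def by blast
qed

text \<open>On the range of a minimal projection, every element of the algebra is a multiple of an isometry.\<close>

lemma minimal_corner_norm: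
  assumes p: "minimal_projection p" and d: "d \<in> C" and u: "op_apply p u = u"
  shows "norm (op_apply d u) = norm (d * p) * norm u"
    and "p * (star d * d) * p = (norm (d * p))\<^sup>2 *\<^sub>R p"
proof -
  note pD = minimal_projectionD[OF p]
  let ?h = "p * (star d * d) * p"
  have h_eq: "?h = star (d * p) * (d * p)"
    by (simp add: star_mult pD mult.assoc)
  obtain r where r: "?h = r *\<^sub>R p"
    by (rule minimal_corner_selfadjoint[OF p, of ?h])
      (use pD d in \<open>auto simp: star_mult star_star mult.assoc intro: intros\<close>)
  have norm_sq: "(norm (op_apply d v))\<^sup>2 = r * (norm v)\<^sup>2" if v: "op_apply p v = v" for v
  proof -
    have "(norm (op_apply (d * p) v))\<^sup>2 = r * Re (cinner (op_apply p v) v)"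
      unfolding norm_op_apply_sq h_eq[symmetric] r by (simp add: Re_cinner_scaleR_left)
    then show ?thesis
      by (simp add: v norm_sq_eq_Re_cinner)
  qed
  obtain v where "norm v = 1" "op_apply p v = v"
    by (rule op_projection_nonzero[OF pD(2,3)])
  then have "0 \<le> r"
    using norm_sq[of v] by (metis mult.right_neutral one_power2 zero_le_power2)
  moreover have "norm ?h = (norm (d * p))\<^sup>2"
    unfolding h_eq by (rule cstar_identity)
  ultimately have r_eq: "r = (norm (d * p))\<^sup>2"
    using r norm_projection[OF pD(2,3)] by simp
  show "?h = (norm (d * p))\<^sup>2 *\<^sub>R p"
    using r r_eq by simp
  have "(norm (op_apply d u))\<^sup>2 = (norm (d * p) * norm u)\<^sup>2"
    using norm_sq[OF u] r_eq by (simp add: power_mult_distrib)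
  then show "norm (op_apply d u) = norm (d * p) * norm u"
    by (rule power2_eq_imp_eq) auto
qed

lemma strong_BJ_orthogonal_minimal_iff:
  assumes x: "x \<in> C" "x \<noteq> 0" and e: "norming_projection x e" "minimal_projection e" and y: "y \<in> C"
  shows "strong_BJ_orthogonal C x y \<longleftrightarrow> e * y = 0"
proof -
  note eD = minimal_projectionD[OF e(2)]
  have "star y * e = 0 \<longleftrightarrow> (\<exists>u. u \<noteq> 0 \<and> op_apply e u = u \<and> op_apply (star y) u = 0)"
  proof
    assume "star y * e = 0"
    then have "op_apply (star y) u = 0" if "op_apply e u = u" for u
      using that by (metis op_apply_times op_apply_zero(2))
    moreover obtain u where "norm u = 1" "op_apply e u = u"
      by (rule op_projection_nonzero[OF eD(2,3)])
    ultimately show "\<exists>u. u \<noteq> 0 \<and> op_apply e u = u \<and> op_apply (star y) u = 0"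
      by (intro exI[of _ u]) auto
  next
    assume "\<exists>u. u \<noteq> 0 \<and> op_apply e u = u \<and> op_apply (star y) u = 0"
    then show "star y * e = 0"
      using minimal_corner_norm(1)[OF e(2) intros(4)[OF y]] by (metis mult_eq_0_iff norm_eq_zero)
  qed
  moreover have "star y * e = 0 \<longleftrightarrow> e * y = 0"
    using mult_eq_star[of "star y" e 0] mult_eq_star[of e y 0] by (auto simp: eD star_star)
  ultimately show ?thesis
    using strong_BJ_orthogonal_iff[OF x y e(1)] by simp
qed

subsection \<open>Minimal projections in terms of strong Birkhoff--James orthogonality\<close>

text \<open>
  Minimality refers to the set of all \<open>y\<close> to which \<open>x\<close> is orthogonal. The condition that \<open>x\<close> is not
  orthogonal to itself excludes zero. Nothing but the relation occurs, so strong BJ isomorphisms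
  preserve the notion.
\<close>

definition BJ_minimal :: "'h bounded_operator \<Rightarrow> bool"
  where "BJ_minimal x \<longleftrightarrow> x \<in> C \<and> \<not> strong_BJ_orthogonal C x x \<and>
    (\<forall>x'\<in>C. \<not> strong_BJ_orthogonal C x' x' \<longrightarrow>
      (\<forall>y\<in>C. strong_BJ_orthogonal C x' y \<longrightarrow> strong_BJ_orthogonal C x y) \<longrightarrow>
      (\<forall>y\<in>C. strong_BJ_orthogonal C x y \<longrightarrow> strong_BJ_orthogonal C x' y))"

lemma strong_BJ_orthogonal_cong:
  assumes "x \<in> C" "x \<noteq> 0" "norming_projection x e" "x' \<in> C" "x' \<noteq> 0" "norming_projection x' e" "y \<in> C"
  shows "strong_BJ_orthogonal C x y \<longleftrightarrow> strong_BJ_orthogonal C x' y"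
  using assms by (simp add: strong_BJ_orthogonal_iff)

text \<open>
  The test element is \<open>y = p - f * p\<close>. Its adjoint vanishes on the range of \<open>f\<close>, which lies in the range
  of the norming projection of \<open>x'\<close>. So \<open>x'\<close> is orthogonal to \<open>y\<close>, hence \<open>x\<close> is, and as \<open>p\<close> is minimal
  this means \<open>p * y = 0\<close>.
\<close>

lemma minimal_le_norming_projection:
  assumes x: "x \<in> C" "x \<noteq> 0" and p: "norming_projection x p" "minimal_projection p"
    and x': "x' \<in> C" "x' \<noteq> 0" and e: "norming_projection x' e"
    and le: "\<And>y. y \<in> C \<Longrightarrow> strong_BJ_orthogonal C x' y \<Longrightarrow> strong_BJ_orthogonal C x y"
    and f: "f \<in> C" "projection f" "f \<noteq> 0" "e * f = f"
  shows "f * p = p"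
proof -
  note pD = minimal_projectionD[OF p(2)]
  obtain u where u: "norm u = 1" "op_apply f u = u"
    by (rule op_projection_nonzero[OF f(2,3)])
  define y where "y = p - f * p"
  have y: "y \<in> C"
    unfolding y_def by (intro intros pD f)
  have "star y * f = 0"
    by (simp add: y_def star_diff star_mult pD projectionD[OF f(2)] left_diff_distrib mult.assoc)
  then have "op_apply (star y) u = 0"
    using u(2) by (metis op_apply_times op_apply_zero(2))
  moreover have "op_apply e u = u"
    using f(4) u(2) by (metis op_apply_times)
  moreover have "u \<noteq> 0"
    using u(1) by auto
  ultimately have "strong_BJ_orthogonal C x' y"
    using strong_BJ_orthogonal_iff[OF x' y e] by blast
  then have "p * y = 0"
    using le[OF y] strong_BJ_orthogonal_minimal_iff[OF x p y] by blast
  moreover have "star y * y = p * y"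
  proof -
    have "star y * y = star y * p - star y * f * p"
      by (simp add: y_def right_diff_distrib mult.assoc)
    also have "\<dots> = star y * p"
      by (simp add: \<open>star y * f = 0\<close>)
    also have "\<dots> = p * y"
      by (simp add: y_def star_diff star_mult pD projectionD[OF f(2)] left_diff_distrib right_diff_distrib mult.assoc)
    finally show ?thesis .
  qed
  ultimately have "y = 0"
    using cstar_identity[of y] by simp
  then show ?thesis
    by (simp add: y_def)
qed

text \<open>
  If \<open>p\<close> dominates a proper nonzero subprojection \<open>f\<close>, then \<open>f\<close> is orthogonal to less than \<open>x\<close> is: the
  element \<open>f\<close> itself makes the difference. For minimal \<open>p\<close> and a competitor \<open>x'\<close> with norming projection
  \<open>e\<close>, the preceding lemma gives \<open>p \<le> e\<close> and excludes that \<open>e - p\<close> is nonzero.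
\<close>

lemma BJ_minimal_iff:
  assumes x: "x \<in> C" "x \<noteq> 0" and p: "norming_projection x p"
  shows "BJ_minimal x \<longleftrightarrow> minimal_projection p"
proof
  assume min: "minimal_projection p"
  have "strong_BJ_orthogonal C x' y"
    if x': "x' \<in> C" "\<not> strong_BJ_orthogonal C x' x'"
      and le: "\<forall>y\<in>C. strong_BJ_orthogonal C x' y \<longrightarrow> strong_BJ_orthogonal C x y"
      and y: "y \<in> C" "strong_BJ_orthogonal C x y" for x' y
  proof -
    note pD = minimal_projectionD[OF min]
    have x'0: "x' \<noteq> 0"
      using x' by (simp add: strong_BJ_orthogonal_self_iff)
    obtain e where e: "norming_projection x' e"
      by (rule ex_norming_projection[OF x'(1) x'0])
    note eI = norming_projection_in[OF x'(1) x'0 e]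
    note eD = projectionD[OF eI(3)]
    have below: "f * p = p" if "f \<in> C" "projection f" "f \<noteq> 0" "e * f = f" for f
      by (rule minimal_le_norming_projection[OF x p min x'(1) x'0 e _ that]) (use le in blast)
    have ep: "e * p = p"
      by (rule below[OF eI(1,3,2)]) (simp add: eD)
    then have pe: "p * e = p"
      using mult_eq_star[OF ep] by (simp add: eD pD)
    have "e - p = 0"
    proof (rule ccontr)
      assume "e - p \<noteq> 0"
      moreover have "projection (e - p)"
        by (simp add: projection_def star_diff eD pD algebra_simps ep pe)
      ultimately have "(e - p) * p = p"
        by (intro below intros eI(1) pD(1)) (simp_all add: right_diff_distrib eD ep)
      then show False
        using pD(3) by (simp add: algebra_simps ep pD)
    qed
    then have "e = p" by simp
    then show ?thesis
      using strong_BJ_orthogonal_cong[OF x p x'(1) x'0 _ y(1)] e y(2) by simp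
  qed
  moreover have "\<not> strong_BJ_orthogonal C x x"
    using x by (simp add: strong_BJ_orthogonal_self_iff)
  ultimately show "BJ_minimal x"
    unfolding BJ_minimal_def using x(1) by blast
next
  assume min: "BJ_minimal x"
  note pI = norming_projection_in[OF x p]
  note pD = projectionD[OF pI(3)]
  have "f = p" if f: "f \<in> C" "projection f" "p * f = f" "f \<noteq> 0" for f
  proof (rule ccontr)
    assume "f \<noteq> p"
    have fp: "f * p = f"
      using mult_eq_star[OF f(3)] by (simp add: pD projectionD[OF f(2)])
    note nf = norming_projection_self[OF f(2,4)]
    have "projection (p - f)" "p - f \<noteq> 0"
      using \<open>f \<noteq> p\<close> by (auto simp: projection_def star_diff pD projectionD[OF f(2)] algebra_simps fp f(3))
    then obtain u where u: "norm u = 1" "op_apply (p - f) u = u"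
      by (rule op_projection_nonzero)
    have "p * (p - f) = p - f" "f * (p - f) = 0"
      by (simp_all add: algebra_simps pD f(3) fp projectionD[OF f(2)])
    then have "op_apply p u = u" "op_apply (star f) u = 0"
      using u(2) by (metis op_apply_times op_apply_zero(2) projectionD(1)[OF f(2)])+
    then have "strong_BJ_orthogonal C x f"
      using u(1) strong_BJ_orthogonal_iff[OF x f(1) p] by force
    moreover have "strong_BJ_orthogonal C x y" if y: "y \<in> C" "strong_BJ_orthogonal C f y" for y
    proof -
      obtain v where v: "v \<noteq> 0" "op_apply f v = v" "op_apply (star y) v = 0"
        using y(2) strong_BJ_orthogonal_iff[OF f(1,4) y(1) nf] by blast
      have "op_apply p v = v"
        using f(3) v(2) by (metis op_apply_times)
      with v show ?thesis
        using strong_BJ_orthogonal_iff[OF x y(1) p] by blast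
    qed
    ultimately have "strong_BJ_orthogonal C f f"
      using min f strong_BJ_orthogonal_self_iff[OF f(1)] unfolding BJ_minimal_def by blast
    then show False
      using f by (simp add: strong_BJ_orthogonal_self_iff)
  qed
  then show "minimal_projection p"
    using pI by (auto simp: minimal_projection_def)
qed

end

section \<open>Isomorphisms onto algebras of compact operators are isometric\<close>

lemma sum_orthogonal_projections_mult:
  fixes f :: "'i \<Rightarrow> 'a::cstar_algebra"
  assumes F: "finite F" and proj: "\<And>i. i \<in> F \<Longrightarrow> projection (f i)"
    and orth: "\<And>i j. i \<in> F \<Longrightarrow> j \<in> F \<Longrightarrow> i \<noteq> j \<Longrightarrow> f i * f j = 0"
  shows "(\<Sum>i\<in>F. a i *\<^sub>C f i) * (\<Sum>i\<in>F. b i *\<^sub>C f i) = (\<Sum>i\<in>F. (a i * b i) *\<^sub>C f i)"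
proof -
  have "(\<Sum>i\<in>F. a i *\<^sub>C f i) * (\<Sum>i\<in>F. b i *\<^sub>C f i) = (\<Sum>i\<in>F. \<Sum>j\<in>F. (a i *\<^sub>C f i) * (b j *\<^sub>C f j))"
    by (rule sum_product)
  also have "\<dots> = (\<Sum>i\<in>F. \<Sum>j\<in>F. if i = j then (a i * b i) *\<^sub>C f i else 0)"
    by (intro sum.cong refl)
      (auto simp: mult_scaleC_left mult_scaleC_right scaleC_scaleC orth projectionD(2)[OF proj] mult.commute)
  also have "\<dots> = (\<Sum>i\<in>F. (a i * b i) *\<^sub>C f i)"
    using F by (simp add: sum.delta)
  finally show ?thesis .
qed

text \<open>
  With \<open>t i = sqrt (c\<^sup>2 - (s i)\<^sup>2)\<close>, the sum is the self-adjoint part of the normal element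
  \<open>z = (\<Sum>i\<in>F. (s i + \<i> t i) f i)\<close>, and \<open>star z * z\<close> is \<open>c\<^sup>2\<close> times a projection. No spectral theory
  is involved, so the bound is available in an abstract \<open>C\<^sup>*\<close>-algebra.
\<close>

lemma norm_sum_orthogonal_projections_le:
  fixes f :: "'i \<Rightarrow> 'a::cstar_algebra"
  assumes F: "finite F" and proj: "\<And>i. i \<in> F \<Longrightarrow> projection (f i)"
    and orth: "\<And>i j. i \<in> F \<Longrightarrow> j \<in> F \<Longrightarrow> i \<noteq> j \<Longrightarrow> f i * f j = 0"
    and s: "\<And>i. i \<in> F \<Longrightarrow> 0 \<le> s i \<and> s i \<le> c" and "0 \<le> c"
  shows "norm (\<Sum>i\<in>F. s i *\<^sub>R f i) \<le> c"
proof -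
  define t where "t i = sqrt (c\<^sup>2 - (s i)\<^sup>2)" for i
  define z where "z = (\<Sum>i\<in>F. Complex (s i) (t i) *\<^sub>C f i)"
  define p where "p = (\<Sum>i\<in>F. 1 *\<^sub>C f i)"
  have star_z: "star z = (\<Sum>i\<in>F. cnj (Complex (s i) (t i)) *\<^sub>C f i)"
    by (simp add: z_def star_sum star_scaleC projectionD(1)[OF proj])
  have "star p = p"
    by (simp add: p_def star_sum projectionD(1)[OF proj])
  moreover have "p * p = p"
    using sum_orthogonal_projections_mult[OF F proj orth, where a = "\<lambda>_. 1" and b = "\<lambda>_. 1"] by (simp add: p_def)
  ultimately have "norm p \<le> 1"
    using norm_projection[of p] by (cases "p = 0") (auto simp: projection_def)
  have coeff: "cnj (Complex (s i) (t i)) * Complex (s i) (t i) = of_real (c\<^sup>2)" if "i \<in> F" for i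
  proof -
    have "(s i)\<^sup>2 \<le> c\<^sup>2"
      using s[OF that] by (intro power_mono) auto
    then have "(s i)\<^sup>2 + (t i)\<^sup>2 = c\<^sup>2"
      by (simp add: t_def)
    then show ?thesis
      by (simp add: complex_eq_iff power2_eq_square)
  qed
  have "star z * z = (\<Sum>i\<in>F. (cnj (Complex (s i) (t i)) * Complex (s i) (t i)) *\<^sub>C f i)"
    unfolding star_z unfolding z_def by (rule sum_orthogonal_projections_mult[OF F proj orth])
  also have "\<dots> = c\<^sup>2 *\<^sub>R p"
    unfolding p_def scaleR_sum_right by (intro sum.cong refl) (simp only: coeff scaleC_of_real scaleC_one)
  finally have "(norm z)\<^sup>2 = c\<^sup>2 * norm p"
    using cstar_identity[of z] by simp
  also have "\<dots> \<le> c\<^sup>2 * 1"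
    using \<open>norm p \<le> 1\<close> by (intro mult_left_mono) auto
  finally have norm_z: "norm z \<le> c"
    using power2_le_imp_le[of "norm z" c] \<open>0 \<le> c\<close> by simp
  have "z + star z = 2 *\<^sub>R (\<Sum>i\<in>F. s i *\<^sub>R f i)"
  proof -
    have "Complex (s i) (t i) *\<^sub>C f i + cnj (Complex (s i) (t i)) *\<^sub>C f i = 2 *\<^sub>R s i *\<^sub>R f i" for i
    proof -
      have "Complex (s i) (t i) + cnj (Complex (s i) (t i)) = of_real (2 * s i)"
        by (simp add: complex_eq_iff)
      then show ?thesis
        by (metis scaleC_add_left scaleC_of_real scaleR_scaleR)
    qed
    then show ?thesis
      unfolding star_z unfolding z_def by (simp only: scaleR_sum_right flip: sum.distrib)
  qed
  then have "2 * norm (\<Sum>i\<in>F. s i *\<^sub>R f i) = norm (z + star z)"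
    by simp
  also have "\<dots> \<le> c + c"
    using norm_triangle_ineq[of z "star z"] norm_z by (simp add: norm_star)
  finally show ?thesis
    by simp
qed

context compact_operator_algebra
begin

text \<open>
  Norming projections are split off one after the other. The norms of the remainders tend to zero:
  otherwise the compact operator \<open>d * star d\<close> would have infinitely many orthonormal eigenvectors
  whose eigenvalues stay away from zero.
\<close>

lemma spectral_decomposition:
  assumes d: "d \<in> C"
  obtains e :: "nat \<Rightarrow> 'h bounded_operator" and s :: "nat \<Rightarrow> real"
  where "\<And>n. e n \<in> C" "\<And>n. projection (e n)" "\<And>m n. m \<noteq> n \<Longrightarrow> e m * e n = 0"
    "decseq s" "s \<longlonglongrightarrow> 0" "s 0 = (norm d)\<^sup>2"
    "(\<lambda>N. \<Sum>n<N. s n *\<^sub>R e n) \<longlonglongrightarrow> d * star d"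
proof -
  define splits where "splits x e \<longleftrightarrow> e \<in> C \<and> projection e \<and> x * star x * e = (norm x)\<^sup>2 *\<^sub>R e
      \<and> e * (x * star x) = (norm x)\<^sup>2 *\<^sub>R e
      \<and> norm (x * star x - (norm x)\<^sup>2 *\<^sub>R e) \<le> (norm x)\<^sup>2 \<and> (e = 0 \<longleftrightarrow> x = 0)" for x e
  have ex_splits: "\<exists>e. splits x e" if x: "x \<in> C" for x
  proof (cases "x = 0")
    case True
    then show ?thesis
      by (intro exI[of _ 0]) (simp add: splits_def intros)
  next
    case False
    obtain e where e: "e \<in> C" "norming_projection x e" "e \<noteq> 0" "norm (x * star x - (norm x)\<^sup>2 *\<^sub>R e) < (norm x)\<^sup>2"
      by (rule ex_norming_projection[OF x False])
    then have "splits x e"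
      unfolding splits_def using False norming_projection_mult[OF e(2)]
      by (simp add: norming_projection_def)
    then show ?thesis ..
  qed
  define E where "E x = (SOME e. splits x e)" for x
  have "splits x (E x)" if "x \<in> C" for x
    unfolding E_def by (rule someI_ex[OF ex_splits[OF that]])
  then have E: "\<And>x. x \<in> C \<Longrightarrow> E x \<in> C" "\<And>x. x \<in> C \<Longrightarrow> projection (E x)"
    "\<And>x. x \<in> C \<Longrightarrow> x * star x * E x = (norm x)\<^sup>2 *\<^sub>R E x" "\<And>x. x \<in> C \<Longrightarrow> E x * (x * star x) = (norm x)\<^sup>2 *\<^sub>R E x"
    "\<And>x. x \<in> C \<Longrightarrow> norm (x * star x - (norm x)\<^sup>2 *\<^sub>R E x) \<le> (norm x)\<^sup>2" "\<And>x. x \<in> C \<Longrightarrow> E x = 0 \<longleftrightarrow> x = 0"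
    unfolding splits_def by blast+
  define x where "x n = rec_nat d (\<lambda>_ y. y - E y * y) n" for n :: nat
  have x_0: "x 0 = d" and x_Suc: "x (Suc n) = x n - E (x n) * x n" for n
    by (simp_all add: x_def)
  have x_C: "x n \<in> C" for n
    by (induction n) (auto simp: x_0 x_Suc d intro!: intros E(1))
  define e where "e n = E (x n)" for n
  define s where "s n = (norm (x n))\<^sup>2" for n
  define h where "h n = x n * star (x n)" for n
  have e_proj: "projection (e n)" for n
    by (simp add: e_def E(2) x_C)
  note eD = projectionD[OF e_proj]
  have he: "h n * e n = s n *\<^sub>R e n" "e n * h n = s n *\<^sub>R e n" for n
    by (simp_all only: h_def s_def e_def E(3,4)[OF x_C])
  have h_Suc: "h (Suc n) = h n - s n *\<^sub>R e n" for n
  proof -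
    have "h (Suc n) = (x n - e n * x n) * (star (x n) - star (x n) * e n)"
      by (simp add: h_def x_Suc star_diff star_mult eD(1) flip: e_def)
    also have "\<dots> = h n - e n * h n - h n * e n + e n * (h n * e n)"
      by (simp add: h_def algebra_simps)
    also have "\<dots> = h n - s n *\<^sub>R e n"
      by (simp add: he eD(2))
    finally show ?thesis .
  qed
  have norm_h: "norm (h n) = s n" for n
    by (simp add: h_def s_def cstar_identity_right)
  have "s (Suc n) \<le> s n" for n
    using E(5)[OF x_C, of n] by (simp add: h_Suc flip: norm_h) (simp add: h_def e_def s_def cstar_identity_right)
  then have dec: "decseq s"
    by (rule decseq_SucI)
  have partial: "d * star d = (\<Sum>i<n. s i *\<^sub>R e i) + h n" for n
    by (induction n) (simp add: h_def x_0, simp add: h_Suc)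
  have e_eq: "s n *\<^sub>R (y * e n) = 0" if "y * x n = 0" for y n
  proof -
    have "s n *\<^sub>R (y * e n) = y * (h n * e n)"
      by (simp add: he)
    also have "\<dots> = 0"
      using that by (simp add: h_def flip: mult.assoc)
    finally show ?thesis .
  qed
  have kill: "m < n \<Longrightarrow> e m * x n = 0 \<and> e m * e n = 0" for m n
  proof (induction n)
    case (Suc n)
    have "e m * x (Suc n) = 0"
    proof (cases "m = n")
      case True
      then show ?thesis
        by (simp add: x_Suc right_diff_distrib eD(3) flip: e_def)
    next
      case False
      with Suc have "e m * x n = 0" "e m * e n = 0"
        by auto
      then show ?thesis
        by (simp add: x_Suc right_diff_distrib flip: e_def mult.assoc)
    qed
    moreover from this have "e m * e (Suc n) = 0"
      using e_eq[of "e m" "Suc n"] E(6)[OF x_C, of "Suc n"] by (auto simp: s_def e_def)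
    ultimately show ?case ..
  qed simp
  have orth: "e m * e n = 0" if "m \<noteq> n" for m n
  proof (cases "m < n")
    case False
    then have "e n * e m = 0"
      using that kill[of n m] by simp
    then show ?thesis
      using mult_eq_star[of "e n" "e m" 0] by (simp add: eD)
  qed (simp add: kill)
  have "s \<longlonglongrightarrow> 0"
  proof -
    obtain l where l: "s \<longlonglongrightarrow> l" "\<And>n. l \<le> s n"
      using decseq_convergent[OF dec, of 0] by (auto simp: s_def)
    have "l = 0"
    proof (rule ccontr)
      assume "l \<noteq> 0"
      moreover have "0 \<le> l"
        using LIMSEQ_le_const[OF l(1), of 0] by (auto simp: s_def)
      ultimately have "0 < l" by simp
      have "e n \<noteq> 0" for n
        using l(2)[of n] \<open>0 < l\<close> E(6)[OF x_C, of n] by (auto simp: e_def s_def)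
      then have "\<exists>u. norm u = 1 \<and> op_apply (e n) u = u" for n
        by (metis op_projection_nonzero[OF e_proj])
      then obtain u where u: "\<And>n. norm (u n) = 1" "\<And>n. op_apply (e n) (u n) = u n"
        by metis
      have "d * star d * e n = s n *\<^sub>R e n" for n
      proof -
        have "(\<Sum>i<n. s i *\<^sub>R e i) * e n = 0"
          by (simp add: sum_distrib_right orth)
        then show ?thesis
          by (simp add: partial[of n] distrib_right he)
      qed
      then have eigen: "op_apply (d * star d) (u n) = s n *\<^sub>R u n" for n
        by (metis op_apply_scaleR_left op_apply_times u(2))
      have "cinner (u m) (u n) = 0" if "m \<noteq> n" for m n
      proof -
        have "cinner (u m) (u n) = cinner (op_apply (e m) (u m)) (op_apply (e n) (u n))"
          by (simp only: u(2))
        also have "\<dots> = cinner (u m) (op_apply (e m * e n) (u n))"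
          by (simp add: eD(1) flip: cinner_star_right)
        finally show ?thesis
          by (simp add: orth[OF that])
      qed
      then have far: "2 * l\<^sup>2 \<le> (norm (s m *\<^sub>R u m - s n *\<^sub>R u n))\<^sup>2" if "m \<noteq> n" for m n
        using that power_mono[OF l(2)[of m] \<open>0 \<le> l\<close>, of 2] power_mono[OF l(2)[of n] \<open>0 \<le> l\<close>, of 2]
        by (simp add: norm_diff_sq Re_cinner_scaleR_left Re_cinner_scaleR_right power_mult_distrib u(1))
      have "d * star d \<in> compact_operators"
        using compact intros(3)[OF d intros(4)[OF d]] by blast
      then obtain r y where r: "strict_mono (r :: nat \<Rightarrow> nat)" and y: "(\<lambda>n. op_apply (d * star d) (u (r n))) \<longlonglongrightarrow> y"
        by (rule compact_operator_subseq[where x = u and K = 1]) (simp add: u(1))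
      obtain N where N: "\<And>m n. N \<le> m \<Longrightarrow> N \<le> n \<Longrightarrow>
          dist (op_apply (d * star d) (u (r m))) (op_apply (d * star d) (u (r n))) < l"
        using metric_CauchyD[OF LIMSEQ_imp_Cauchy[OF y] \<open>0 < l\<close>] by blast
      have "norm (s (r N) *\<^sub>R u (r N) - s (r (Suc N)) *\<^sub>R u (r (Suc N))) < l"
        using N[of N "Suc N"] unfolding eigen dist_norm by simp
      then have "(norm (s (r N) *\<^sub>R u (r N) - s (r (Suc N)) *\<^sub>R u (r (Suc N))))\<^sup>2 < l\<^sup>2"
        by (intro power_strict_mono) auto
      moreover have "r N \<noteq> r (Suc N)"
        using strict_monoD[OF r, of N "Suc N"] by simp
      ultimately show False
        using far[of "r N" "r (Suc N)"] \<open>0 < l\<close> by (smt (verit) zero_less_power)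
    qed
    with l(1) show ?thesis by simp
  qed
  moreover have "(\<lambda>N. \<Sum>n<N. s n *\<^sub>R e n) \<longlonglongrightarrow> d * star d"
  proof -
    have "h \<longlonglongrightarrow> 0"
      by (rule tendsto_norm_zero_cancel) (simp add: norm_h \<open>s \<longlonglongrightarrow> 0\<close>)
    from tendsto_diff[OF tendsto_const this, of "d * star d"]
    have "(\<lambda>N. d * star d - h N) \<longlonglongrightarrow> d * star d"
      by simp
    moreover have "d * star d - h N = (\<Sum>n<N. s n *\<^sub>R e n)" for N
      using partial[of N] by simp
    ultimately show ?thesis
      by (simp only:)
  qed
  ultimately show thesis
    using that[of e s] e_proj orth dec by (simp add: e_def E(1) x_C s_def x_0)
qed

text \<open>The image of the norming projection is nonzero and witnesses the norm of the image.\<close>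

lemma injective_star_hom_expands:
  fixes \<pi> :: "'h bounded_operator \<Rightarrow> 'a::cstar_algebra"
  assumes mult: "\<And>x y. x \<in> C \<Longrightarrow> y \<in> C \<Longrightarrow> \<pi> (x * y) = \<pi> x * \<pi> y"
    and star: "\<And>x. x \<in> C \<Longrightarrow> \<pi> (star x) = star (\<pi> x)"
    and scale: "\<And>r x. x \<in> C \<Longrightarrow> \<pi> (r *\<^sub>R x) = r *\<^sub>R \<pi> x"
    and inj: "\<And>x. x \<in> C \<Longrightarrow> \<pi> x = 0 \<Longrightarrow> x = 0" and d: "d \<in> C"
  shows "norm d \<le> norm (\<pi> d)"
proof (cases "d = 0")
  case False
  obtain e where e: "e \<in> C" "norming_projection d e" "e \<noteq> 0"
    by (rule ex_norming_projection[OF d False])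
  then have "projection e"
    by (simp add: norming_projection_def)
  then have "projection (\<pi> e)"
    using mult[OF e(1) e(1)] star[OF e(1)] by (simp add: projection_def)
  moreover have "\<pi> e \<noteq> 0"
    using inj e by blast
  ultimately have norm_e: "norm (\<pi> e) = 1"
    by (rule norm_projection)
  have "\<pi> (d * star d * e) = \<pi> d * star (\<pi> d) * \<pi> e"
    using d e(1) by (simp add: mult star intros)
  then have "(norm d)\<^sup>2 *\<^sub>R \<pi> e = \<pi> d * star (\<pi> d) * \<pi> e"
    unfolding norming_projection_mult(1)[OF e(2)] using scale e(1) by simp
  then have "(norm d)\<^sup>2 = norm (\<pi> d * star (\<pi> d) * \<pi> e)"
    by (metis abs_of_nonneg mult.right_neutral norm_e norm_scaleR zero_le_power2)
  also have "\<dots> \<le> (norm (\<pi> d))\<^sup>2"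
    using norm_mult_ineq[of "\<pi> d * star (\<pi> d)" "\<pi> e"] by (simp add: norm_e cstar_identity_right)
  finally show ?thesis
    by (rule power2_le_imp_le) simp
qed simp

end

lemma star_isomorphismD:
  assumes "star_isomorphism A B \<phi>"
  shows "bij_betw \<phi> A B" "inj_on \<phi> A" "\<phi> ` A = B" "x \<in> A \<Longrightarrow> \<phi> x \<in> B"
    "x \<in> A \<Longrightarrow> y \<in> A \<Longrightarrow> \<phi> (x + y) = \<phi> x + \<phi> y" "x \<in> A \<Longrightarrow> y \<in> A \<Longrightarrow> \<phi> (x * y) = \<phi> x * \<phi> y"
    "x \<in> A \<Longrightarrow> \<phi> (star x) = star (\<phi> x)" "x \<in> A \<Longrightarrow> \<phi> (c *\<^sub>C x) = c *\<^sub>C \<phi> x"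
  using assms by (auto simp: star_isomorphism_def bij_betw_def)

lemma star_isomorphism_comp:
  assumes "star_isomorphism A B \<phi>" "star_isomorphism B C \<psi>"
  shows "star_isomorphism A C (\<psi> \<circ> \<phi>)"
  unfolding star_isomorphism_def
  by (simp add: star_isomorphismD[OF assms(1)] star_isomorphismD[OF assms(2)]
      bij_betw_trans[OF star_isomorphismD(1)[OF assms(1)] star_isomorphismD(1)[OF assms(2)]])

lemma star_isomorphism_inv:
  assumes A: "cstar_subalgebra A" and \<phi>: "star_isomorphism A B \<phi>"
  shows "star_isomorphism B A (inv_into A \<phi>)"
proof -
  note D = star_isomorphismD[OF \<phi>]
  have inv: "inv_into A \<phi> y \<in> A" "\<phi> (inv_into A \<phi> y) = y" if "y \<in> B" for y
    using that D(3) by (auto intro: inv_into_into f_inv_into_f)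
  have eq: "inv_into A \<phi> y = x" if "x \<in> A" "\<phi> x = y" for x y
    using that D(2) by auto
  show ?thesis
    unfolding star_isomorphism_def
    by (intro conjI ballI allI bij_betw_inv_into D(1) eq cstar_subalgebra_intros[OF A] inv)
      (simp_all add: D inv cstar_subalgebra_intros[OF A])
qed

text \<open>
  The inverse of \<open>\<phi>\<close> does not decrease norms, so \<open>\<phi>\<close> does not increase them. For the other inequality,
  pull the spectral decomposition of \<open>\<phi> (b * star b)\<close> back to \<open>B\<close> term by term. The continuity of the
  inverse is not yet known, but the pulled back partial sums are Cauchy by the bound for orthogonal
  projections, and the continuous map \<open>\<phi>\<close> identifies their limit as \<open>b * star b\<close>.
\<close>

theorem star_isomorphism_isometric:
  assumes B: "cstar_subalgebra B" and D: "compact_operator_algebra D"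
    and \<phi>: "star_isomorphism B D \<phi>" and b: "b \<in> B"
  shows "norm (\<phi> b) = norm b"
proof -
  interpret compact_operator_algebra D by (rule D)
  note \<phi>D = star_isomorphismD[OF \<phi>]
  define \<psi> where "\<psi> = inv_into B \<phi>"
  have \<psi>: "star_isomorphism D B \<psi>"
    unfolding \<psi>_def by (rule star_isomorphism_inv[OF B \<phi>])
  note \<psi>D = star_isomorphismD[OF \<psi>]
  have \<phi>\<psi>: "\<phi> (\<psi> x) = x" if "x \<in> D" for x
    unfolding \<psi>_def using that \<phi>D(3) by (auto intro: f_inv_into_f)
  have \<psi>\<phi>: "\<psi> (\<phi> x) = x" if "x \<in> B" for x
    unfolding \<psi>_def using that \<phi>D(2) by simp
  have \<phi>_R: "\<phi> (r *\<^sub>R x) = r *\<^sub>R \<phi> x" if "x \<in> B" for r x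
    using \<phi>D(8)[OF that] by (metis scaleC_of_real)
  have \<psi>_R: "\<psi> (r *\<^sub>R x) = r *\<^sub>R \<psi> x" if "x \<in> D" for r x
    using \<psi>D(8)[OF that] by (metis scaleC_of_real)
  have \<phi>_0: "\<phi> 0 = 0"
    using \<phi>_R[of 0 0] cstar_subalgebra_0[OF B] by simp
  have \<psi>_0: "\<psi> 0 = 0"
    using \<psi>\<phi>[of 0] cstar_subalgebra_0[OF B] \<phi>_0 by simp
  have contract: "norm (\<phi> x) \<le> norm x" if x: "x \<in> B" for x
  proof -
    have "norm (\<phi> x) \<le> norm (\<psi> (\<phi> x))"
      by (rule injective_star_hom_expands[OF \<psi>D(6,7) \<psi>_R]) (use \<phi>\<psi> \<phi>_0 \<phi>D(4)[OF x] in \<open>force+\<close>)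
    then show ?thesis
      by (simp add: \<psi>\<phi>[OF x])
  qed
  have \<phi>_diff: "\<phi> (x - y) = \<phi> x - \<phi> y" if "x \<in> B" "y \<in> B" for x y
    using \<phi>D(5)[of x "(- 1) *\<^sub>R y"] \<phi>_R[of y "- 1"] that by (simp add: cstar_subalgebra_scaleR[OF B, of y "- 1", simplified])
  have \<phi>_sum: "\<phi> (sum g F) = (\<Sum>i\<in>F. \<phi> (g i))" if "\<And>i. g i \<in> B" for g :: "nat \<Rightarrow> 'a" and F
    using that
    by (induction F rule: infinite_finite_induct) (auto simp: \<phi>_0 \<phi>D(5) cstar_subalgebra_sum[OF B])
  obtain e s where e: "\<And>n. e n \<in> D" "\<And>n. projection (e n)" "\<And>m n. m \<noteq> n \<Longrightarrow> e m * e n = 0"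
    and s: "decseq s" "s \<longlonglongrightarrow> 0" "s 0 = (norm (\<phi> b))\<^sup>2"
    and lim: "(\<lambda>N. \<Sum>n<N. s n *\<^sub>R e n) \<longlonglongrightarrow> \<phi> b * star (\<phi> b)"
    by (rule spectral_decomposition[OF \<phi>D(4)[OF b]]) (rule that; assumption)
  define f where "f n = \<psi> (e n)" for n
  have f_B: "f n \<in> B" for n
    unfolding f_def by (rule \<psi>D(4)[OF e(1)])
  have f_proj: "projection (f n)" for n
    using e(1,2)[of n] \<psi>D(6)[OF e(1) e(1), of n n] \<psi>D(7)[OF e(1), of n] by (simp add: f_def projection_def)
  have f_orth: "f m * f n = 0" if "m \<noteq> n" for m n
    using \<psi>D(6)[OF e(1) e(1), of m n] e(3)[OF that] by (simp add: f_def \<psi>_0)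
  have s_nonneg: "0 \<le> s n" for n
    using decseq_ge[OF s(1,2)] .
  have bound: "norm (\<Sum>n=M..<N. s n *\<^sub>R f n) \<le> s M" for M N
    by (rule norm_sum_orthogonal_projections_le)
      (use f_proj f_orth s_nonneg decseqD[OF s(1)] in auto)
  define S where "S N = (\<Sum>n<N. s n *\<^sub>R f n)" for N
  have S_B: "S N \<in> B" for N
    unfolding S_def by (intro cstar_subalgebra_sum[OF B] cstar_subalgebra_scaleR[OF B] f_B)
  have S_diff: "norm (S N - S M) \<le> s M" if "M \<le> N" for M N
  proof -
    have "S N - S M = (\<Sum>n=M..<N. s n *\<^sub>R f n)"
      unfolding S_def using sum_diff_nat_ivl[of 0 M N "\<lambda>n. s n *\<^sub>R f n"] that by (simp add: atLeast0LessThan)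
    then show ?thesis
      using bound by simp
  qed
  have "Cauchy S"
  proof (rule metric_CauchyI)
    fix r :: real assume "0 < r"
    then obtain M where M: "s M < r / 2"
      using order_tendstoD(2)[OF s(2), of "r / 2"] by (auto simp: eventually_sequentially)
    have "dist (S m) (S n) < r" if "M \<le> m" "M \<le> n" for m n
      using S_diff[OF that(1)] S_diff[OF that(2)] M dist_triangle_half_l[of "S m" "S M" r "S n"]
      by (simp add: dist_norm)
    then show "\<exists>M. \<forall>m\<ge>M. \<forall>n\<ge>M. dist (S m) (S n) < r"
      by blast
  qed
  then obtain l where l: "S \<longlonglongrightarrow> l"
    using Cauchy_convergent convergent_def by blast
  have l_B: "l \<in> B"
    by (rule cstar_subalgebra_LIMSEQ[OF B S_B l])
  have "(\<lambda>N. \<phi> (S N) - \<phi> l) \<longlonglongrightarrow> 0"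
  proof (rule Lim_null_comparison)
    show "\<forall>\<^sub>F N in sequentially. norm (\<phi> (S N) - \<phi> l) \<le> norm (S N - l)"
      using contract[OF cstar_subalgebra_diff[OF B S_B l_B]] by (simp add: \<phi>_diff[OF S_B l_B])
    show "(\<lambda>N. norm (S N - l)) \<longlonglongrightarrow> 0"
      using l by (simp add: LIM_zero tendsto_norm_zero)
  qed
  then have "(\<lambda>N. \<phi> (S N)) \<longlonglongrightarrow> \<phi> l"
    by (simp add: LIM_zero_iff)
  moreover have "\<phi> (S N) = (\<Sum>n<N. s n *\<^sub>R e n)" for N
    unfolding S_def by (simp add: \<phi>_sum cstar_subalgebra_scaleR[OF B] f_B \<phi>_R) (simp add: f_def \<phi>\<psi> e(1))
  ultimately have "\<phi> l = \<phi> b * star (\<phi> b)"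
    using lim by (metis (no_types, lifting) LIMSEQ_unique sum.cong ext)
  also have "\<dots> = \<phi> (b * star b)"
    using b by (simp add: \<phi>D cstar_subalgebra_star[OF B])
  finally have "l = b * star b"
    using inj_onD[OF \<phi>D(2)] l_B b cstar_subalgebra_mult[OF B] cstar_subalgebra_star[OF B] by blast
  moreover have "norm l \<le> (norm (\<phi> b))\<^sup>2"
  proof (rule tendsto_upperbound[OF tendsto_norm[OF l]])
    show "\<forall>\<^sub>F N in sequentially. norm (S N) \<le> (norm (\<phi> b))\<^sup>2"
      using bound[of 0] s(3) by (simp add: S_def atLeast0LessThan)
  qed simp
  ultimately have "(norm b)\<^sup>2 \<le> (norm (\<phi> b))\<^sup>2"
    by (simp add: cstar_identity_right)
  then have "norm b \<le> norm (\<phi> b)"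
    by (rule power2_le_imp_le) simp
  with contract[OF b] show ?thesis
    by simp
qed

section \<open>Transport of minimal projections\<close>

lemma mult_norming_projection_eq_0:
  assumes "z * x = 0" "norming_projection x e" "x \<noteq> 0" shows "z * e = 0"
proof -
  have "(norm x)\<^sup>2 *\<^sub>R (z * e) = z * (x * star x * e)"
    by (simp add: norming_projection_mult(1)[OF assms(2)])
  also have "\<dots> = 0"
    using assms(1) by (simp flip: mult.assoc)
  finally show ?thesis
    using assms(3) by simp
qed

text \<open>
  A minimal projection is determined by the elements it annihilates from the left. The test element is
  again \<open>p - e * p\<close>.
\<close>

lemma (in compact_operator_algebra) minimal_projection_eqI:
  assumes p: "minimal_projection p" and e: "minimal_projection e"
    and ann: "\<And>y. y \<in> C \<Longrightarrow> e * y = 0 \<Longrightarrow> p * y = 0"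
  shows "e = p"
proof -
  note pD = minimal_projectionD[OF p] and eD = minimal_projectionD[OF e]
  define y where "y = p - e * p"
  have "y \<in> C" "e * y = 0"
    by (auto simp: y_def right_diff_distrib eD intro: intros pD(1) eD(1))
  then have "p * y = 0"
    by (rule ann)
  moreover have "star y * y = p * y"
    by (simp add: y_def star_diff star_mult pD eD algebra_simps)
  ultimately have "e * p = p"
    using cstar_identity[of y] by (simp add: y_def)
  then show ?thesis
    using e pD by (auto simp: minimal_projection_def)
qed

locale strong_BJ_isomorphic = A: compact_operator_algebra A + D: compact_operator_algebra D
  for A :: "'h::complex_hilbert_space bounded_operator set"
    and D :: "'k::complex_hilbert_space bounded_operator set" +
  fixes T :: "'h bounded_operator \<Rightarrow> 'k bounded_operator"
  assumes T: "strong_BJ_isomorphism A D T"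
begin

lemma T_in: "x \<in> A \<Longrightarrow> T x \<in> D"
  and T_image: "T ` A = D"
  and T_orthogonal: "x \<in> A \<Longrightarrow> y \<in> A \<Longrightarrow> strong_BJ_orthogonal D (T x) (T y) \<longleftrightarrow> strong_BJ_orthogonal A x y"
  using T by (auto simp: strong_BJ_isomorphism_def bij_betw_def)

lemma T_eq_0_iff: "x \<in> A \<Longrightarrow> T x = 0 \<longleftrightarrow> x = 0"
  using T_orthogonal[of x x] A.strong_BJ_orthogonal_self_iff D.strong_BJ_orthogonal_self_iff[OF T_in] by blast

lemma BJ_minimal_T:
  assumes "x \<in> A" shows "D.BJ_minimal (T x) \<longleftrightarrow> A.BJ_minimal x"
proof -
  have "(\<forall>y\<in>D. Q y) \<longleftrightarrow> (\<forall>x\<in>A. Q (T x))" for Q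
    using T_image by blast
  then show ?thesis
    unfolding A.BJ_minimal_def D.BJ_minimal_def using assms by (simp add: T_orthogonal T_in)
qed

text \<open>
  The condition is what remains of strong BJ orthogonality when the norming projection of the first
  argument is minimal. Each of \<open>p\<close> and \<open>q\<close> determines the other.
\<close>

definition corresponding :: "'h bounded_operator \<Rightarrow> 'k bounded_operator \<Rightarrow> bool"
  where "corresponding p q \<longleftrightarrow> A.minimal_projection p \<and> D.minimal_projection q \<and>
    (\<forall>a\<in>A. q * T a = 0 \<longleftrightarrow> p * a = 0)"

lemma corresponding_norming_projections:
  assumes x: "x \<in> A" "x \<noteq> 0" and p: "norming_projection x p" and q: "norming_projection (T x) q"
    and min: "A.minimal_projection p \<or> D.minimal_projection q"
  shows "corresponding p q"
proof -
  have Tx: "T x \<in> D" "T x \<noteq> 0"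
    using x T_in T_eq_0_iff by auto
  have min: "A.minimal_projection p" "D.minimal_projection q"
    using min A.BJ_minimal_iff[OF x p] D.BJ_minimal_iff[OF Tx q] BJ_minimal_T[OF x(1)] by auto
  then show ?thesis
    unfolding corresponding_def
    using A.strong_BJ_orthogonal_minimal_iff[OF x p] D.strong_BJ_orthogonal_minimal_iff[OF Tx q]
      T_orthogonal[OF x(1)] T_in by blast
qed

lemma corresponding_unique_right:
  assumes "corresponding p q" "corresponding p r" shows "q = r"
proof (rule D.minimal_projection_eqI)
  show "D.minimal_projection r" "D.minimal_projection q"
    using assms by (auto simp: corresponding_def)
  show "r * y = 0" if "y \<in> D" "q * y = 0" for y
  proof -
    obtain a where "a \<in> A" "y = T a"
      using \<open>y \<in> D\<close> T_image by blast
    then show ?thesis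
      using that assms by (auto simp: corresponding_def)
  qed
qed

lemma corresponding_unique_left:
  assumes "corresponding p q" "corresponding r q" shows "p = r"
proof (rule A.minimal_projection_eqI)
  show "A.minimal_projection r" "A.minimal_projection p"
    using assms by (auto simp: corresponding_def)
  show "r * y = 0" if "y \<in> A" "p * y = 0" for y
    using that assms unfolding corresponding_def by blast
qed

lemma ex_corresponding_right:
  assumes p: "A.minimal_projection p"
  obtains q where "corresponding p q" "norming_projection (T p) q"
proof -
  note pD = A.minimal_projectionD[OF p]
  obtain q where q: "norming_projection (T p) q"
    using D.ex_norming_projection[OF T_in[OF pD(1)]] T_eq_0_iff[OF pD(1)] pD(3) by metis
  then have "corresponding p q"
    using corresponding_norming_projections[OF pD(1,3) norming_projection_self[OF pD(2,3)] q] p by blast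
  with q show thesis
    using that by blast
qed

lemma ex_corresponding_left:
  assumes q: "D.minimal_projection q"
  obtains p b where "corresponding p q" "b \<in> A" "T b = q" "b \<noteq> 0" "norming_projection b p"
proof -
  note qD = D.minimal_projectionD[OF q]
  obtain b where b: "b \<in> A" "T b = q"
    using qD(1) T_image by blast
  then have "b \<noteq> 0"
    using T_eq_0_iff qD(3) by blast
  then obtain p where p: "norming_projection b p"
    using A.ex_norming_projection[OF b(1)] by metis
  have "norming_projection (T b) q"
    unfolding b(2) by (rule norming_projection_self[OF qD(2,3)])
  then have "corresponding p q"
    using corresponding_norming_projections[OF b(1) \<open>b \<noteq> 0\<close> p] q by blast
  with b p \<open>b \<noteq> 0\<close> show thesis
    using that by blast
qed

text \<open>
  Orthogonality is inherited by corresponding projections, although a lattice isomorphism would not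
  have to respect it: \<open>q * T a = 0\<close> makes \<open>q\<close> orthogonal to the range of \<open>T a\<close>, in particular to
  the norming projection of \<open>T a\<close>.
\<close>

lemma corresponding_orthogonal_iff:
  assumes pq: "corresponding p q" and pq': "corresponding p' q'"
  shows "q * q' = 0 \<longleftrightarrow> p * p' = 0"
proof
  assume "p * p' = 0"
  have p': "A.minimal_projection p'"
    using pq' by (simp add: corresponding_def)
  obtain r where r: "corresponding p' r" "norming_projection (T p') r"
    by (rule ex_corresponding_right[OF p'])
  then have r_eq: "r = q'"
    using corresponding_unique_right[OF pq'] by simp
  note pD = A.minimal_projectionD[OF p']
  have "q * T p' = 0"
    using pq \<open>p * p' = 0\<close> pD(1) by (simp add: corresponding_def)
  then show "q * q' = 0"
    using mult_norming_projection_eq_0[OF _ r(2)] T_eq_0_iff[OF pD(1)] pD(3) r_eq by simp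
next
  assume "q * q' = 0"
  have "D.minimal_projection q'"
    using pq' by (simp add: corresponding_def)
  then obtain r b where r: "corresponding r q'" "b \<in> A" "T b = q'" "b \<noteq> 0" "norming_projection b r"
    by (rule ex_corresponding_left)
  then have r_eq: "r = p'"
    using corresponding_unique_left[OF pq'] by simp
  have "p * b = 0"
    using pq r(2) \<open>q * q' = 0\<close> by (simp add: corresponding_def flip: r(3))
  then show "p * p' = 0"
    using mult_norming_projection_eq_0[OF _ r(5,4)] r_eq by simp
qed

end

lemma strong_BJ_isomorphism_comp_isometric:
  assumes T: "strong_BJ_isomorphism A B T" and B: "cstar_subalgebra B"
    and \<phi>: "star_isomorphism B D \<phi>" and isometric: "\<And>b. b \<in> B \<Longrightarrow> norm (\<phi> b) = norm b"
  shows "strong_BJ_isomorphism A D (\<phi> \<circ> T)"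
proof -
  note \<phi>D = star_isomorphismD[OF \<phi>]
  have "strong_BJ_orthogonal D (\<phi> x) (\<phi> y) \<longleftrightarrow> strong_BJ_orthogonal B x y" if "x \<in> B" "y \<in> B" for x y
  proof -
    have "norm (\<phi> x + \<phi> y * \<phi> z) = norm (x + y * z)" if "z \<in> B" for z
      using isometric[of "x + y * z"] \<open>x \<in> B\<close> \<open>y \<in> B\<close> that
      by (simp add: \<phi>D cstar_subalgebra_intros[OF B])
    then show ?thesis
      unfolding strong_BJ_orthogonal_def \<phi>D(3)[symmetric] using isometric[OF \<open>x \<in> B\<close>] by simp
  qed
  moreover have "bij_betw T A B"
    using T by (simp add: strong_BJ_isomorphism_def)
  then have "bij_betw (\<phi> \<circ> T) A D" "\<And>x. x \<in> A \<Longrightarrow> T x \<in> B"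
    by (rule bij_betw_trans[OF _ \<phi>D(1)], rule bij_betw_apply)
  ultimately show ?thesis
    using T unfolding strong_BJ_isomorphism_def by simp
qed

section \<open>Matrix units\<close>

context compact_operator_algebra
begin

lemma minimal_projectionI:
  assumes r: "r \<in> C" "projection r" "r \<noteq> 0"
    and corner: "\<And>f. f \<in> C \<Longrightarrow> \<exists>c. r * f * r = c *\<^sub>C r"
  shows "minimal_projection r"
proof -
  have "f = 0 \<or> f = r" if f: "f \<in> C" "projection f" "r * f = f" for f
  proof -
    have "f * r = f"
      using mult_eq_star[OF f(3)] projectionD(1)[OF r(2)] projectionD(1)[OF f(2)] by simp
    then obtain c where c: "f = c *\<^sub>C r"
      using corner[OF f(1)] f(3) by auto
    then have "(c * c - c) *\<^sub>C r = f * f - f"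
      by (simp add: mult_scaleC_left mult_scaleC_right scaleC_scaleC projectionD[OF r(2)]
          diff_conv_add_uminus scaleC_add_left scaleC_minus_left del: add_uminus_conv_diff)
    then have "c * c - c = 0"
      using r(3) projectionD(2)[OF f(2)] by (simp add: scaleC_eq_0_iff)
    then have "c = 0 \<or> c = 1"
      by (metis diff_eq_eq add_0 mult_cancel_right1)
    then show ?thesis
      using c by auto
  qed
  then show ?thesis
    using r by (auto simp: minimal_projection_def)
qed

text \<open>The corner \<open>r * p * r\<close> is a nonzero multiple of \<open>r\<close>, so \<open>p * r * q = 0\<close> would give \<open>r * q = 0\<close>.\<close>

lemma minimal_projection_product_nonzero:
  assumes "p \<in> C" "projection p" and r: "minimal_projection r" and "p * r \<noteq> 0" "r * q \<noteq> 0"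
  shows "p * r * q \<noteq> 0"
proof
  assume "p * r * q = 0"
  obtain u where u: "op_apply r u = u"
    using op_apply_zero(1) by blast
  have "(norm (p * r))\<^sup>2 *\<^sub>R (r * q) = r * (star p * p) * r * q"
    using minimal_corner_norm(2)[OF r assms(1) u] by simp
  also have "\<dots> = r * (p * r * q)"
    using projectionD[OF assms(2)] by (simp add: mult.assoc)
  finally show False
    using assms \<open>p * r * q = 0\<close> by simp
qed

text \<open>
  Normalizing \<open>w = p * d * q\<close> suffices, because \<open>star w * w\<close> and \<open>w * star w\<close> lie in one-dimensional corners.
\<close>

lemma minimal_projection_equivalence:
  assumes p: "minimal_projection p" and q: "minimal_projection q" and d: "d \<in> C" "p * d * q \<noteq> 0"
  obtains u where "u \<in> C" "star u * u = q" "u * star u = p" "p * u = u" "u * q = u"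
proof
  note pD = minimal_projectionD[OF p] and qD = minimal_projectionD[OF q]
  define w where "w = p * d * q"
  define u where "u = w /\<^sub>R norm w"
  have w: "w \<in> C" "p * w = w" "w * q = w" "w \<noteq> 0"
    using d by (auto simp: w_def mult.assoc pD qD intro!: intros)
  obtain x y where "op_apply q x = x" "op_apply p y = y"
    using op_apply_zero(1) by blast
  then have corner: "q * (star w * w) * q = (norm w)\<^sup>2 *\<^sub>R q" "p * (w * star w) * p = (norm w)\<^sup>2 *\<^sub>R p"
    using minimal_corner_norm(2)[OF q w(1), of x] minimal_corner_norm(2)[OF p intros(4)[OF w(1)], of y]
      mult_eq_star[OF w(2)] by (simp_all add: w(3) star_star pD norm_star)
  have "q * star w = star w" "star w * p = star w"
    using mult_eq_star[OF w(3)] mult_eq_star[OF w(2)] by (simp_all add: pD qD)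
  then have "star w * w = (norm w)\<^sup>2 *\<^sub>R q" "w * star w = (norm w)\<^sup>2 *\<^sub>R p"
    using corner w(2,3) by (metis mult.assoc)+
  moreover have "inverse (norm w) * (inverse (norm w) * (norm w)\<^sup>2) = 1"
    using w(4) by (simp add: power2_eq_square field_simps)
  ultimately show "star u * u = q" "u * star u = p"
    by (simp_all add: u_def star_scaleR)
  show "u \<in> C" "p * u = u" "u * q = u"
    using w by (auto simp: u_def intro: intros)
qed

text \<open>
  If \<open>u\<close> is a partial isometry from \<open>q\<close> to \<open>p\<close>, then \<open>v = q + u\<close> satisfies \<open>star v * v = 2 q\<close>, so
  \<open>v * star v / 2\<close> is a projection equivalent to \<open>q\<close>. It sits diagonally between \<open>p\<close> and \<open>q\<close>.
\<close>

lemma minimal_projection_between: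
  assumes p: "minimal_projection p" and q: "minimal_projection q" and pq: "p * q = 0"
    and d: "d \<in> C" "p * d * q \<noteq> 0"
  obtains r where "minimal_projection r" "r * p \<noteq> 0" "r * q \<noteq> 0"
proof -
  note pD = minimal_projectionD[OF p] and qD = minimal_projectionD[OF q]
  obtain u where u: "u \<in> C" "star u * u = q" "u * star u = p" "p * u = u" "u * q = u"
    by (rule minimal_projection_equivalence[OF p q d])
  have qp: "q * p = 0"
    using mult_eq_star[OF pq] by (simp add: pD qD)
  have qu: "q * u = 0"
    by (metis u(4) qp mult.assoc mult_zero_left)
  have suq: "star u * q = 0" "q * star u = star u" "star u * p = star u"
    using mult_eq_star[OF qu] mult_eq_star[OF u(5)] mult_eq_star[OF u(4)] by (simp_all add: pD qD)
  have psu: "p * star u = 0"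
    by (metis suq(2) pq mult.assoc mult_zero_left)
  define v where "v = q + u"
  have sv: "star v = q + star u"
    by (simp add: v_def star_add qD)
  have vv: "star v * v = 2 *\<^sub>R q"
    unfolding sv unfolding v_def by (simp add: distrib_left distrib_right qD u qu suq scaleR_2)
  have vq: "v * q = v" "q * star v = star v"
    unfolding sv unfolding v_def by (simp_all add: distrib_left distrib_right qD u suq)
  define r where "r = (v * star v) /\<^sub>R 2"
  have v_C: "v \<in> C"
    unfolding v_def by (intro intros qD(1) u(1))
  have rr: "r * r = r"
  proof -
    have "v * star v * (v * star v) = v * (star v * v) * star v"
      by (simp add: mult.assoc)
    also have "\<dots> = 2 *\<^sub>R (v * star v)"
      by (simp add: vv vq)
    finally show ?thesis
      by (simp add: r_def)
  qed
  have r_p: "p * r * p = p /\<^sub>R 2" and r_q: "q * r * q = q /\<^sub>R 2"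
  proof -
    have "p * v = u" "star v * p = star u" "q * v = q" "star v * q = q"
      unfolding sv unfolding v_def by (simp_all add: distrib_left distrib_right pq u qp suq qD qu)
    moreover have "x * (v * star v) * x = (x * v) * (star v * x)" for x
      by (simp only: mult.assoc)
    ultimately have "p * (v * star v) * p = p" "q * (v * star v) * q = q"
      using u(3) qD(5) by simp_all
    then show "p * r * p = p /\<^sub>R 2" "q * r * q = q /\<^sub>R 2"
      by (simp_all add: r_def)
  qed
  have "minimal_projection r"
  proof (rule minimal_projectionI)
    show "r \<in> C"
      unfolding r_def by (intro intros v_C)
    show "projection r"
      using rr by (simp add: projection_def) (simp add: r_def star_scaleR star_mult star_star)
    show "r \<noteq> 0"
      using r_q qD(3) by auto
    fix f assume f: "f \<in> C"
    obtain c where c: "q * (star v * f * v) * q = c *\<^sub>C q"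
      by (rule minimal_corner[OF q, of "star v * f * v"]) (intro intros v_C f)
    have "v * (q * (star v * f * v) * q) * star v = (v * q) * (star v * f * v) * (q * star v)"
      by (simp only: mult.assoc)
    also have "\<dots> = v * star v * f * (v * star v)"
      unfolding vq by (simp only: mult.assoc)
    finally have "v * star v * f * (v * star v) = v * (q * (star v * f * v) * q) * star v" ..
    also have "\<dots> = c *\<^sub>C (v * star v)"
      unfolding c by (simp add: mult_scaleC_left mult_scaleC_right vq)
    finally have "r * f * r = (1 / 4) *\<^sub>R (c *\<^sub>C (v * star v))"
      by (simp add: r_def)
    also have "\<dots> = (c / 2) *\<^sub>C r"
      by (simp add: r_def scaleC_scaleR[symmetric]) (simp add: scaleC_scaleC flip: scaleC_of_real)
    finally show "\<exists>c. r * f * r = c *\<^sub>C r" ..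
  qed
  moreover have "r * p \<noteq> 0" "r * q \<noteq> 0"
    using r_p r_q pD(3) qD(3) by (auto simp: mult.assoc)
  ultimately show thesis
    using that by blast
qed

end

text \<open>
  The algebra \<open>C\<close> comes without a block structure of its own. The labels \<open>block\<close> are brought in from
  outside, and the last two conditions say that they sort the projections by equivalence in \<open>C\<close>.
\<close>

locale maximal_orthogonal_family = compact_operator_algebra C
  for C :: "'k::complex_hilbert_space bounded_operator set" +
  fixes E :: "'e set" and q :: "'e \<Rightarrow> 'k bounded_operator" and block :: "'e \<Rightarrow> 'i"
  assumes minimal: "i \<in> E \<Longrightarrow> minimal_projection (q i)"
    and orthogonal: "i \<in> E \<Longrightarrow> j \<in> E \<Longrightarrow> i \<noteq> j \<Longrightarrow> q i * q j = 0"
    and maximal: "d \<in> C \<Longrightarrow> (\<And>i. i \<in> E \<Longrightarrow> q i * d = 0) \<Longrightarrow> d = 0"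
    and connected: "i \<in> E \<Longrightarrow> j \<in> E \<Longrightarrow> block i = block j \<Longrightarrow> \<exists>d\<in>C. q i * d * q j \<noteq> 0"
    and disconnected: "i \<in> E \<Longrightarrow> j \<in> E \<Longrightarrow> block i \<noteq> block j \<Longrightarrow> d \<in> C \<Longrightarrow> q i * d * q j = 0"
begin

text \<open>
  Each block has a base projection \<open>q (base i)\<close> with a unit vector \<open>v\<close>. The partial isometries from
  the base move \<open>v\<close> to the basis vectors \<open>z i\<close>. Only one vector of the range of each \<open>q i\<close> is used,
  so the multiplicity with which \<open>C\<close> acts is divided out.

  For the invariance, consider a base projection \<open>p\<close>: the map \<open>s \<mapsto> s v\<close> is isometric on \<open>C p\<close>, hence
  \<open>C p v\<close> is a closed subspace. It contains \<open>y = d (z i)\<close> and the projection of \<open>y\<close> to the closed span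
  of the \<open>z j\<close>, hence it contains their difference, which therefore has the form \<open>s v\<close>. All
  \<open>q j * s\<close> vanish, so maximality forces \<open>s = 0\<close>.
\<close>

theorem ex_matrix_basis:
  obtains z :: "'e \<Rightarrow> 'k" where "orthonormal_family E z"
    "\<And>i. i \<in> E \<Longrightarrow> op_apply (q i) (z i) = z i"
    "\<And>i j. i \<in> E \<Longrightarrow> j \<in> E \<Longrightarrow> block i = block j \<Longrightarrow>
      \<exists>x\<in>C. op_apply x (z j) = z i \<and> (\<forall>k\<in>E. k \<noteq> j \<longrightarrow> op_apply x (z k) = 0)"
    "\<And>d i. d \<in> C \<Longrightarrow> i \<in> E \<Longrightarrow> basis_transfer E z z (op_apply d (z i)) = op_apply d (z i)"
proof -
  note qD = minimal_projectionD[OF minimal]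
  define base where "base i = (SOME j. j \<in> E \<and> block j = block i)" for i
  have base: "base i \<in> E" "block (base i) = block i" if "i \<in> E" for i
    using someI[of "\<lambda>j. j \<in> E \<and> block j = block i" i] that by (auto simp: base_def)
  have base_eq: "base i = base j" if "block i = block j" for i j
    using that by (simp add: base_def)
  have "\<exists>u. u \<in> C \<and> star u * u = q (base i) \<and> u * star u = q i \<and> q i * u = u \<and> u * q (base i) = u"
    if i: "i \<in> E" for i
  proof -
    obtain d where "d \<in> C" "q i * d * q (base i) \<noteq> 0"
      using connected[OF i base(1)[OF i]] base(2)[OF i] by auto
    then show ?thesis
      using minimal_projection_equivalence[OF minimal[OF i] minimal[OF base(1)[OF i]]] by blast
  qed
  then have "\<exists>u. \<forall>i\<in>E. u i \<in> C \<and> star (u i) * u i = q (base i) \<and> u i * star (u i) = q i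
      \<and> q i * u i = u i \<and> u i * q (base i) = u i"
    by (intro bchoice) blast
  then obtain u where u: "\<And>i. i \<in> E \<Longrightarrow> u i \<in> C" "\<And>i. i \<in> E \<Longrightarrow> star (u i) * u i = q (base i)"
    "\<And>i. i \<in> E \<Longrightarrow> u i * star (u i) = q i" "\<And>i. i \<in> E \<Longrightarrow> q i * u i = u i"
    "\<And>i. i \<in> E \<Longrightarrow> u i * q (base i) = u i"
    by blast
  have "\<exists>v. norm v = 1 \<and> op_apply (q i) v = v" if "i \<in> E" for i
    using op_projection_nonzero[OF qD(2,3)[OF that]] by blast
  then have "\<exists>v. \<forall>i\<in>E. norm (v i) = 1 \<and> op_apply (q i) (v i) = v i"
    by (intro bchoice) blast
  then obtain v where v: "\<And>i. i \<in> E \<Longrightarrow> norm (v i) = 1" "\<And>i. i \<in> E \<Longrightarrow> op_apply (q i) (v i) = v i"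
    by blast
  define z where "z i = op_apply (u i) (v (base i))" for i
  have qz: "op_apply (q i) (z i) = z i" if "i \<in> E" for i
    using u(4)[OF that] by (simp add: z_def flip: op_apply_times)
  have sz: "op_apply (star (u i)) (z i) = v (base i)" if "i \<in> E" for i
    using u(2)[OF that] v(2)[OF base(1)[OF that]] by (simp add: z_def flip: op_apply_times)
  have qz0: "op_apply (q i) (z j) = 0" if "i \<in> E" "j \<in> E" "i \<noteq> j" for i j
    using orthogonal[OF that] qz[OF that(2)] by (metis op_apply_times op_apply_zero(2))
  have z: "orthonormal_family E z"
    unfolding orthonormal_family_def
  proof (intro ballI)
    fix i j assume ij: "i \<in> E" "j \<in> E"
    have "cinner (z i) (z j) = cinner (z i) (op_apply (q i) (z j))"
      using qz[OF ij(1)] by (metis cinner_star_left qD(4)[OF ij(1)])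
    moreover have "cinner (z i) (z i) = cinner (v (base i)) (v (base i))"
      using sz[OF ij(1)] unfolding z_def[of i] by (metis cinner_star_right)
    ultimately show "cinner (z i) (z j) = (if i = j then 1 else 0)"
      using qz0[OF ij] v(1)[OF base(1)[OF ij(1)]] by (auto simp: cinner_self)
  qed
  have units: "\<exists>x\<in>C. op_apply x (z j) = z i \<and> (\<forall>k\<in>E. k \<noteq> j \<longrightarrow> op_apply x (z k) = 0)"
    if ij: "i \<in> E" "j \<in> E" "block i = block j" for i j
  proof (intro bexI conjI ballI impI)
    show "u i * star (u j) \<in> C"
      by (intro intros u(1) ij)
    show "op_apply (u i * star (u j)) (z j) = z i"
      unfolding op_apply_times sz[OF ij(2)] by (simp add: z_def base_eq[OF ij(3)])
    fix k assume "k \<in> E" "k \<noteq> j"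
    have "op_apply (star (u j)) (z k) = op_apply (star (u j)) (op_apply (q j) (z k))"
      using mult_eq_star[OF u(4)[OF ij(2)]] qD(4)[OF ij(2)] by (metis op_apply_times)
    then show "op_apply (u i * star (u j)) (z k) = 0"
      using qz0[OF ij(2) \<open>k \<in> E\<close>] \<open>k \<noteq> j\<close> by simp
  qed
  have invariant: "basis_transfer E z z (op_apply d (z i)) = op_apply d (z i)" if d: "d \<in> C" and i: "i \<in> E" for d i
  proof -
    define p where "p = q (base i)"
    define w where "w = v (base i)"
    have p: "minimal_projection p"
      unfolding p_def by (rule minimal[OF base(1)[OF i]])
    have w: "norm w = 1" "op_apply p w = w"
      unfolding p_def w_def using v base(1)[OF i] by auto
    define y where "y = op_apply d (z i)"
    define y' where "y' = basis_transfer E z z y"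
    define S where "S = {s \<in> C. s * p = s}"
    define N where "N = (\<lambda>s. op_apply s w) ` S"
    have isometric: "norm (op_apply s w) = norm s" if "s \<in> S" for s
      using minimal_corner_norm(1)[OF p _ w(2), of s] that w(1) by (simp add: S_def)
    have S: "subspace S"
      by (auto simp: subspace_def S_def distrib_right intro: intros)
    have "closed {s :: 'k bounded_operator. s * p = s}"
      by (intro closed_Collect_eq continuous_intros)
    then have "complete S"
      unfolding S_def complete_eq_closed
      using closed_Int[OF cstar_subalgebra_closed[OF subalgebra]] by (simp add: Collect_conj_eq)
    then have "complete N"
      unfolding N_def
      by (intro complete_isometric_image[where e = 1] S bounded_linear_op_apply_left) (simp_all add: isometric)
    then have N: "closed N" "subspace N"
      unfolding N_def complete_eq_closed
      by (simp_all add: linear_subspace_image[OF bounded_linear.linear[OF bounded_linear_op_apply_left] S])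
    define d' where "d' = d * u i"
    have d': "d' \<in> C" "d' * p = d'"
      unfolding d'_def p_def using u(5)[OF i] by (auto simp: mult.assoc intro: intros d u(1)[OF i])
    have y_eq: "y = op_apply d' w"
      by (simp add: y_def d'_def z_def w_def)
    have y_N: "y \<in> N"
      unfolding N_def y_eq S_def using d' by blast
    have coeff: "\<exists>c. op_apply (q j) y = c *\<^sub>C z j \<and> (block j \<noteq> block i \<longrightarrow> c = 0)" if j: "j \<in> E" for j
    proof (cases "block j = block i")
      case True
      obtain c where c: "p * (star (u j) * d') * p = c *\<^sub>C p"
        by (rule minimal_corner[OF p, of "star (u j) * d'"]) (use d' u(1)[OF j] in \<open>auto intro: intros\<close>)
      have bj: "base j = base i"
        by (rule base_eq[OF True])
      have "p * star (u j) = star (u j)"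
        using mult_eq_star[OF u(5)[OF j]] minimal_projectionD(4)[OF p] by (simp add: p_def bj)
      then have "star (u j) * d' = c *\<^sub>C p"
        using c d'(2) by (metis mult.assoc)
      then have "q j * d' = c *\<^sub>C (u j * p)"
        using u(3)[OF j] by (metis mult.assoc mult_scaleC_right)
      then have "op_apply (q j) y = c *\<^sub>C z j"
        using u(5)[OF j] by (simp add: y_eq z_def w_def bj p_def flip: op_apply_times)
      with True show ?thesis
        by blast
    next
      case False
      then have "q j * d' * p = 0"
        unfolding p_def using disconnected[OF j base(1)[OF i]] base(2)[OF i] d'(1) by simp
      then have "op_apply (q j) y = 0"
        using d'(2) by (metis mult.assoc op_apply_times op_apply_zero(2) y_eq)
      then show ?thesis
        by (intro exI[of _ 0]) simp
    qed
    have z_coeff: "cinner x (z j) = cinner (op_apply (q j) x) (z j)" if "j \<in> E" for x j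
      by (metis cinner_star_left qD(4)[OF that] qz[OF that])
    have y_coeff: "op_apply (q j) y = cinner y (z j) *\<^sub>C z j" "block j \<noteq> block i \<Longrightarrow> cinner y (z j) = 0"
      if j: "j \<in> E" for j
      using coeff[OF j] z_coeff[OF j, of y] orthonormal_familyD[OF z j j] by (auto simp: cinner_scaleC_left)
    have y'_N: "y' \<in> N"
      unfolding y'_def
    proof (rule has_sum_in_closed_subspace[OF basis_transfer_has_sum[OF z z] N])
      fix j assume j: "j \<in> E"
      show "cinner y (z j) *\<^sub>C z j \<in> N"
      proof (cases "block j = block i")
        case True
        have "cinner y (z j) *\<^sub>C u j \<in> S"
          using u(5)[OF j] base_eq[OF True]
          by (auto simp: S_def p_def mult_scaleC_left intro: intros u(1)[OF j])
        then have "op_apply (cinner y (z j) *\<^sub>C u j) w \<in> N"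
          unfolding N_def by (rule imageI)
        then show ?thesis
          by (simp add: z_def w_def base_eq[OF True])
      next
        case False
        then show ?thesis
          using y_coeff(2)[OF j] subspace_0[OF N(2)] by simp
      qed
    qed
    have y'_coeff: "op_apply (q j) y' = cinner y' (z j) *\<^sub>C z j" if j: "j \<in> E" for j
    proof -
      have "y' \<in> {x. op_apply (q j) x = cinner x (z j) *\<^sub>C z j}"
        unfolding y'_def
      proof (rule has_sum_in_closed_subspace[OF basis_transfer_has_sum[OF z z]])
        have "bounded_linear (\<lambda>x. cinner x (z j) *\<^sub>C z j)"
          by (rule bounded_linear_intro[where K = "norm (z j) * norm (z j)"])
            (auto simp: cinner_add_left scaleC_add_left cinner_scaleC_left norm_scaleC_complex_inner
              scaleC_scaleC mult_right_mono cmod_cinner_le simp flip: scaleC_of_real mult.assoc)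
        then show "closed {x. op_apply (q j) x = cinner x (z j) *\<^sub>C z j}"
          by (intro closed_Collect_eq linear_continuous_on bounded_linear_op_apply)
        show "subspace {x. op_apply (q j) x = cinner x (z j) *\<^sub>C z j}"
          by (auto simp: subspace_def op_apply_add op_apply_scaleC cinner_add_left scaleC_add_left
              cinner_scaleC_left scaleC_scaleC simp flip: scaleC_of_real)
        fix k assume k: "k \<in> E"
        then show "cinner y (z k) *\<^sub>C z k \<in> {x. op_apply (q j) x = cinner x (z j) *\<^sub>C z j}"
          using qz[OF j] qz0[OF j k] orthonormal_familyD[OF z k j]
          by (auto simp: op_apply_scaleC cinner_scaleC_left)
      qed
      then show ?thesis by simp
    qed
    have "y - y' \<in> N"
      by (rule subspace_diff[OF N(2) y_N y'_N])
    then obtain s where s: "s \<in> S" "y - y' = op_apply s w"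
      unfolding N_def by blast
    have "q j * s = 0" if j: "j \<in> E" for j
    proof -
      have "cinner y' (z j) = cinner y (z j)"
        unfolding y'_def using j by (simp add: basis_transfer_adjoint[OF z z] basis_transfer_basis[OF z z])
      then have "op_apply (q j * s) w = 0"
        using y_coeff(1)[OF j] y'_coeff[OF j] by (simp add: op_apply_diff flip: s(2))
      moreover have "q j * s \<in> S"
        using s(1) qD(1)[OF j] by (auto simp: S_def mult.assoc intro: intros)
      ultimately show ?thesis
        using isometric[of "q j * s"] by simp
    qed
    then have "s = 0"
      using maximal[of s] s(1) by (simp add: S_def)
    then show ?thesis
      using s(2) by (simp add: y_def y'_def)
  qed
  show thesis
    by (rule that[OF z qz units invariant])
qed

end

section \<open>Rank-one operators\<close>

definition rank_one :: "'h::complex_hilbert_space \<Rightarrow> 'h \<Rightarrow> 'h bounded_operator"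
  where "rank_one x y = op_of_blinfun (Blinfun (\<lambda>u. cinner u y *\<^sub>C x))"

lemma op_apply_rank_one [simp]: "op_apply (rank_one x y) u = cinner u y *\<^sub>C x"
proof -
  have "bounded_linear (\<lambda>u. cinner u y *\<^sub>C x)"
  proof (rule bounded_linear_intro[where K = "norm y * norm x"])
    show "norm (cinner u y *\<^sub>C x) \<le> norm u * (norm y * norm x)" for u
      using mult_right_mono[OF cmod_cinner_le[of u y], of "norm x"]
      by (simp add: norm_scaleC_complex_inner mult.assoc)
    show "cinner (r *\<^sub>R u) y *\<^sub>C x = r *\<^sub>R (cinner u y *\<^sub>C x)" for r u
      by (simp only: cinner_scaleR_left scaleC_scaleC[symmetric] scaleC_of_real)
  qed (simp add: cinner_add_left scaleC_add_left)
  then show ?thesis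
    by (simp add: rank_one_def op_apply.rep_eq op_of_blinfun_inverse bounded_linear_Blinfun_apply
        cinner_scaleC_left scaleC_scaleC)
qed

lemma star_rank_one: "star (rank_one x y) = rank_one y x"
proof (rule star_eqI)
  fix u v
  show "cinner (op_apply (rank_one x y) u) v = cinner u (op_apply (rank_one y x) v)"
    using cinner_commute[of x v] by (simp add: cinner_scaleC_left cinner_scaleC_right mult.commute)
qed

lemma mult_rank_one: "A * rank_one x y = rank_one (op_apply A x) y"
  by (rule op_eqI) (simp add: op_apply_scaleC)

lemma rank_one_mult: "rank_one x y * A = rank_one x (op_apply (star A) y)"
  by (rule op_eqI) (simp add: cinner_star_right)

lemma norm_rank_one_le: "norm (rank_one x y) \<le> norm x * norm y"
proof (rule norm_op_bound)
  show "norm (op_apply (rank_one x y) u) \<le> norm x * norm y * norm u" for u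
    using mult_left_mono[OF cmod_cinner_le[of u y], of "norm x"]
    by (simp add: norm_scaleC_complex_inner algebra_simps)
qed simp

lemma bounded_linear_rank_one_right: "bounded_linear (rank_one x)"
proof (rule bounded_linear_intro[where K = "norm x"])
  show "rank_one x (y + y') = rank_one x y + rank_one x y'" for y y'
    by (rule op_eqI) (simp add: cinner_add_right scaleC_add_left)
  show "rank_one x (r *\<^sub>R y) = r *\<^sub>R rank_one x y" for r y
    by (rule op_eqI) (simp only: op_apply_rank_one cinner_scaleR_right scaleC_scaleC[symmetric]
        scaleC_of_real op_apply_scaleR_left)
  show "norm (rank_one x y) \<le> norm y * norm x" for y
    using norm_rank_one_le[of x y] by (simp add: mult.commute)
qed

lemma rank_one_scaleC_right: "rank_one x (c *\<^sub>C y) = cnj c *\<^sub>C rank_one x y"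
  by (rule op_eqI) (simp add: cinner_scaleC_right scaleC_scaleC)

lemma rank_one_eq_0_iff: "rank_one x y = 0 \<longleftrightarrow> x = 0 \<or> y = 0"
proof
  assume "rank_one x y = 0"
  then have "op_apply (rank_one x y) y = 0"
    by simp
  then show "x = 0 \<or> y = 0"
    by (auto simp: scaleC_eq_0_iff cinner_self_eq_0_iff)
qed (auto intro: op_eqI)

lemma rank_one_zero [simp]: "rank_one x 0 = 0" "rank_one 0 y = 0"
  by (simp_all add: rank_one_eq_0_iff)

lemma compact_operators_rank_one: "rank_one x y \<in> compact_operators"
proof (rule compact_operatorI_subseq)
  fix u :: "nat \<Rightarrow> 'a" assume u: "\<And>n. norm (u n) \<le> 1"
  have "norm (cinner (u n) y) \<le> norm y" for n
    using cmod_cinner_le[of "u n" y] mult_right_mono[OF u[of n], of "norm y"] by simp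
  then have "bounded (range (\<lambda>n. cinner (u n) y))"
    by (auto simp: bounded_iff)
  then obtain c r where "strict_mono (r :: nat \<Rightarrow> nat)" and c: "((\<lambda>n. cinner (u n) y) \<circ> r) \<longlonglongrightarrow> c"
    using bounded_imp_convergent_subsequence by blast
  moreover have "bounded_linear (\<lambda>c. c *\<^sub>C x)"
    by (rule bounded_linear_intro[where K = "norm x"])
      (auto simp: scaleC_add_left norm_scaleC_complex_inner scaleC_scaleC scaleR_conv_of_real simp flip: scaleC_of_real)
  from bounded_linear.tendsto[OF this c]
  have "(\<lambda>n. op_apply (rank_one x y) (u (r n))) \<longlonglongrightarrow> c *\<^sub>C x"
    by (simp add: o_def)
  ultimately show "\<exists>r l. strict_mono (r :: nat \<Rightarrow> nat) \<and> (\<lambda>n. op_apply (rank_one x y) (u (r n))) \<longlonglongrightarrow> l"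
    by blast
qed

section \<open>Compact operators that respect an orthogonal decomposition\<close>

locale orthogonal_decomposition =
  fixes \<Lambda> :: "'i set" and P :: "'i \<Rightarrow> 'h::complex_hilbert_space bounded_operator"
  assumes sum_id: "orthogonal_projections_sum_id \<Lambda> P"
begin

lemma P: "l \<in> \<Lambda> \<Longrightarrow> star (P l) = P l" "l \<in> \<Lambda> \<Longrightarrow> P l * P l = P l"
  "l \<in> \<Lambda> \<Longrightarrow> m \<in> \<Lambda> \<Longrightarrow> l \<noteq> m \<Longrightarrow> P l * P m = 0"
  "((\<lambda>l. op_apply (P l) x) has_sum x) \<Lambda>"
  using sum_id unfolding orthogonal_projections_sum_id_def by blast+

lemma cinner_P: "l \<in> \<Lambda> \<Longrightarrow> cinner (op_apply (P l) x) y = cinner x (op_apply (P l) y)"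
  by (metis P(1) cinner_star_left)

lemma P_other: "l \<in> \<Lambda> \<Longrightarrow> m \<in> \<Lambda> \<Longrightarrow> op_apply (P l) x = x \<Longrightarrow> m \<noteq> l \<Longrightarrow> op_apply (P m) x = 0"
  by (metis P(3) op_apply_times op_apply_zero(2))

definition \<K> :: "'h bounded_operator set"
  where "\<K> = commutant (P ` \<Lambda>) \<inter> compact_operators"

lemma \<K>_iff: "a \<in> \<K> \<longleftrightarrow> (\<forall>l\<in>\<Lambda>. a * P l = P l * a) \<and> a \<in> compact_operators"
  by (auto simp: \<K>_def commutant_def)

lemma \<K>_commute: "a \<in> \<K> \<Longrightarrow> l \<in> \<Lambda> \<Longrightarrow> P l * a = a * P l"
  by (simp add: \<K>_iff)

sublocale compact_operator_algebra \<K>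
proof
  note intro = cstar_subalgebra_intros[OF cstar_subalgebra_compact_operators]
  have "closed {a. \<forall>l\<in>\<Lambda>. a * P l = P l * a}"
    unfolding ball_conj_distrib Collect_ball_eq
    by (intro closed_INT ballI closed_Collect_eq continuous_intros)
  then have "closed \<K>"
    unfolding \<K>_def commutant_def using closed_compact_operators by (intro closed_Int) simp_all
  moreover have "star a \<in> \<K>" if "a \<in> \<K>" for a
    unfolding \<K>_iff
  proof (intro conjI ballI)
    fix l assume l: "l \<in> \<Lambda>"
    show "star a * P l = P l * star a"
      using arg_cong[OF \<K>_commute[OF that l], of star] by (simp add: star_mult P(1)[OF l])
  qed (use that in \<open>simp add: \<K>_iff intro\<close>)
  moreover have "a * b * P l = P l * (a * b)" if "a \<in> \<K>" "b \<in> \<K>" "l \<in> \<Lambda>" for a b l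
    using \<K>_commute[OF that(1,3)] \<K>_commute[OF that(2,3)] by (metis mult.assoc)
  ultimately show "cstar_subalgebra \<K>"
    unfolding cstar_subalgebra_def
    by (auto simp: \<K>_iff distrib_left distrib_right mult_scaleC_left mult_scaleC_right intro: intro)
  show "\<K> \<subseteq> compact_operators"
    by (simp add: \<K>_def)
qed

lemma rank_one_in:
  assumes l: "l \<in> \<Lambda>" and x: "op_apply (P l) x = x" and y: "op_apply (P l) y = y"
  shows "rank_one x y \<in> \<K>"
  unfolding \<K>_iff
proof (intro conjI ballI)
  fix m assume m: "m \<in> \<Lambda>"
  show "rank_one x y * P m = P m * rank_one x y"
  proof (cases "m = l")
    case False
    then show ?thesis
      by (simp add: mult_rank_one rank_one_mult P(1)[OF m] P_other[OF l m x] P_other[OF l m y])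
  qed (simp add: mult_rank_one rank_one_mult P(1)[OF l] x y)
qed (rule compact_operators_rank_one)

lemma minimal_projection_rank_one:
  assumes l: "l \<in> \<Lambda>" and x: "op_apply (P l) x = x" and unit: "norm x = 1"
  shows "minimal_projection (rank_one x x)"
proof (rule minimal_projectionI)
  show "rank_one x x \<in> \<K>"
    by (rule rank_one_in[OF l x x])
  show "projection (rank_one x x)"
    using unit by (simp add: projection_def star_rank_one mult_rank_one cinner_self)
  show "rank_one x x \<noteq> 0"
    using unit by (auto simp: rank_one_eq_0_iff)
  show "\<exists>c. rank_one x x * f * rank_one x x = c *\<^sub>C rank_one x x" for f
    by (rule exI[of _ "cinner (op_apply f x) x"], rule op_eqI)
      (simp add: op_apply_scaleC cinner_scaleC_left scaleC_scaleC mult.commute)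
qed

text \<open>A minimal projection \<open>p\<close> commutes with \<open>P l\<close>, so \<open>P l * p\<close> is a projection below \<open>p\<close>.\<close>

lemma minimal_projection_block:
  assumes p: "minimal_projection p" and l: "l \<in> \<Lambda>" and px: "op_apply p x \<noteq> 0" and x: "op_apply (P l) x = x"
  shows "P l * p = p"
proof -
  note pD = minimal_projectionD[OF p]
  have comm: "P l * p = p * P l"
    by (rule \<K>_commute[OF pD(1) l])
  have comp: "P l * p \<in> \<K>"
    unfolding \<K>_iff
  proof (intro conjI ballI)
    fix m assume m: "m \<in> \<Lambda>"
    show "P l * p * P m = P m * (P l * p)"
    proof (cases "m = l")
      case True
      then show ?thesis
        using comm P(2)[OF l] by (metis mult.assoc)
    next
      case False
      have "P l * p * P m = P l * P m * p"
        using \<K>_commute[OF pD(1) m] by (simp add: mult.assoc)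
      also have "\<dots> = P m * P l * p"
        using P(3)[OF l m] P(3)[OF m l] False by simp
      finally show ?thesis
        by (simp add: mult.assoc)
    qed
  qed (use pD(1) in \<open>simp add: \<K>_iff compact_operators_mult_left\<close>)
  moreover have "projection (P l * p)"
  proof -
    have "P l * p * (P l * p) = P l * (p * P l) * p"
      by (simp add: mult.assoc)
    also have "\<dots> = P l * P l * (p * p)"
      by (simp only: comm[symmetric] mult.assoc)
    finally show ?thesis
      using comm by (simp add: projection_def star_mult P(1,2)[OF l] pD)
  qed
  moreover have "p * (P l * p) = P l * p"
    using comm pD(5) by (metis mult.assoc)
  moreover have "P l * p \<noteq> 0"
  proof
    assume "P l * p = 0"
    then have "op_apply (p * P l) x = 0"
      using comm by simp
    then show False
      using px x by simp
  qed
  ultimately show ?thesis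
    using p by (auto simp: minimal_projection_def)
qed

end

locale adapted_basis = orthogonal_decomposition \<Lambda> P
  for \<Lambda> :: "'i set" and P :: "'i \<Rightarrow> 'h::complex_hilbert_space bounded_operator" +
  fixes E :: "'h set" and block :: "'h \<Rightarrow> 'i"
  assumes orthonormal: "orthonormal_family E (\<lambda>x. x)"
    and total: "(\<And>e. e \<in> E \<Longrightarrow> cinner x e = 0) \<Longrightarrow> x = 0"
    and block: "e \<in> E \<Longrightarrow> block e \<in> \<Lambda>" "e \<in> E \<Longrightarrow> op_apply (P (block e)) e = e"

context orthogonal_decomposition
begin

text \<open>
  Take a maximal orthonormal set among the unit vectors of the ranges of all \<open>P l\<close>. If \<open>x\<close> is orthogonal
  to it, so is every \<open>P l x\<close>, which must then vanish by maximality, and \<open>x\<close> is the sum of the \<open>P l x\<close>.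
\<close>

lemma ex_adapted_basis:
  obtains E and block :: "'h \<Rightarrow> 'i" where "adapted_basis \<Lambda> P E block"
proof -
  obtain E where E: "E \<subseteq> {x. norm x = 1 \<and> (\<exists>l\<in>\<Lambda>. op_apply (P l) x = x)}" and on: "orthonormal_family E (\<lambda>x. x)"
    and max: "\<And>x. x \<in> {x. norm x = 1 \<and> (\<exists>l\<in>\<Lambda>. op_apply (P l) x = x)} \<Longrightarrow>
      (\<And>e. e \<in> E \<Longrightarrow> cinner x e = 0) \<Longrightarrow> False"
    using ex_maximal_orthonormal[of "{x. norm x = 1 \<and> (\<exists>l\<in>\<Lambda>. op_apply (P l) x = x)}"] by blast
  define block where "block e = (SOME l. l \<in> \<Lambda> \<and> op_apply (P l) e = e)" for e
  have block: "block e \<in> \<Lambda> \<and> op_apply (P (block e)) e = e" if "e \<in> E" for e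
    unfolding block_def
    by (rule someI_ex[of "\<lambda>l. l \<in> \<Lambda> \<and> op_apply (P l) e = e"]) (use E that in blast)
  have "x = 0" if x: "\<And>e. e \<in> E \<Longrightarrow> cinner x e = 0" for x
  proof -
    have "op_apply (P l) x = 0" if l: "l \<in> \<Lambda>" for l
    proof (rule ccontr)
      define w where "w = op_apply (P l) x"
      assume "op_apply (P l) x \<noteq> 0"
      then have w: "w \<noteq> 0" by (simp add: w_def)
      have Pw: "op_apply (P l) w = w"
        unfolding w_def using P(2)[OF l] by (metis op_apply_times)
      have "cinner w e = 0" if e: "e \<in> E" for e
      proof -
        have "op_apply (P l) e = e \<or> op_apply (P l) e = 0"
          using block[OF e] P_other[of "block e" l e] l by blast
        then show ?thesis
          using x[OF e] by (auto simp: w_def cinner_P[OF l])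
      qed
      then show False
        using max[of "w /\<^sub>R norm w"] w Pw l by (auto simp: op_apply_scaleR cinner_scaleR_left)
    qed
    then have "((\<lambda>l. op_apply (P l) x) has_sum 0) \<Lambda>"
      by (simp add: has_sum_0)
    then show ?thesis
      using P(4)[of x] has_sum_unique by blast
  qed
  with on block have "adapted_basis \<Lambda> P E block"
    by unfold_locales blast+
  then show thesis
    by (rule that)
qed

end

context adapted_basis
begin

lemma P_basis: "e \<in> E \<Longrightarrow> l \<in> \<Lambda> \<Longrightarrow> op_apply (P l) e = (if l = block e then e else 0)"
  by (simp add: block P_other[OF block(1) _ block(2)])

lemma norm_basis: "e \<in> E \<Longrightarrow> norm e = 1"
  using orthonormal_familyD[OF orthonormal, of e e] power2_eq_imp_eq[of "norm e" 1]
  by (simp add: cinner_self flip: of_real_power)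

lemma basis_expansion: "((\<lambda>e. cinner x e *\<^sub>C e) has_sum x) E"
proof -
  have "basis_transfer E (\<lambda>x. x) (\<lambda>x. x) x = x"
    by (rule basis_transfer_eq_self[OF orthonormal]) (use total in force)
  then show ?thesis
    using basis_transfer_has_sum[OF orthonormal orthonormal, of x] by simp
qed

lemma op_eqI_basis:
  assumes "\<And>e e'. e \<in> E \<Longrightarrow> e' \<in> E \<Longrightarrow> cinner (op_apply A e) e' = cinner (op_apply B e) e'"
  shows "A = B"
proof (rule op_eqI)
  fix x
  have basis: "op_apply A e = op_apply B e" if "e \<in> E" for e
    using total[of "op_apply A e - op_apply B e"] assms[OF that] by (simp add: cinner_diff_left)
  have "closed {x. op_apply A x = op_apply B x}"
    by (intro closed_Collect_eq linear_continuous_on bounded_linear_op_apply)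
  moreover have "subspace {x. op_apply A x = op_apply B x}"
    by (auto simp: subspace_def op_apply_add op_apply_scaleR)
  ultimately have "x \<in> {x. op_apply A x = op_apply B x}"
    by (rule has_sum_in_closed_subspace[OF basis_expansion]) (simp add: op_apply_scaleC basis)
  then show "op_apply A x = op_apply B x"
    by simp
qed

lemma minimal_projection_basis: "e \<in> E \<Longrightarrow> minimal_projection (rank_one e e)"
  by (rule minimal_projection_rank_one[OF block norm_basis])

text \<open>
  A block sum is thus cut out by equations \<open>p * a = 0\<close> with minimal projections \<open>p\<close>, which are the
  equations that corresponding projections carry over.
\<close>

lemma block_sum_iff:
  assumes "a \<in> \<K>"
  shows "a \<in> block_sum \<K> P \<Lambda> \<Lambda>\<^sub>0 \<longleftrightarrow> (\<forall>e\<in>E. block e \<notin> \<Lambda>\<^sub>0 \<longrightarrow> rank_one e e * a = 0)"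
proof
  assume "a \<in> block_sum \<K> P \<Lambda> \<Lambda>\<^sub>0"
  then have zero: "P l * a = 0" if "l \<in> \<Lambda>" "l \<notin> \<Lambda>\<^sub>0" for l
    using that \<K>_commute[OF assms] by (simp add: block_sum_def)
  show "\<forall>e\<in>E. block e \<notin> \<Lambda>\<^sub>0 \<longrightarrow> rank_one e e * a = 0"
  proof (intro ballI impI)
    fix e assume e: "e \<in> E" "block e \<notin> \<Lambda>\<^sub>0"
    have "rank_one e e = rank_one e e * P (block e)"
      using e by (simp add: rank_one_mult P(1) block)
    then show "rank_one e e * a = 0"
      using zero[OF block(1) e(2)] e(1) by (metis mult.assoc mult_zero_right)
  qed
next
  assume *: "\<forall>e\<in>E. block e \<notin> \<Lambda>\<^sub>0 \<longrightarrow> rank_one e e * a = 0"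
  have "P l * a = 0" if l: "l \<in> \<Lambda>" "l \<notin> \<Lambda>\<^sub>0" for l
  proof (rule op_eqI_basis)
    fix e e' assume e: "e \<in> E" "e' \<in> E"
    show "cinner (op_apply (P l * a) e) e' = cinner (op_apply 0 e) e'"
    proof (cases "block e' = l")
      case True
      then have "rank_one e' e' * a = 0"
        using * e l by blast
      then have "cinner (op_apply a e) e' *\<^sub>C e' = 0"
        by (metis op_apply_rank_one op_apply_times op_apply_zero(2))
      then have "cinner (op_apply a e) e' = 0"
        using norm_basis[OF e(2)] by (auto simp: scaleC_eq_0_iff)
      then show ?thesis
        using True e by (simp add: cinner_P[OF l(1)] P_basis[OF e(2) l(1)])
    next
      case False
      then show ?thesis
        by (simp add: cinner_P[OF l(1)] P_basis[OF e(2) l(1)])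
    qed
  qed
  then show "a \<in> block_sum \<K> P \<Lambda> \<Lambda>\<^sub>0"
    using assms \<K>_commute[OF assms] by (simp add: block_sum_def)
qed

lemma norm_partial_expansion_le:
  assumes "finite F" "F \<subseteq> E" shows "norm (\<Sum>e\<in>F. cinner x e *\<^sub>C e) \<le> norm x"
proof -
  have "(norm (\<Sum>e\<in>F. cinner x e *\<^sub>C e))\<^sup>2 \<le> (norm x)\<^sup>2"
    unfolding norm_sum_orthonormal[OF orthonormal assms] by (rule Bessel_inequality[OF orthonormal assms])
  then show ?thesis
    by (rule power2_le_imp_le) simp
qed

text \<open>
  A compact operator \<open>a\<close> is the norm limit of the truncations \<open>(\<Sum>e\<in>F. rank_one e e) * a\<close>, because the
  expansion in the basis converges uniformly on the image of the unit ball: it suffices to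
  control it on a finite net.
\<close>

lemma matrix_units_generate:
  assumes R: "closed R" "subspace R" "\<And>c a. a \<in> R \<Longrightarrow> c *\<^sub>C a \<in> R"
    and units: "\<And>e e'. e \<in> E \<Longrightarrow> e' \<in> E \<Longrightarrow> block e = block e' \<Longrightarrow> rank_one e e' \<in> R"
    and a: "a \<in> \<K>"
  shows "a \<in> R"
proof -
  have row: "rank_one e y \<in> R" if e: "e \<in> E" and y: "op_apply (P (block e)) y = y" for e y
  proof (rule has_sum_in_closed_subspace[OF _ R(1,2)])
    show "((\<lambda>e'. rank_one e (cinner y e' *\<^sub>C e')) has_sum rank_one e y) E"
      by (rule has_sum_bounded_linear[OF bounded_linear_rank_one_right basis_expansion])
    fix e' assume e': "e' \<in> E"
    show "rank_one e (cinner y e' *\<^sub>C e') \<in> R"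
    proof (cases "block e = block e'")
      case True
      then show ?thesis
        by (simp add: rank_one_scaleC_right R(3) units[OF e e'])
    next
      case False
      have "cinner y e' = cinner y (op_apply (P (block e)) e')"
        by (metis y cinner_P[OF block(1)[OF e]])
      then have "cinner y e' = 0"
        using False by (simp add: P_basis[OF e' block(1)[OF e]])
      then show ?thesis
        using subspace_0[OF R(2)] by simp
    qed
  qed
  have in_R: "(\<Sum>e\<in>F. rank_one e e * a) \<in> R" if "F \<subseteq> E" for F
  proof (rule subspace_sum[OF R(2)])
    fix e assume "e \<in> F"
    then have e: "e \<in> E"
      using that by blast
    have "P (block e) * star a = star a * P (block e)"
      by (rule \<K>_commute[OF intros(4)[OF a] block(1)[OF e]])
    then have "op_apply (P (block e)) (op_apply (star a) e) = op_apply (star a) e"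
      by (metis op_apply_times block(2)[OF e])
    then show "rank_one e e * a \<in> R"
      unfolding rank_one_mult by (rule row[OF e])
  qed
  have "\<exists>y\<in>R. dist y a < r" if r: "0 < r" for r
  proof -
    have "a \<in> compact_operators"
      using a by (simp add: \<K>_iff)
    moreover have "0 < r / 4"
      using r by simp
    ultimately obtain K where K: "finite K" "\<And>x. norm x \<le> 1 \<Longrightarrow> \<exists>y\<in>K. dist y (op_apply a x) < r / 4"
      by (rule compact_operator_finite_net) (rule that; blast)
    have "\<forall>\<^sub>F F in finite_subsets_at_top E. \<forall>y\<in>K. dist (\<Sum>e\<in>F. cinner y e *\<^sub>C e) y < r / 4"
    proof (rule eventually_ball_finite[OF K(1)], rule ballI)
      fix y assume "y \<in> K"
      have "((\<lambda>F. \<Sum>e\<in>F. cinner y e *\<^sub>C e) \<longlongrightarrow> y) (finite_subsets_at_top E)"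
        using basis_expansion[of y] by (simp add: has_sum_def)
      then show "\<forall>\<^sub>F F in finite_subsets_at_top E. dist (\<Sum>e\<in>F. cinner y e *\<^sub>C e) y < r / 4"
        by (rule tendstoD) (rule \<open>0 < r / 4\<close>)
    qed
    moreover have "\<forall>\<^sub>F F in finite_subsets_at_top E. finite F \<and> F \<subseteq> E"
      by (rule eventually_finite_subsets_at_top_weakI) simp
    ultimately have "\<forall>\<^sub>F F in finite_subsets_at_top E.
        (\<forall>y\<in>K. dist (\<Sum>e\<in>F. cinner y e *\<^sub>C e) y < r / 4) \<and> finite F \<and> F \<subseteq> E"
      by (rule eventually_conj)
    from eventually_happens'[OF finite_subsets_at_top_neq_bot this]
    obtain F where F: "\<And>y. y \<in> K \<Longrightarrow> dist (\<Sum>e\<in>F. cinner y e *\<^sub>C e) y < r / 4" "finite F" "F \<subseteq> E"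
      by blast
    define b where "b = (\<Sum>e\<in>F. rank_one e e * a)"
    have "norm (b - a) \<le> 3 * (r / 4)"
    proof (rule norm_op_le)
      fix x :: 'h assume "norm x \<le> 1"
      then obtain y where y: "y \<in> K" "dist y (op_apply a x) < r / 4"
        using K(2) by blast
      define w where "w = op_apply a x"
      have "(\<Sum>e\<in>F. cinner w e *\<^sub>C e) = (\<Sum>e\<in>F. cinner (w - y) e *\<^sub>C e) + (\<Sum>e\<in>F. cinner y e *\<^sub>C e)"
        by (simp flip: sum.distrib scaleC_add_left cinner_add_left)
      moreover have "op_apply (b - a) x = (\<Sum>e\<in>F. cinner w e *\<^sub>C e) - w"
        by (simp add: b_def w_def op_apply_sum_left)
      ultimately have "op_apply (b - a) x
          = (\<Sum>e\<in>F. cinner (w - y) e *\<^sub>C e) + ((\<Sum>e\<in>F. cinner y e *\<^sub>C e) - y) + (y - w)"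
        by simp
      moreover have "norm (\<Sum>e\<in>F. cinner (w - y) e *\<^sub>C e) \<le> norm (w - y)"
        by (rule norm_partial_expansion_le[OF F(2,3)])
      moreover have "norm ((\<Sum>e\<in>F. cinner y e *\<^sub>C e) - y) < r / 4"
        using F(1)[OF y(1)] by (simp add: dist_norm)
      moreover have "norm (y - w) < r / 4"
        using y(2) by (simp add: w_def dist_norm)
      ultimately show "norm (op_apply (b - a) x) \<le> 3 * (r / 4)"
        by (smt (verit) norm_minus_commute norm_triangle_ineq)
    qed (use r in simp)
    then have "dist b a < r"
      using r by (simp add: dist_norm)
    moreover have "b \<in> R"
      unfolding b_def by (rule in_R[OF F(3)])
    ultimately show ?thesis
      by blast
  qed
  then show ?thesis
    using closed_approachable[OF R(1)] by blast
qed

section \<open>The isomorphism between the algebras\<close>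

text \<open>
  Compression to the closed span of the matrix basis \<open>z\<close>, which is identified with the space of \<open>P\<close>
  by \<open>z e \<mapsto> e\<close>. It is multiplicative because that span is invariant, injective by maximality, and
  onto because it is isometric and hits the matrix units.
\<close>

theorem ex_block_isomorphism:
  fixes D :: "'k::complex_hilbert_space bounded_operator set"
  assumes "maximal_orthogonal_family D E q block"
  obtains \<pi> where "star_isomorphism D \<K> \<pi>" "\<And>e. e \<in> E \<Longrightarrow> \<pi> (q e) = rank_one e e"
proof -
  interpret D: maximal_orthogonal_family D E q block
    by (rule assms)
  note qD = D.minimal_projectionD[OF D.minimal]
  obtain z where z: "orthonormal_family E z"
    and qz: "\<And>e. e \<in> E \<Longrightarrow> op_apply (q e) (z e) = z e"
    and units: "\<And>e e'. e \<in> E \<Longrightarrow> e' \<in> E \<Longrightarrow> block e = block e' \<Longrightarrow>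
      \<exists>x\<in>D. op_apply x (z e') = z e \<and> (\<forall>k\<in>E. k \<noteq> e' \<longrightarrow> op_apply x (z k) = 0)"
    and invariant: "\<And>d e. d \<in> D \<Longrightarrow> e \<in> E \<Longrightarrow> basis_transfer E z z (op_apply d (z e)) = op_apply d (z e)"
    by (rule D.ex_matrix_basis) (rule that; assumption)
  note on = orthonormal
  define W where "W = basis_transfer E (\<lambda>x. x) z"
  define V where "V = basis_transfer E z (\<lambda>x. x)"
  have W: "bounded_linear W" "\<And>c x. W (c *\<^sub>C x) = c *\<^sub>C W x" "\<And>e. e \<in> E \<Longrightarrow> W e = z e" "\<And>x. norm (W x) \<le> norm x"
    unfolding W_def using bounded_linear_basis_transfer[OF on z] basis_transfer_scaleC[OF on z]
      basis_transfer_basis[OF on z] norm_basis_transfer_le[OF on z] by auto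
  have V: "bounded_linear V" "\<And>c x. V (c *\<^sub>C x) = c *\<^sub>C V x" "\<And>e. e \<in> E \<Longrightarrow> V (z e) = e" "\<And>x. norm (V x) \<le> norm x"
    unfolding V_def using bounded_linear_basis_transfer[OF z on] basis_transfer_scaleC[OF z on]
      basis_transfer_basis[OF z on] norm_basis_transfer_le[OF z on] by auto
  have adjoint: "cinner (V y) x = cinner y (W x)" "cinner (W x) y = cinner x (V y)" for x y
    unfolding V_def W_def by (rule basis_transfer_adjoint[OF z on], rule basis_transfer_adjoint[OF on z])
  define \<pi> where "\<pi> d = op_of_blinfun (Blinfun (\<lambda>x. V (op_apply d (W x))))" for d
  have \<pi>: "op_apply (\<pi> d) x = V (op_apply d (W x))" for d x
  proof -
    have "bounded_linear (\<lambda>x. V (op_apply d (W x)))"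
      by (intro bounded_linear_compose[OF V(1)] bounded_linear_compose[OF bounded_linear_op_apply] W(1))
    then show ?thesis
      by (simp add: \<pi>_def op_apply.rep_eq[of "op_of_blinfun _"] op_of_blinfun_inverse
          bounded_linear_Blinfun_apply V(2) W(2) op_apply_scaleC)
  qed
  have VW_z: "W (V (op_apply d (z e))) = op_apply d (z e)" if "d \<in> D" "e \<in> E" for d e
    using invariant[OF that] by (simp add: V_def W_def basis_transfer_basis_transfer[OF z on z])
  have VW: "W (V (op_apply d (W x))) = op_apply d (W x)" if d: "d \<in> D" for d x
  proof -
    have cont: "bounded_linear (\<lambda>x. W (V (op_apply d (W x))))" "bounded_linear (\<lambda>x. op_apply d (W x))"
      by (intro bounded_linear_compose[OF W(1)] bounded_linear_compose[OF V(1)]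
          bounded_linear_compose[OF bounded_linear_op_apply] W(1))+
    have "x \<in> {x. W (V (op_apply d (W x))) = op_apply d (W x)}"
    proof (rule has_sum_in_closed_subspace[OF basis_expansion])
      show "closed {x. W (V (op_apply d (W x))) = op_apply d (W x)}"
        by (intro closed_Collect_eq linear_continuous_on cont)
      show "subspace {x. W (V (op_apply d (W x))) = op_apply d (W x)}"
        using linear_subspace_kernel[OF bounded_linear.linear[OF bounded_linear_sub[OF cont]]] by simp
      fix e assume "e \<in> E"
      then show "cinner x e *\<^sub>C e \<in> {x. W (V (op_apply d (W x))) = op_apply d (W x)}"
        by (simp add: V(2) W(2,3) op_apply_scaleC VW_z[OF d])
    qed
    then show ?thesis
      by simp
  qed
  have entry: "cinner (op_apply (\<pi> d) e) e' = cinner (op_apply d (z e)) (z e')" if "e \<in> E" "e' \<in> E" for d e e'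
    using that by (simp add: \<pi> adjoint W(3))
  have off_block: "cinner (op_apply d (z e)) (z e') = 0"
    if d: "d \<in> D" and e: "e \<in> E" "e' \<in> E" "block e \<noteq> block e'" for d e e'
  proof -
    have "cinner (op_apply d (z e)) (z e') = cinner (op_apply (q e' * d * q e) (z e)) (z e')"
      using cinner_star_left[of "q e'"] by (simp add: qz e qD(4))
    then show ?thesis
      using D.disconnected[OF e(2,1) _ d] e(3) by simp
  qed
  have add: "\<pi> (c + d) = \<pi> c + \<pi> d" and scale: "\<pi> (a *\<^sub>C d) = a *\<^sub>C \<pi> d" and scaleR: "\<pi> (r *\<^sub>R d) = r *\<^sub>R \<pi> d"
    and star: "\<pi> (star d) = star (\<pi> d)" for a r c d
  proof -
    show "\<pi> (c + d) = \<pi> c + \<pi> d"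
      by (rule op_eqI) (simp add: \<pi> linear_add[OF bounded_linear.linear[OF V(1)]])
    show "\<pi> (a *\<^sub>C d) = a *\<^sub>C \<pi> d" for a
      by (rule op_eqI) (simp add: \<pi> V(2))
    then show "\<pi> (r *\<^sub>R d) = r *\<^sub>R \<pi> d"
      by (metis scaleC_of_real)
    show "\<pi> (star d) = star (\<pi> d)"
      by (rule star_eqI[symmetric]) (simp add: \<pi> adjoint(1) cinner_star_right flip: adjoint(2))
  qed
  have mult: "\<pi> (c * d) = \<pi> c * \<pi> d" if "d \<in> D" for c d
    by (rule op_eqI) (simp add: \<pi> VW[OF that])
  have inj: "d = 0" if d: "d \<in> D" "\<pi> d = 0" for d
  proof -
    have "star d = 0"
    proof (rule D.maximal[OF D.intros(4)[OF d(1)]])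
      fix e assume e: "e \<in> E"
      have "op_apply d (z e) = W (op_apply (\<pi> d) e)"
        using VW_z[OF d(1) e] by (simp add: \<pi> W(3)[OF e])
      also have "\<dots> = 0"
        using linear_0[OF bounded_linear.linear[OF W(1)]] by (simp add: d(2))
      finally have "norm (d * q e) * norm (z e) = 0"
        using D.minimal_corner_norm(1)[OF D.minimal[OF e] d(1) qz[OF e]] by simp
      moreover have "z e \<noteq> 0"
        using orthonormal_familyD[OF z e e] by auto
      ultimately have "d * q e = 0"
        by simp
      from mult_eq_star[OF this] show "q e * star d = 0"
        by (simp add: qD(4)[OF e])
    qed
    then show ?thesis
      using star_star[of d] by simp
  qed
  have into: "\<pi> d \<in> \<K>" if d: "d \<in> D" for d
    unfolding \<K>_iff
  proof (intro conjI ballI)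
    fix l assume l: "l \<in> \<Lambda>"
    show "\<pi> d * P l = P l * \<pi> d"
      by (rule op_eqI_basis) (use off_block[OF d] in \<open>auto simp: cinner_P[OF l] P_basis[OF _ l] entry\<close>)
  next
    show "\<pi> d \<in> compact_operators"
    proof (rule compact_operatorI_subseq)
      fix x :: "nat \<Rightarrow> 'h" assume "\<And>n. norm (x n) \<le> 1"
      then have "norm (W (x n)) \<le> 1" for n
        using W(4)[of "x n"] by (meson order_trans)
      moreover have "d \<in> compact_operators"
        using D.compact d by blast
      ultimately obtain r l where "strict_mono (r :: nat \<Rightarrow> nat)" and l: "(\<lambda>n. op_apply d (W (x (r n)))) \<longlonglongrightarrow> l"
        using compact_operator_subseq[of d "\<lambda>n. W (x n)" 1] by metis
      then show "\<exists>r l. strict_mono (r :: nat \<Rightarrow> nat) \<and> (\<lambda>n. op_apply (\<pi> d) (x (r n))) \<longlonglongrightarrow> l"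
        using bounded_linear.tendsto[OF V(1) l] by (intro exI[of _ r] exI[of _ "V l"]) (simp add: \<pi>)
    qed
  qed
  have subspace_D: "subspace D"
    by (auto simp: subspace_def intro: D.intros)
  have linear: "bounded_linear \<pi>"
  proof (rule bounded_linear_intro[where K = 1])
    show "norm (\<pi> d) \<le> norm d * 1" for d
    proof (rule norm_op_bound)
      fix x
      have "norm (op_apply (\<pi> d) x) \<le> norm (op_apply d (W x))"
        by (simp add: \<pi> V(4))
      also have "\<dots> \<le> norm d * norm (W x)"
        by (rule norm_op_apply)
      also have "\<dots> \<le> norm d * norm x"
        by (intro mult_left_mono W(4) norm_ge_zero)
      finally show "norm (op_apply (\<pi> d) x) \<le> norm d * 1 * norm x"
        by simp
    qed simp
  qed (simp_all add: add scaleR)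
  have "norm d \<le> norm (\<pi> d)" if "d \<in> D" for d
    by (rule D.injective_star_hom_expands) (use mult star scaleR inj that in blast)+
  then have "complete (\<pi> ` D)"
    using complete_isometric_image[OF _ subspace_D linear, of 1] cstar_subalgebra_closed[OF D.subalgebra]
    by (simp add: complete_eq_closed)
  then have closed: "closed (\<pi> ` D)"
    by (simp add: complete_eq_closed)
  have "\<K> \<subseteq> \<pi> ` D"
  proof
    fix a assume "a \<in> \<K>"
    then show "a \<in> \<pi> ` D"
    proof (rule matrix_units_generate[OF closed, rotated -1])
      show "subspace (\<pi> ` D)"
        by (rule linear_subspace_image[OF bounded_linear.linear[OF linear] subspace_D])
      show "c *\<^sub>C b \<in> \<pi> ` D" if "b \<in> \<pi> ` D" for c b
        using that scale D.intros(5) by (metis imageE imageI)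
      fix e e' assume e: "e \<in> E" "e' \<in> E" "block e = block e'"
      obtain x where x: "x \<in> D" "op_apply x (z e') = z e" "\<forall>k\<in>E. k \<noteq> e' \<longrightarrow> op_apply x (z k) = 0"
        using units[OF e] by blast
      have "\<pi> x = rank_one e e'"
      proof (rule op_eqI_basis)
        fix k k' assume k: "k \<in> E" "k' \<in> E"
        show "cinner (op_apply (\<pi> x) k) k' = cinner (op_apply (rank_one e e') k) k'"
          using x(2,3) k e orthonormal_familyD[OF z e(1) k(2)]
          by (cases "k = e'") (simp_all add: entry cinner_scaleC_left orthonormal_familyD[OF on])
      qed
      then show "rank_one e e' \<in> \<pi> ` D"
        using x(1) by (metis imageI)
    qed
  qed
  then have "\<pi> ` D = \<K>"
    using into by blast
  moreover have "inj_on \<pi> D"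
  proof (rule inj_onI)
    fix c d assume "c \<in> D" "d \<in> D" "\<pi> c = \<pi> d"
    moreover from this have "\<pi> (c - d) = 0"
      using linear_diff[OF bounded_linear.linear[OF linear], of c d] by simp
    ultimately show "c = d"
      using inj[of "c - d"] D.intros(7) by auto
  qed
  ultimately have "star_isomorphism D \<K> \<pi>"
    unfolding star_isomorphism_def bij_betw_def using add mult star scale by blast
  moreover have "\<pi> (q e) = rank_one e e" if e: "e \<in> E" for e
  proof (rule op_eqI_basis)
    fix k k' assume k: "k \<in> E" "k' \<in> E"
    have "op_apply (q e) (z k) = 0" if "k \<noteq> e"
      using D.orthogonal[OF e k(1)] that by (metis op_apply_times op_apply_zero(2) qz[OF k(1)])
    then show "cinner (op_apply (\<pi> (q e)) k) k' = cinner (op_apply (rank_one e e) k) k'"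
      using k e orthonormal_familyD[OF z e k(2)]
      by (cases "k = e") (simp_all add: entry cinner_scaleC_left orthonormal_familyD[OF on] qz)
  qed
  ultimately show thesis
    using that by blast
qed

text \<open>
  Correspondence preserves orthogonality, so it is enough to describe the blocks on both sides by
  orthogonality: two minimal projections lie in the same block if and only if some minimal projection
  is orthogonal to neither of them. In \<open>D\<close>, lying in the same block means being equivalent.
\<close>

lemma ex_corresponding_family:
  fixes D :: "'k::complex_hilbert_space bounded_operator set"
  assumes "strong_BJ_isomorphic \<K> D T"
  obtains q where "maximal_orthogonal_family D E q block"
    "\<And>e a. e \<in> E \<Longrightarrow> a \<in> \<K> \<Longrightarrow> q e * T a = 0 \<longleftrightarrow> rank_one e e * a = 0"
proof -
  interpret T: strong_BJ_isomorphic \<K> D T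
    by (rule assms)
  have "\<exists>q. T.corresponding (rank_one e e) q" if "e \<in> E" for e
    using T.ex_corresponding_right[OF minimal_projection_basis[OF that]] by blast
  then have "\<exists>q. \<forall>e\<in>E. T.corresponding (rank_one e e) (q e)"
    by (intro bchoice) blast
  then obtain q where q: "\<And>e. e \<in> E \<Longrightarrow> T.corresponding (rank_one e e) (q e)"
    by blast
  have q_min: "T.D.minimal_projection (q e)" if "e \<in> E" for e
    using q[OF that] by (simp add: T.corresponding_def)
  have q_T: "q e * T a = 0 \<longleftrightarrow> rank_one e e * a = 0" if "e \<in> E" "a \<in> \<K>" for e a
    using q[OF that(1)] that(2) by (simp add: T.corresponding_def)
  have q_orth: "q e * q e' = 0" if "e \<in> E" "e' \<in> E" "e \<noteq> e'" for e e'
  proof -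
    have "rank_one e e * rank_one e' e' = 0"
      using orthonormal_familyD[OF orthonormal that(2,1)] that(3) by (simp add: mult_rank_one)
    then show ?thesis
      using T.corresponding_orthogonal_iff[OF q[OF that(1)] q[OF that(2)]] by simp
  qed
  have "maximal_orthogonal_family D E q block"
  proof
    show "d = 0" if d: "d \<in> D" "\<And>e. e \<in> E \<Longrightarrow> q e * d = 0" for d
    proof -
      obtain a where a: "a \<in> \<K>" "d = T a"
        using d(1) T.T_image by blast
      have "cinner (op_apply a x) e = 0" if e: "e \<in> E" for x e
      proof -
        have "op_apply (rank_one e e * a) x = 0"
          using d(2)[OF e] q_T[OF e a(1)] a(2) by simp
        moreover have "e \<noteq> 0"
          using norm_basis[OF e] by auto
        ultimately show ?thesis
          by (simp add: scaleC_eq_0_iff)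
      qed
      then have "a = 0"
        by (intro op_eqI) (simp add: total)
      then show "d = 0"
        using T.T_eq_0_iff[OF a(1)] a(2) by simp
    qed
    show "\<exists>d\<in>D. q e * d * q e' \<noteq> 0" if e: "e \<in> E" "e' \<in> E" "block e = block e'" for e e'
    proof -
      note qD = T.D.minimal_projectionD[OF q_min]
      show ?thesis
      proof (cases "e = e'")
        case True
        then show ?thesis
          using qD[OF e(1)] by (intro bexI[of _ "q e"]) auto
      next
        case False
        \<comment> \<open>The vector halfway between \<open>e\<close> and \<open>e'\<close> spans a minimal projection not orthogonal to either.\<close>
        define w where "w = (e + e') /\<^sub>R sqrt 2"
        have on: "cinner e e = 1" "cinner e' e' = 1" "cinner e e' = 0" "cinner e' e = 0"
          using orthonormal_familyD[OF orthonormal] e False by auto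
        have "norm (e + e') = sqrt 2"
        proof -
          have "(norm (e + e'))\<^sup>2 = 2"
            by (simp add: norm_add_sq norm_basis e on)
          then show ?thesis
            by (simp add: real_sqrt_unique)
        qed
        then have unit: "norm w = 1"
          by (simp add: w_def)
        have Pw: "op_apply (P (block e)) w = w"
          using block(2)[OF e(1)] block(2)[OF e(2)] e(3)
          by (simp add: w_def op_apply_scaleR op_apply_add)
        have w_min: "minimal_projection (rank_one w w)"
          by (rule minimal_projection_rank_one[OF block(1)[OF e(1)] Pw unit])
        obtain r where r: "T.corresponding (rank_one w w) r"
          by (rule T.ex_corresponding_right[OF w_min])
        have w0: "w \<noteq> 0" "e \<noteq> 0" "e' \<noteq> 0"
          using unit norm_basis[OF e(1)] norm_basis[OF e(2)] by auto
        have "cinner w e \<noteq> 0" "cinner w e' \<noteq> 0" "cinner e' w \<noteq> 0"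
          by (simp_all add: w_def cinner_scaleR_left cinner_scaleR_right cinner_add_left cinner_add_right on)
        then have "rank_one e e * rank_one w w \<noteq> 0" "rank_one w w * rank_one e' e' \<noteq> 0"
          by (simp_all add: mult_rank_one rank_one_eq_0_iff scaleC_eq_0_iff w0)
        then have "q e * r \<noteq> 0" "r * q e' \<noteq> 0"
          using T.corresponding_orthogonal_iff[OF q[OF e(1)] r] T.corresponding_orthogonal_iff[OF r q[OF e(2)]]
          by simp_all
        moreover have "T.D.minimal_projection r"
          using r by (simp add: T.corresponding_def)
        ultimately show ?thesis
          using T.D.minimal_projection_product_nonzero[OF qD(1,2)[OF e(1)]] T.D.minimal_projectionD(1) by blast
      qed
    qed
    show "q e * d * q e' = 0" if e: "e \<in> E" "e' \<in> E" "block e \<noteq> block e'" and d: "d \<in> D" for e e' d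
    proof (rule ccontr)
      assume nz: "q e * d * q e' \<noteq> 0"
      have "q e * q e' = 0"
        using q_orth e by blast
      then obtain r where r: "T.D.minimal_projection r" "r * q e \<noteq> 0" "r * q e' \<noteq> 0"
        by (rule T.D.minimal_projection_between[OF q_min[OF e(1)] q_min[OF e(2)] _ d nz])
      obtain p where p: "T.corresponding p r"
        by (rule T.ex_corresponding_left[OF r(1)])
      then have p_min: "minimal_projection p"
        by (simp add: T.corresponding_def)
      have below: "P (block k) * p = p" if k: "k \<in> E" and rk: "r * q k \<noteq> 0" for k
      proof -
        have "p * rank_one k k \<noteq> 0"
          using T.corresponding_orthogonal_iff[OF p q[OF k]] rk by simp
        then have "op_apply p k \<noteq> 0"
          by (auto simp: mult_rank_one)
        then show ?thesis
          by (rule minimal_projection_block[OF p_min block(1)[OF k] _ block(2)[OF k]])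
      qed
      have "p = P (block e) * P (block e') * p"
        using below[OF e(1) r(2)] below[OF e(2) r(3)] by (simp add: mult.assoc)
      then have "p = 0"
        using P(3)[OF block(1)[OF e(1)] block(1)[OF e(2)] e(3)] by simp
      then show False
        using minimal_projectionD(3)[OF p_min] by simp
    qed
  qed (use q_min q_orth in auto)
  then show thesis
    using that q_T by blast
qed

end

theorem theorem3p24:
  fixes \<Lambda> :: "'i set"
    and P :: "'i \<Rightarrow> 'h::complex_hilbert_space bounded_operator"
    and \<AA> :: "'h bounded_operator set"
    and \<BB> :: "'b::cstar_algebra set"
    and T :: "'h bounded_operator \<Rightarrow> 'b"
  assumes "orthogonal_projections_sum_id \<Lambda> P"
    and "\<AA> = commutant (P ` \<Lambda>) \<inter> compact_operators"
    and "compact_cstar_algebra TYPE('k::complex_hilbert_space) \<BB>"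
    and "strong_BJ_isomorphism \<AA> \<BB> T"
  shows "\<exists>\<Psi>. star_isomorphism \<BB> \<AA> \<Psi> \<and>
    (\<forall>\<Lambda>\<^sub>0\<subseteq>\<Lambda>. (\<Psi> \<circ> T) ` block_sum \<AA> P \<Lambda> \<Lambda>\<^sub>0 = block_sum \<AA> P \<Lambda> \<Lambda>\<^sub>0)"
proof -
  interpret orthogonal_decomposition \<Lambda> P
    by standard (rule assms(1))
  have \<AA>: "\<AA> = \<K>"
    by (simp add: assms(2) \<K>_def)
  obtain D :: "'k bounded_operator set" and \<phi> where \<BB>: "cstar_subalgebra \<BB>"
    and D: "cstar_subalgebra D" "D \<subseteq> compact_operators" and \<phi>: "star_isomorphism \<BB> D \<phi>"
    using assms(3) unfolding compact_cstar_algebra_def by blast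
  interpret D: compact_operator_algebra D
    by standard (use D in auto)
  have "strong_BJ_isomorphism \<K> D (\<phi> \<circ> T)"
    using strong_BJ_isomorphism_comp_isometric[OF _ \<BB> \<phi> star_isomorphism_isometric[OF \<BB> D.compact_operator_algebra_axioms \<phi>]]
      assms(4) \<AA> by blast
  then interpret T: strong_BJ_isomorphic \<K> D "\<phi> \<circ> T"
    by unfold_locales
  obtain E block where "adapted_basis \<Lambda> P E block"
    by (rule ex_adapted_basis)
  then interpret adapted_basis \<Lambda> P E block .
  obtain q where fam: "maximal_orthogonal_family D E q block"
    and q: "\<And>e a. e \<in> E \<Longrightarrow> a \<in> \<K> \<Longrightarrow> q e * (\<phi> \<circ> T) a = 0 \<longleftrightarrow> rank_one e e * a = 0"
    by (rule ex_corresponding_family[OF T.strong_BJ_isomorphic_axioms]) (rule that; assumption)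
  interpret F: maximal_orthogonal_family D E q block
    by (rule fam)
  obtain \<pi> where \<pi>: "star_isomorphism D \<K> \<pi>" "\<And>e. e \<in> E \<Longrightarrow> \<pi> (q e) = rank_one e e"
    by (rule ex_block_isomorphism[OF fam]) (rule that; assumption)
  note \<pi>D = star_isomorphismD[OF \<pi>(1)]
  define S where "S = \<pi> \<circ> \<phi> \<circ> T"
  have \<pi>_eq_0: "\<pi> d = 0 \<longleftrightarrow> d = 0" if "d \<in> D" for d
  proof -
    have "\<pi> 0 = 0"
      using \<pi>D(8)[of 0 0] D.intros(1) by simp
    then show ?thesis
      using inj_onD[OF \<pi>D(2), of d 0] that D.intros(1) by auto
  qed
  have S: "S ` \<K> = \<K>" "\<And>a. a \<in> \<K> \<Longrightarrow> S a \<in> \<K>"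
    using T.T_image \<pi>D(3) by (auto simp: S_def image_comp[symmetric] o_assoc[symmetric])
  have S_iff: "rank_one e e * S a = 0 \<longleftrightarrow> rank_one e e * a = 0" if e: "e \<in> E" and a: "a \<in> \<K>" for e a
  proof -
    have "(\<phi> \<circ> T) a \<in> D" "q e \<in> D"
      using T.T_in[OF a] F.minimal[OF e] D.minimal_projectionD(1) by auto
    then have "rank_one e e * S a = \<pi> (q e * (\<phi> \<circ> T) a)"
      using \<pi>(2)[OF e] by (simp add: S_def \<pi>D)
    then show ?thesis
      using \<pi>_eq_0 q[OF e a] D.intros(3) \<open>(\<phi> \<circ> T) a \<in> D\<close> \<open>q e \<in> D\<close> by simp
  qed
  have "S ` block_sum \<K> P \<Lambda> \<Lambda>\<^sub>0 = block_sum \<K> P \<Lambda> \<Lambda>\<^sub>0" for \<Lambda>\<^sub>0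
  proof -
    have "S a \<in> block_sum \<K> P \<Lambda> \<Lambda>\<^sub>0 \<longleftrightarrow> a \<in> block_sum \<K> P \<Lambda> \<Lambda>\<^sub>0" if "a \<in> \<K>" for a
      using that S(2)[OF that] S_iff by (simp add: block_sum_iff)
    moreover have "block_sum \<K> P \<Lambda> \<Lambda>\<^sub>0 \<subseteq> \<K>"
      by (auto simp: block_sum_def)
    moreover have "\<exists>a\<in>\<K>. b = S a" if "b \<in> \<K>" for b
      using that S(1) by (metis imageE)
    ultimately show ?thesis
      by (intro equalityI subsetI) (fast, metis image_eqI subset_iff)
  qed
  moreover have "star_isomorphism \<BB> \<K> (\<pi> \<circ> \<phi>)"
    by (rule star_isomorphism_comp[OF \<phi> \<pi>(1)])
  ultimately show ?thesis
    unfolding \<AA> S_def by blast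
qed

end
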